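(* Let $\epsilon>0$, $n\in\mathbb{N}$, let $A\in\mathcal{A}(\Sigma_{0,\epsilon})$ and let $g,g'\in C_0^\infty(M)$ be real-valued. If $\operatorname{supp}(g-g')\subset\{x\in M: x^0\ge\epsilon\}$, then $$S_{V_g}(A)=S_{V_{g'}}(A),$$ and if $\operatorname{supp}(g-g')\subset\{x\in M:x^0\le-\epsilon\}$, then $$S_{V_g}(A)=W_{g,g'}^{-1}\star_\lambda S_{V_{g'}}(A)\star_\lambda W_{g,g'},$$ where $W_{g,g'}=S(V_{g'})^{-1}\star_\lambda S(V_g)$ is (in the sense of formal power series) a unitary element of $\mathcal{A}$.
   Context: Fix $m,\lambda>0$. $M=\mathbb{R}^4$, points $x=(x^0,\mathbf{x})$; $\omega(\mathbf{p})=\sqrt{|\mathbf{p}|^2+m^2}$ for $\mathbf{p}\in\mathbb{R}^3$. $\Sigma_{0,\epsilon}=\{x\in M:x^0\in(-\epsilon,\epsilon)\}$. Propagators: $$\Delta_{+,\lambda}(x)=\frac{1}{(2\pi)^3}\int_{\mathbb{R}^3}\frac{d\mathbf{p}}{2\omega(\mathbf{p})}e^{-\lambda^2(2|\mathbf{p}|^2+m^2)}e^{-i(\omega(\mathbf{p})x^0-\mathbf{p}\cdot\mathbf{x})},\quad \Delta_{F,\lambda}(x)=\theta(x^0)\Delta_{+,\lambda}(x)+\theta(-x^0)\Delta_{+,\lambda}(-x).$$ Field configurations: $\mathcal{C}=C^\infty(M;\mathbb{R})\cap\mathcal{S}'(M)$. For $O\subset M$ open, $\mathcal{A}(O)$ is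 the space of functionals $A:\mathcal{C}\to\mathbb{C}$ that are finite sums of functionals $\phi\mapsto\int_{M^\ell}dx_1\cdots dx_\ell\,f(x_1,\dots,x_\ell)\,\phi(x_1)^{n_1}\cdots\phi(x_\ell)^{n_\ell}$ with $\ell\ge1$, $n_i\in\mathbb{N}_0$, and $f$ continuous with compact support in $O^\ell$; $\mathcal{A}=\mathcal{A}(M)$. Involution: $A^*(\phi)=\overline{A(\phi)}$. For a function $D$ on $M$ let $\Gamma_D=\int_{M^2}dx\,dy\,D(x-y)\frac{\delta}{\delta\phi(x)}\otimes\frac{\delta}{\delta\phi(y)}$, and let $m(A\otimes B)(\phi)=A(\phi)B(\phi)$. Products on $\mathcal{A}$: $A\star_\lambda B=m\circ e^{\Gamma_{\Delta_{+,\lambda}}}(A\otimes B)$ and the commutative product $A\cdot_{T_\lambda}B=m\circ e^{\Gamma_{\Delta_{F,\lambda}}}(A\otimes B)$. For $A\in\mathcal{A}$, $S(A)=\sum_{k\ge0}\kappa^k\frac{(-i)^k}{k!}A^{\cdot_{T_\lambda}k}\in\mathcal{A}[[\kappa]]$, with $\kappa$ a formal real parameter and $A^{\cdot_{T_\lambda}k}$ the $k$-fold $\cdot_{T_\lambda}$-power; inverses are with respect to $\star_\lambda$. $V_g(\phi)=\int_Mg(x)\phi(x)^n\,dx$, and the relative $S$ matrix is $S_{V_g}(A)=S(V_g)^{-1}\star_\lambda S(V_g+A)$. Unitarity of $W\in\mathcal{A}[[\kappa]]$ means $W^*\star_\lambda W=1=W\star_\lambda W^*$. All identities are in $\mathcal{A}[[\kappa]]$.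 *)

theory Defs
  imports
    "HOL-Analysis.Analysis"
    "HOL-Algebra.Group"
    "HOL-Library.Function_Algebras"
    "HOL-Computational_Algebra.Formal_Power_Series"
begin

section \<open>Smooth functions and tempered distributions\<close>

definition supp :: "('a::topological_space \<Rightarrow> 'b::zero) \<Rightarrow> 'a set" where
  "supp f = closure {x. f x \<noteq> 0}"

definition partial :: "'a::real_normed_vector \<Rightarrow> ('a \<Rightarrow> real) \<Rightarrow> 'a \<Rightarrow> real" where
  "partial v f = (\<lambda>x. frechet_derivative f (at x) v)"

fun partials :: "'a::real_normed_vector list \<Rightarrow> ('a \<Rightarrow> real) \<Rightarrow> 'a \<Rightarrow> real" where
  "partials [] f = f"
| "partials (v # vs) f = partials vs (partial v f)"

text \<open>A multi-index derivative is given by the list of the coordinate directions.\<close>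

definition smooth :: "('a::euclidean_space \<Rightarrow> real) \<Rightarrow> bool" where
  "smooth f \<longleftrightarrow> (\<forall>vs \<in> lists Basis. \<forall>x. partials vs f differentiable (at x))"

definition test_function :: "('a::euclidean_space \<Rightarrow> real) \<Rightarrow> bool" where
  "test_function f \<longleftrightarrow> smooth f \<and> compact (supp f)"

definition schwartz_norm :: "nat \<Rightarrow> ('a::euclidean_space \<Rightarrow> real) \<Rightarrow> real" where
  "schwartz_norm N f =
     (SUP (vs, x) \<in> {vs \<in> lists Basis. length vs \<le> N} \<times> UNIV.
        (1 + norm x) ^ N * \<bar>partials vs f x\<bar>)"

text \<open>
  The regular distribution \<open>f \<mapsto> \<integral> \<phi> f\<close> belongs to \<open>\<S>'\<close>, i.e. it is continuous on the test
  functions (a dense subspace of Schwartz space) in the topology of the Schwartz seminorms.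
  This is weaker than polynomial boundedness of \<open>\<phi>\<close>.
\<close>

definition tempered :: "('a::euclidean_space \<Rightarrow> real) \<Rightarrow> bool" where
  "tempered \<phi> \<longleftrightarrow>
     (\<exists>C N. \<forall>f. test_function f \<longrightarrow> \<bar>LINT x|lborel. \<phi> x * f x\<bar> \<le> C * schwartz_norm N f)"

lemma partials_zero: "partials vs (\<lambda>x. 0) = (\<lambda>x. 0)"
  by (induction vs) (simp_all add: partial_def)

lemma smooth_zero: "smooth (\<lambda>x. 0)"
  by (simp add: smooth_def partials_zero)

lemma smooth_differentiable: "smooth f \<Longrightarrow> f differentiable (at x)"
  unfolding smooth_def by (metis lists.Nil partials.simps(1))

lemma smooth_partial: "smooth f \<Longrightarrow> v \<in> Basis \<Longrightarrow> smooth (partial v f)"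
  unfolding smooth_def by (metis lists.Cons partials.simps(2))

lemma smooth_partials: "smooth f \<Longrightarrow> vs \<in> lists Basis \<Longrightarrow> smooth (partials vs f)"
  by (induction vs arbitrary: f) (auto simp: smooth_partial)

lemma smooth_continuous: "smooth f \<Longrightarrow> continuous_on A f"
  by (meson continuous_at_imp_continuous_on differentiable_imp_continuous_within smooth_differentiable)

lemma partial_add:
  assumes "smooth f" "smooth g"
  shows "partial v (\<lambda>x. f x + g x) = (\<lambda>x. partial v f x + partial v g x)"
proof
  fix x
  have "(f has_derivative frechet_derivative f (at x)) (at x)"
       "(g has_derivative frechet_derivative g (at x)) (at x)"
    using assms smooth_differentiable frechet_derivative_works by blast+
  from has_derivative_add[OF this] show "partial v (\<lambda>x. f x + g x) x = partial v f x + partial v g x"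
    unfolding partial_def by (metis (no_types, lifting) frechet_derivative_at)
qed

lemma partial_scale:
  assumes "smooth f"
  shows "partial v (\<lambda>x. c * f x) = (\<lambda>x. c * partial v f x)"
proof
  fix x
  have "(f has_derivative frechet_derivative f (at x)) (at x)"
    using assms smooth_differentiable frechet_derivative_works by blast+
  from has_derivative_mult_right[OF this, of c] show "partial v (\<lambda>x. c * f x) x = c * partial v f x"
    unfolding partial_def by (metis (no_types, lifting) frechet_derivative_at)
qed

lemma partials_add:
  assumes "smooth f" "smooth g" "vs \<in> lists Basis"
  shows "partials vs (\<lambda>x. f x + g x) = (\<lambda>x. partials vs f x + partials vs g x)"
  using assms by (induction vs arbitrary: f g) (auto simp: partial_add smooth_partial)

lemma partials_scale:
  assumes "smooth f" "vs \<in> lists Basis"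
  shows "partials vs (\<lambda>x. c * f x) = (\<lambda>x. c * partials vs f x)"
  using assms by (induction vs arbitrary: f) (auto simp: partial_scale smooth_partial)

lemma smooth_add:
  assumes "smooth f" "smooth g"
  shows "smooth (\<lambda>x. f x + g x)"
  unfolding smooth_def
proof (intro ballI allI)
  fix vs :: "'a list" and x :: 'a
  assume vs: "vs \<in> lists Basis"
  have "(\<lambda>x. partials vs f x + partials vs g x) differentiable (at x)"
    by (rule differentiable_add) (rule smooth_differentiable, rule smooth_partials[OF _ vs], rule assms)+
  then show "partials vs (\<lambda>x. f x + g x) differentiable (at x)"
    unfolding partials_add[OF assms vs] .
qed

lemma smooth_scale:
  assumes "smooth f"
  shows "smooth (\<lambda>x. c * f x)"
  unfolding smooth_def
proof (intro ballI allI)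
  fix vs :: "'a list" and x :: 'a
  assume vs: "vs \<in> lists Basis"
  have "partials vs f differentiable (at x)"
    by (rule smooth_differentiable, rule smooth_partials[OF _ vs], rule assms)
  then have "(\<lambda>x. c * partials vs f x) differentiable (at x)"
    using has_derivative_mult_right unfolding differentiable_def by blast
  then show "partials vs (\<lambda>x. c * f x) differentiable (at x)"
    unfolding partials_scale[OF assms vs] .
qed

lemma notin_supp: "x \<notin> supp f \<Longrightarrow> f x = 0"
  unfolding supp_def by (metis (mono_tags, lifting) closure_subset mem_Collect_eq subsetD)

lemma supp_partial: "supp (partial v f) \<subseteq> supp f"
proof -
  have "partial v f x = 0" if x: "x \<notin> supp f" for x
  proof -
    have "open (- supp f)" by (simp add: supp_def open_Compl)
    moreover have "0 = f y" if "y \<in> - supp f" for y using that notin_supp[of y f] by simp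
    ultimately have "(f has_derivative (\<lambda>h. 0)) (at x)"
      using has_derivative_transform_within_open[of "\<lambda>x. 0" "\<lambda>h. 0" x UNIV "- supp f" f] x
      by simp
    then show ?thesis unfolding partial_def by (metis frechet_derivative_at)
  qed
  then have "{x. partial v f x \<noteq> 0} \<subseteq> supp f" by auto
  then show ?thesis
    unfolding supp_def by (metis closed_closure closure_minimal)
qed

lemma supp_partials: "supp (partials vs f) \<subseteq> supp f"
proof (induction vs arbitrary: f)
  case Nil
  show ?case by simp
next
  case (Cons v vs)
  have "supp (partials vs (partial v f)) \<subseteq> supp f"
    by (rule subset_trans[OF Cons.IH supp_partial])
  then show ?case by simp
qed

lemma schwartz_bdd:
  fixes f :: "'a::euclidean_space \<Rightarrow> real"
  assumes "test_function f"
  shows "bdd_above ((\<lambda>(vs, x). (1 + norm x) ^ N * \<bar>partials vs f x\<bar>) `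
                      ({vs \<in> lists Basis. length vs \<le> N} \<times> UNIV))"
proof -
  let ?L = "{vs \<in> lists (Basis::'a set). length vs \<le> N}"
  have fin: "finite ?L"
    using finite_lists_length_le[OF finite_Basis[where 'a='a], of N] by (simp add: lists_eq_set)
  have sm: "smooth f" and cp: "compact (supp f)" using assms by (auto simp: test_function_def)
  have "\<exists>B. \<forall>x. (1 + norm x) ^ N * \<bar>partials vs f x\<bar> \<le> B" if "vs \<in> ?L" for vs
  proof -
    have "continuous_on (supp f) (\<lambda>x. (1 + norm x) ^ N * \<bar>partials vs f x\<bar>)"
      using that by (intro continuous_intros smooth_continuous smooth_partials sm) auto
    then have "compact ((\<lambda>x. (1 + norm x) ^ N * \<bar>partials vs f x\<bar>) ` supp f)"
      using cp by (rule compact_continuous_image)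
    then have "bdd_above ((\<lambda>x. (1 + norm x) ^ N * \<bar>partials vs f x\<bar>) ` supp f)"
      by (intro bounded_imp_bdd_above compact_imp_bounded)
    then obtain B where B: "\<forall>x\<in>supp f. (1 + norm x) ^ N * \<bar>partials vs f x\<bar> \<le> B"
      unfolding bdd_above_def by auto
    have "(1 + norm x) ^ N * \<bar>partials vs f x\<bar> \<le> max B 0" for x
    proof (cases "x \<in> supp f")
      case True
      with B have "(1 + norm x) ^ N * \<bar>partials vs f x\<bar> \<le> B" by (rule bspec)
      then show ?thesis by (rule max.coboundedI1)
    next
      case False
      then have "partials vs f x = 0" using notin_supp[of x "partials vs f"] supp_partials[of vs f] by auto
      then show ?thesis by simp
    qed
    then show ?thesis by blast
  qed
  then have "\<forall>vs\<in>?L. \<exists>B. \<forall>x. (1 + norm x) ^ N * \<bar>partials vs f x\<bar> \<le> B" by (rule ballI)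
  then obtain B where "\<forall>vs\<in>?L. \<forall>x. (1 + norm x) ^ N * \<bar>partials vs f x\<bar> \<le> B vs"
    by (rule bchoice[THEN exE])
  then have B: "(1 + norm x) ^ N * \<bar>partials vs f x\<bar> \<le> B vs" if "vs \<in> ?L" for vs x
    using that by blast
  have "y \<le> Max (B ` ?L)"
    if y: "y \<in> (\<lambda>(vs, x). (1 + norm x) ^ N * \<bar>partials vs f x\<bar>) ` (?L \<times> UNIV)" for y
  proof -
    obtain p where p: "y = (case p of (vs, x) \<Rightarrow> (1 + norm x) ^ N * \<bar>partials vs f x\<bar>)" "p \<in> ?L \<times> UNIV"
      using y by (rule imageE)
    obtain vs x where "p = (vs, x)" by (rule prod.exhaust)
    with p have v: "vs \<in> ?L" and yv: "y = (1 + norm x) ^ N * \<bar>partials vs f x\<bar>"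
      by simp_all
    have "y \<le> B vs" unfolding yv by (rule B[OF v])
    also have "\<dots> \<le> Max (B ` ?L)" by (rule Max_ge[OF finite_imageI[OF fin] imageI[OF v]])
    finally show ?thesis .
  qed
  then show ?thesis by (rule bdd_aboveI)
qed

lemma schwartz_norm_mono:
  fixes f :: "'a::euclidean_space \<Rightarrow> real"
  assumes "test_function f" "N \<le> N'"
  shows "schwartz_norm N f \<le> schwartz_norm N' f"
  unfolding schwartz_norm_def
proof (rule cSUP_mono)
  show "{vs \<in> lists (Basis::'a set). length vs \<le> N} \<times> (UNIV::'a set) \<noteq> {}"
    using lists.Nil by fastforce
  show "bdd_above ((\<lambda>(vs, x). (1 + norm x) ^ N' * \<bar>partials vs f x\<bar>) `
                      ({vs \<in> lists Basis. length vs \<le> N'} \<times> UNIV))"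
    by (rule schwartz_bdd[OF assms(1)])
  fix p :: "'a list \<times> 'a"
  assume p: "p \<in> {vs \<in> lists Basis. length vs \<le> N} \<times> UNIV"
  obtain vs x where vx: "p = (vs, x)" by fastforce
  have "(1 + norm x) ^ N * \<bar>partials vs f x\<bar> \<le> (1 + norm x) ^ N' * \<bar>partials vs f x\<bar>"
    using assms(2) by (intro mult_right_mono power_increasing) auto
  then show "\<exists>q\<in>{vs \<in> lists Basis. length vs \<le> N'} \<times> UNIV.
      (case p of (vs, x) \<Rightarrow> (1 + norm x) ^ N * \<bar>partials vs f x\<bar>)
      \<le> (case q of (vs, x) \<Rightarrow> (1 + norm x) ^ N' * \<bar>partials vs f x\<bar>)"
    using p vx assms(2) by (intro bexI[of _ p]) auto
qed

lemma schwartz_norm_nonneg: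
  fixes f :: "'a::euclidean_space \<Rightarrow> real"
  assumes "test_function f"
  shows "0 \<le> schwartz_norm N f"
proof -
  have "(\<lambda>(vs, x). (1 + norm x) ^ N * \<bar>partials vs f x\<bar>) ([], 0::'a) \<le> schwartz_norm N f"
    unfolding schwartz_norm_def by (rule cSUP_upper[OF _ schwartz_bdd[OF assms]]) auto
  then show ?thesis by simp
qed

lemma integrable_test:
  assumes "smooth \<phi>" "test_function f"
  shows "integrable lborel (\<lambda>x. \<phi> x * f x)"
proof -
  have "integrable lborel (\<lambda>x. indicator (supp f) x *\<^sub>R (\<phi> x * f x))"
    using assms unfolding test_function_def
    by (intro borel_integrable_compact continuous_intros smooth_continuous) auto
  moreover have "(\<lambda>x. indicator (supp f) x *\<^sub>R (\<phi> x * f x)) = (\<lambda>x. \<phi> x * f x)"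
    using notin_supp by (fastforce simp: indicator_def)
  ultimately show ?thesis by simp
qed

lemma tempered_zero: "tempered (\<lambda>x. 0)"
  unfolding tempered_def by (rule exI[of _ 0], rule exI[of _ 0]) simp

lemma tempered_add:
  assumes "smooth \<phi>" "smooth \<psi>" "tempered \<phi>" "tempered \<psi>"
  shows "tempered (\<lambda>x. \<phi> x + \<psi> x)"
proof -
  obtain C N where 1: "\<And>f. test_function f \<Longrightarrow> \<bar>LINT x|lborel. \<phi> x * f x\<bar> \<le> C * schwartz_norm N f"
    using assms(3) unfolding tempered_def by blast
  obtain C' N' where 2: "\<And>f. test_function f \<Longrightarrow> \<bar>LINT x|lborel. \<psi> x * f x\<bar> \<le> C' * schwartz_norm N' f"
    using assms(4) unfolding tempered_def by blast
  have "\<bar>LINT x|lborel. (\<phi> x + \<psi> x) * f x\<bar> \<le> (\<bar>C\<bar> + \<bar>C'\<bar>) * schwartz_norm (max N N') f"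
    if f: "test_function f" for f
  proof -
    have "(LINT x|lborel. (\<phi> x + \<psi> x) * f x) = (LINT x|lborel. \<phi> x * f x) + (LINT x|lborel. \<psi> x * f x)"
      using integrable_test[OF assms(1) f] integrable_test[OF assms(2) f]
      by (simp add: distrib_right)
    moreover have "C * schwartz_norm N f \<le> \<bar>C\<bar> * schwartz_norm (max N N') f"
      using f schwartz_norm_mono[OF f, of N "max N N'"] schwartz_norm_nonneg[OF f, of N]
      by (intro mult_mono) auto
    moreover have "C' * schwartz_norm N' f \<le> \<bar>C'\<bar> * schwartz_norm (max N N') f"
      using f schwartz_norm_mono[OF f, of N' "max N N'"] schwartz_norm_nonneg[OF f, of N']
      by (intro mult_mono) auto
    ultimately show ?thesis using 1[OF f] 2[OF f] unfolding distrib_right by linarith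
  qed
  then show ?thesis unfolding tempered_def by blast
qed

lemma tempered_scale:
  assumes "tempered \<phi>"
  shows "tempered (\<lambda>x. c * \<phi> x)"
proof -
  obtain C N where 1: "\<And>f. test_function f \<Longrightarrow> \<bar>LINT x|lborel. \<phi> x * f x\<bar> \<le> C * schwartz_norm N f"
    using assms unfolding tempered_def by blast
  have "\<bar>LINT x|lborel. c * \<phi> x * f x\<bar> \<le> (\<bar>c\<bar> * C) * schwartz_norm N f"
    if f: "test_function f" for f
    using mult_left_mono[OF 1[OF f], of "\<bar>c\<bar>"] by (simp add: mult.assoc abs_mult)
  then show ?thesis unfolding tempered_def by blast
qed

section \<open>Field configurations and functionals\<close>

type_synonym spacetime = "real \<times> (real ^ 3)"

typedef config = "{\<phi> :: spacetime \<Rightarrow> real. smooth \<phi> \<and> tempered \<phi>}"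
  morphisms config_fun Config
  by (rule exI[of _ "\<lambda>x. 0"]) (simp add: smooth_zero tempered_zero)

instantiation config :: real_vector
begin

definition zero_config :: config where "0 = Config (\<lambda>x. 0)"
definition plus_config :: "config \<Rightarrow> config \<Rightarrow> config" where
  "\<phi> + \<psi> = Config (\<lambda>x. config_fun \<phi> x + config_fun \<psi> x)"
definition scaleR_config :: "real \<Rightarrow> config \<Rightarrow> config" where
  "c *\<^sub>R \<phi> = Config (\<lambda>x. c * config_fun \<phi> x)"
definition uminus_config :: "config \<Rightarrow> config" where "- \<phi> = (-1) *\<^sub>R (\<phi> :: config)"
definition minus_config :: "config \<Rightarrow> config \<Rightarrow> config" where "\<phi> - \<psi> = \<phi> + - (\<psi> :: config)"

lemma config_fun_zero: "config_fun 0 x = 0"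
  unfolding zero_config_def by (subst Config_inverse) (simp_all add: smooth_zero tempered_zero)

lemma config_fun_add: "config_fun (\<phi> + \<psi>) x = config_fun \<phi> x + config_fun \<psi> x"
proof -
  have "(\<lambda>x. config_fun \<phi> x + config_fun \<psi> x) \<in> {\<phi>. smooth \<phi> \<and> tempered \<phi>}"
    using smooth_add[of "config_fun \<phi>" "config_fun \<psi>"] tempered_add[of "config_fun \<phi>" "config_fun \<psi>"]
      config_fun[of \<phi>] config_fun[of \<psi>] by blast
  then show ?thesis unfolding plus_config_def by (simp only: Config_inverse)
qed

lemma config_fun_scaleR: "config_fun (c *\<^sub>R \<phi>) x = c * config_fun \<phi> x"
proof -
  have "(\<lambda>x. c * config_fun \<phi> x) \<in> {\<phi>. smooth \<phi> \<and> tempered \<phi>}"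
    using smooth_scale[of "config_fun \<phi>" c] tempered_scale[of "config_fun \<phi>" c] config_fun[of \<phi>]
    by blast
  then show ?thesis unfolding scaleR_config_def by (simp only: Config_inverse)
qed

lemma config_eqI: "(\<And>x. config_fun \<phi> x = config_fun \<psi> x) \<Longrightarrow> \<phi> = \<psi>"
  using config_fun_inject[of \<phi> \<psi>] by (simp add: fun_eq_iff)

instance
proof
  fix a b :: real and x y z :: config
  note F = config_fun_zero config_fun_add config_fun_scaleR uminus_config_def minus_config_def
  show "x + y + z = x + (y + z)" by (rule config_eqI) (simp only: F add.assoc)
  show "x + y = y + x" by (rule config_eqI) (simp only: F add.commute)
  show "0 + x = x" by (rule config_eqI) (simp only: F add_0)
  show "- x + x = 0" by (rule config_eqI) (simp add: F)
  show "x - y = x + - y" by (simp only: minus_config_def)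
  show "a *\<^sub>R (x + y) = a *\<^sub>R x + a *\<^sub>R y" by (rule config_eqI) (simp only: F distrib_left)
  show "(a + b) *\<^sub>R x = a *\<^sub>R x + b *\<^sub>R x" by (rule config_eqI) (simp only: F distrib_right)
  show "a *\<^sub>R b *\<^sub>R x = (a * b) *\<^sub>R x" by (rule config_eqI) (simp only: F mult.assoc)
  show "1 *\<^sub>R x = x" by (rule config_eqI) (simp only: F mult_1)
qed

end

type_synonym functional = "config \<Rightarrow> complex"

definition multilocal :: "nat \<Rightarrow> (nat \<Rightarrow> nat) \<Rightarrow> ((nat \<Rightarrow> spacetime) \<Rightarrow> complex) \<Rightarrow> functional" where
  "multilocal l ns f = (\<lambda>\<phi>. LINT x|(\<Pi>\<^sub>M i\<in>{..<l}. lborel). f x * of_real (\<Prod>i<l. config_fun \<phi> (x i) ^ ns i))"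

text \<open>
  Continuous functions with compact support in \<open>U\<^sup>l\<close>.  Points of \<open>M\<^sup>l\<close> are the extensional functions
  on \<open>{..<l}\<close>, with the topology induced by the product topology on \<^typ>\<open>nat \<Rightarrow> spacetime\<close>.
\<close>

definition kernels :: "spacetime set \<Rightarrow> nat \<Rightarrow> ((nat \<Rightarrow> spacetime) \<Rightarrow> complex) set" where
  "kernels U l = {f. continuous_on (\<Pi>\<^sub>E i\<in>{..<l}. UNIV) f \<and>
     (\<exists>K. compact K \<and> K \<subseteq> (\<Pi>\<^sub>E i\<in>{..<l}. U) \<and> (\<forall>x \<in> (\<Pi>\<^sub>E i\<in>{..<l}. UNIV) - K. f x = 0))}"

definition local_alg :: "spacetime set \<Rightarrow> functional set" where
  "local_alg U = {A. \<exists>(N::nat) l ns f.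
     (\<forall>j<N. 1 \<le> l j \<and> f j \<in> kernels U (l j)) \<and> A = (\<Sum>j<N. multilocal (l j) (ns j) (f j))}"

definition time_slab :: "real \<Rightarrow> spacetime set" where
  "time_slab \<epsilon> = {x. - \<epsilon> < fst x \<and> fst x < \<epsilon>}"

definition involution :: "functional \<Rightarrow> functional" where
  "involution A = (\<lambda>\<phi>. cnj (A \<phi>))"

section \<open>Propagators\<close>

definition omega :: "real \<Rightarrow> real ^ 3 \<Rightarrow> real" where
  "omega m p = sqrt ((norm p)\<^sup>2 + m\<^sup>2)"

definition Delta_plus :: "real \<Rightarrow> real \<Rightarrow> spacetime \<Rightarrow> complex" where
  "Delta_plus m lam x = 1 / (2 * of_real pi) ^ 3 *
     (LINT p|lborel. of_real (1 / (2 * omega m p) * exp (- lam\<^sup>2 * (2 * (norm p)\<^sup>2 + m\<^sup>2))) *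
        exp (- \<i> * of_real (omega m p * fst x - p \<bullet> snd x)))"

text \<open>
  With \<open>\<theta>(0) = 1/2\<close> the Feynman propagator is continuous, because \<open>\<Delta>\<^sub>+\<close> is even in the spatial
  argument at time 0; other choices change it only on the null set of points of time 0.
\<close>

definition theta :: "real \<Rightarrow> real" where
  "theta t = (if t < 0 then 0 else if t = 0 then 1 / 2 else 1)"

definition Delta_F :: "real \<Rightarrow> real \<Rightarrow> spacetime \<Rightarrow> complex" where
  "Delta_F m lam x = of_real (theta (fst x)) * Delta_plus m lam x
                   + of_real (theta (- fst x)) * Delta_plus m lam (- x)"

section \<open>Functional derivatives and products\<close>

text \<open>
  \<open>\<delta>A/\<delta>\<phi>(x)\<close> as a functional of \<open>\<phi>\<close>, for fixed \<open>x\<close>.  The density with respect to Lebesgue measure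
  is pinned down by continuity and compact support; for \<open>A\<close> in \<open>local_alg UNIV\<close> it exists.
\<close>

definition func_deriv :: "spacetime \<Rightarrow> functional \<Rightarrow> functional" where
  "func_deriv x A \<phi> =
     (THE k :: spacetime \<Rightarrow> complex.
        continuous_on UNIV k \<and> compact (supp k) \<and>
        (\<forall>h :: config. ((\<lambda>t. A (\<phi> + t *\<^sub>R h)) has_vector_derivative
                          (LINT y|lborel. k y * of_real (config_fun h y))) (at 0))) x"

text \<open>
  Elements of tensor products of spaces of functionals are treated as functionals of two
  configurations, with \<open>(A \<otimes> B)(\<phi>,\<psi>) = A(\<phi>) B(\<psi>)\<close>.
\<close>

type_synonym bifunctional = "config \<Rightarrow> config \<Rightarrow> complex"

definition tensor :: "functional \<Rightarrow> functional \<Rightarrow> bifunctional" where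
  "tensor A B = (\<lambda>\<phi> \<psi>. A \<phi> * B \<psi>)"

definition diag :: "bifunctional \<Rightarrow> functional" where
  "diag F = (\<lambda>\<phi>. F \<phi> \<phi>)"

definition func_deriv_left :: "spacetime \<Rightarrow> bifunctional \<Rightarrow> bifunctional" where
  "func_deriv_left x F = (\<lambda>\<phi> \<psi>. func_deriv x (\<lambda>\<phi>'. F \<phi>' \<psi>) \<phi>)"

definition func_deriv_right :: "spacetime \<Rightarrow> bifunctional \<Rightarrow> bifunctional" where
  "func_deriv_right y F = (\<lambda>\<phi> \<psi>. func_deriv y (\<lambda>\<psi>'. F \<phi> \<psi>') \<psi>)"

definition Gamma_op :: "(spacetime \<Rightarrow> complex) \<Rightarrow> bifunctional \<Rightarrow> bifunctional" where
  "Gamma_op D F = (\<lambda>\<phi> \<psi>. LINT z|lborel.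
     D (fst z - snd z) * func_deriv_right (snd z) (func_deriv_left (fst z) F) \<phi> \<psi>)"

text \<open>On \<open>A \<otimes> B\<close> with \<open>A\<close>, \<open>B\<close> in \<open>local_alg UNIV\<close> only finitely many terms are nonzero.\<close>

definition exp_Gamma :: "(spacetime \<Rightarrow> complex) \<Rightarrow> bifunctional \<Rightarrow> bifunctional" where
  "exp_Gamma D F = (\<lambda>\<phi> \<psi>. \<Sum>k. (Gamma_op D ^^ k) F \<phi> \<psi> / fact k)"

definition star :: "real \<Rightarrow> real \<Rightarrow> functional \<Rightarrow> functional \<Rightarrow> functional" where
  "star m lam A B = diag (exp_Gamma (Delta_plus m lam) (tensor A B))"

definition T_prod :: "real \<Rightarrow> real \<Rightarrow> functional \<Rightarrow> functional \<Rightarrow> functional" where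
  "T_prod m lam A B = diag (exp_Gamma (Delta_F m lam) (tensor A B))"

definition T_monoid :: "real \<Rightarrow> real \<Rightarrow> functional monoid" where
  "T_monoid m lam = \<lparr>carrier = local_alg UNIV, monoid.mult = T_prod m lam, one = 1\<rparr>"

section \<open>Formal power series in the coupling and S-matrices\<close>

definition fps_star :: "real \<Rightarrow> real \<Rightarrow> functional fps \<Rightarrow> functional fps \<Rightarrow> functional fps" where
  "fps_star m lam X Y = Abs_fps (\<lambda>k. \<Sum>i\<le>k. star m lam (fps_nth X i) (fps_nth Y (k - i)))"

text \<open>The algebra of formal power series over \<open>local_alg UNIV\<close> with the star product.\<close>

definition star_alg :: "real \<Rightarrow> real \<Rightarrow> functional fps monoid" where
  "star_alg m lam =
     \<lparr>carrier = {X. \<forall>k. fps_nth X k \<in> local_alg UNIV}, monoid.mult = fps_star m lam, one = 1\<rparr>"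

definition fps_involution :: "functional fps \<Rightarrow> functional fps" where
  "fps_involution X = Abs_fps (\<lambda>k. involution (fps_nth X k))"

definition star_unitary :: "real \<Rightarrow> real \<Rightarrow> functional fps \<Rightarrow> bool" where
  "star_unitary m lam W \<longleftrightarrow> W \<in> carrier (star_alg m lam) \<and>
     fps_involution W \<otimes>\<^bsub>star_alg m lam\<^esub> W = \<one>\<^bsub>star_alg m lam\<^esub> \<and>
     W \<otimes>\<^bsub>star_alg m lam\<^esub> fps_involution W = \<one>\<^bsub>star_alg m lam\<^esub>"

definition S_matrix :: "real \<Rightarrow> real \<Rightarrow> functional \<Rightarrow> functional fps" where
  "S_matrix m lam A =
     Abs_fps (\<lambda>k \<phi>. (- \<i>) ^ k / fact k * (A [^]\<^bsub>T_monoid m lam\<^esub> k) \<phi>)"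

definition interaction :: "nat \<Rightarrow> (spacetime \<Rightarrow> real) \<Rightarrow> functional" where
  "interaction n g = (\<lambda>\<phi>. of_real (LINT x|lborel. g x * config_fun \<phi> x ^ n))"

definition relative_S :: "real \<Rightarrow> real \<Rightarrow> functional \<Rightarrow> functional \<Rightarrow> functional fps" where
  "relative_S m lam V A =
     inv\<^bsub>star_alg m lam\<^esub> (S_matrix m lam V) \<otimes>\<^bsub>star_alg m lam\<^esub> S_matrix m lam (V + A)"

definition W_op ::
  "real \<Rightarrow> real \<Rightarrow> nat \<Rightarrow> (spacetime \<Rightarrow> real) \<Rightarrow> (spacetime \<Rightarrow> real) \<Rightarrow> functional fps" where
  "W_op m lam n g g' =
     inv\<^bsub>star_alg m lam\<^esub> (S_matrix m lam (interaction n g'))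
       \<otimes>\<^bsub>star_alg m lam\<^esub> S_matrix m lam (interaction n g)"

end

theory Submission
  imports Defs "HOL-Probability.Sinc_Integral"
begin

text \<open>
  All products of polynomial functionals are written as integrals over Wick sums: \<open>exp \<Gamma>\<^sub>D\<close> adds to a
  sum over matchings of the legs \<open>\<phi>(x\<^sub>i)\<close> the matchings that pair a leg of the left factor with a leg
  of the right factor, so that algebraic laws become identities between propagator assignments.
  Causality is then a pointwise cancellation.  At order \<open>k\<close> the retarded product is an integral
  over \<open>x\<^sub>1, \<dots>, x\<^sub>k\<close> of the alternating sum over \<open>S\<close> of the anti-time-ordered product of the points in \<open>S\<close>, star
  multiplied by the time-ordered product of the other points and of \<open>A\<close>.  If the latest of all points is some \<open>x\<^sub>i\<close>,
  moving \<open>x\<^sub>i\<close> into or out of \<open>S\<close> changes no propagator but flips the sign, so the sum vanishes.  Hence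
  only points earlier than \<open>\<epsilon>\<close> contribute to the relative S-matrix; for \<open>A = 1\<close> nothing contributes,
  which gives unitarity.  Reversing time and the order of the factors gives the advanced case.
\<close>

section \<open>Functional derivatives\<close>

text \<open>\<open>func_deriv\<close>, \<open>Gamma_op\<close> and \<open>exp_Gamma\<close> are
  total operations built from a definite description, an integral and an infinite sum, so even their
  additivity requires existence, uniqueness and integrability; \<open>regular\<close> and
  \<open>good\<close> keep track of this. Uniqueness of the derivative is tested on polynomials:
  they belong to \<open>config\<close>, and by Stone-Weierstrass there are enough of them, so no
  smooth bump function is constructed. Since \<open>lam > 0\<close> turns both propagators into
  continuous functions, a contraction multiplies a continuous compactly supported kernel by a
  continuous function and no distributions are multiplied. The two products then differ only in the
  continuous function \<open>D\<close>, and \<open>prod_of\<close> treats them together. Its formula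
  wants disjoint vertex sets, hence functionals are relabelled before they are multiplied. In the
  causality argument the star inverse of the S-matrix of the interaction is replaced by its adjoint,
  which is again a diagram; that the adjoint is the inverse comes out of the same cancellation, once
  for each side.\<close>

lemma integrable_inverse_one_plus_power2: "integrable lborel (\<lambda>x::real. inverse (1 + x\<^sup>2))"
  using integrable_inverse_1_plus_square by (simp add: set_integrable_def einterval_def)

text \<open>An integrable weight with polynomial decay, the arctangent density in each coordinate.
  It is the majorant both for polynomials against test functions and for the Gaussian factor of the
  propagator.\<close>

lemma integrable_prod_inverse_one_plus_power2:
  "integrable lborel (\<lambda>x::'a::euclidean_space. \<Prod>b\<in>Basis. inverse (1 + (x \<bullet> b)\<^sup>2))"
proof (rule integrableI_nonneg)
  have "(\<integral>\<^sup>+x. ennreal (\<Prod>b\<in>Basis. inverse (1 + ((x::'a) \<bullet> b)\<^sup>2)) \<partial>lborel) =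
        (\<integral>\<^sup>+x. (\<Prod>b\<in>Basis. ennreal (inverse (1 + ((x::'a) \<bullet> b)\<^sup>2))) \<partial>lborel)"
    by (simp add: prod_ennreal)
  also have "\<dots> = (\<Prod>b\<in>(Basis::'a set). (\<integral>\<^sup>+x. ennreal (inverse (1 + x\<^sup>2)) \<partial>lborel))"
    by (rule nn_integral_lborel_prod[of "\<lambda>b x. ennreal (inverse (1 + x\<^sup>2))"]) auto
  also have "\<dots> < \<infinity>"
    using integrable_inverse_one_plus_power2
    by (simp add: integrable_iff_bounded power_less_top_ennreal)
  finally show "(\<integral>\<^sup>+x. ennreal (\<Prod>b\<in>Basis. inverse (1 + ((x::'a) \<bullet> b)\<^sup>2)) \<partial>lborel) < \<infinity>" .
qed (auto intro!: prod_nonneg)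

section \<open>Polynomials are field configurations\<close>

lemma polynomial_partial:
  assumes "real_polynomial_function (p :: 'a::euclidean_space \<Rightarrow> real)"
  shows "real_polynomial_function (partial v p)"
  using assms
proof induction
  case (linear f)
  have "partial v f = (\<lambda>x. f v)"
    unfolding partial_def
    using frechet_derivative_at[OF bounded_linear_imp_has_derivative[OF linear]] by metis
  then show ?case by (simp add: real_polynomial_function.intros(2))
next
  case (const c)
  have "partial v (\<lambda>x. c) = (\<lambda>x. 0)" by (simp add: partial_def)
  then show ?case by (simp add: real_polynomial_function.intros(2))
next
  case (add f g)
  have "partial v (\<lambda>x. f x + g x) x = partial v f x + partial v g x" for x
  proof -
    have "(f has_derivative frechet_derivative f (at x)) (at x)"
      "(g has_derivative frechet_derivative g (at x)) (at x)"
      using differentiable_at_real_polynomial_function add.hyps frechet_derivative_works by blast+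
    from has_derivative_add[OF this] show ?thesis
      unfolding partial_def by (metis (no_types, lifting) frechet_derivative_at)
  qed
  then have "partial v (\<lambda>x. f x + g x) = (\<lambda>x. partial v f x + partial v g x)" by blast
  then show ?case using add.IH by auto
next
  case (mult f g)
  have "partial v (\<lambda>x. f x * g x) x = f x * partial v g x + partial v f x * g x" for x
  proof -
    have "(f has_derivative frechet_derivative f (at x)) (at x)"
      "(g has_derivative frechet_derivative g (at x)) (at x)"
      using differentiable_at_real_polynomial_function mult.hyps frechet_derivative_works by blast+
    from has_derivative_mult[OF this] show ?thesis
      unfolding partial_def by (metis (no_types, lifting) frechet_derivative_at)
  qed
  then have "partial v (\<lambda>x. f x * g x) = (\<lambda>x. f x * partial v g x + partial v f x * g x)" by blast
  then show ?case using mult by (auto intro!: real_polynomial_function.intros(3,4))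
qed

lemma polynomial_partials:
  "real_polynomial_function (p :: 'a::euclidean_space \<Rightarrow> real) \<Longrightarrow> real_polynomial_function (partials vs p)"
  by (induction vs arbitrary: p) (auto simp: polynomial_partial)

lemma polynomial_smooth:
  "real_polynomial_function (p :: 'a::euclidean_space \<Rightarrow> real) \<Longrightarrow> smooth p"
  unfolding smooth_def using polynomial_partials differentiable_at_real_polynomial_function by blast

lemma polynomial_growth:
  assumes "real_polynomial_function (p :: 'a::real_normed_vector \<Rightarrow> real)"
  shows "\<exists>C d. C \<ge> 0 \<and> (\<forall>x. \<bar>p x\<bar> \<le> C * (1 + norm x) ^ d)"
  using assms
proof induction
  case (linear f)
  then obtain K where K: "\<And>x. norm (f x) \<le> norm x * K" "K > 0" using bounded_linear.pos_bounded by blast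
  have "\<bar>f x\<bar> \<le> K * (1 + norm x) ^ 1" for x
    using K(1)[of x] K(2) by (simp add: algebra_simps)
  with K(2) show ?case by (meson less_imp_le)
next
  case (const c)
  have "\<bar>c\<bar> \<le> \<bar>c\<bar> * (1 + norm (x::'a)) ^ 0" for x by simp
  then show ?case by (meson abs_ge_zero)
next
  case (add f g)
  then obtain C d C' d' where *: "C \<ge> 0" "\<And>x. \<bar>f x\<bar> \<le> C * (1 + norm x) ^ d"
    "C' \<ge> 0" "\<And>x. \<bar>g x\<bar> \<le> C' * (1 + norm x) ^ d'" by blast
  have "\<bar>f x + g x\<bar> \<le> (C + C') * (1 + norm x) ^ (max d d')" for x
  proof -
    have "C * (1 + norm x) ^ d \<le> C * (1 + norm x) ^ (max d d')"
      "C' * (1 + norm x) ^ d' \<le> C' * (1 + norm x) ^ (max d d')"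
      using * by (auto intro!: mult_left_mono power_increasing)
    with *(2,4)[of x] show ?thesis by (simp add: distrib_right)
  qed
  with * show ?case by (meson add_nonneg_nonneg)
next
  case (mult f g)
  then obtain C d C' d' where *: "C \<ge> 0" "\<And>x. \<bar>f x\<bar> \<le> C * (1 + norm x) ^ d"
    "C' \<ge> 0" "\<And>x. \<bar>g x\<bar> \<le> C' * (1 + norm x) ^ d'" by blast
  have "\<bar>f x * g x\<bar> \<le> (C * C') * (1 + norm x) ^ (d + d')" for x
    using mult_mono[OF *(2)[of x] *(4)[of x]] *(1) by (simp add: abs_mult power_add mult_ac)
  with * show ?case by (meson mult_nonneg_nonneg)
qed

text \<open>A Schwartz norm controls \<open>f\<close> only pointwise, so
  \<open>D = 2 * DIM('a)\<close> extra powers of \<open>1 + norm x\<close>, two for each coordinate,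
  are spent on the integrable weight \<open>w\<close>; the other \<open>d\<close> powers absorb the
  growth of \<open>p\<close>.\<close>

lemma polynomial_tempered:
  assumes "real_polynomial_function (p :: 'a::euclidean_space \<Rightarrow> real)"
  shows "tempered p"
proof -
  obtain C d where C: "C \<ge> 0" and p: "\<And>x. \<bar>p x\<bar> \<le> C * (1 + norm x) ^ d"
    using polynomial_growth[OF assms] by blast
  define D where "D = 2 * DIM('a)"
  define w where "w x = (\<Prod>b\<in>Basis. inverse (1 + ((x::'a) \<bullet> b)\<^sup>2))" for x
  have w: "1 \<le> (1 + norm x) ^ D * w x" for x
  proof -
    have "(\<Prod>b\<in>Basis. 1 + (x \<bullet> b)\<^sup>2) \<le> (\<Prod>b\<in>(Basis :: 'a set). (1 + norm x)\<^sup>2)"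
    proof (rule prod_mono, intro conjI)
      fix b :: 'a assume "b \<in> Basis"
      then have "(x \<bullet> b)\<^sup>2 \<le> (norm x)\<^sup>2" using Basis_le_norm[of b x] by (simp add: power2_le_iff_abs_le)
      then show "1 + (x \<bullet> b)\<^sup>2 \<le> (1 + norm x)\<^sup>2"
        by (simp add: power2_sum add_increasing2)
    qed auto
    also have "\<dots> = (1 + norm x) ^ D" by (simp add: D_def power_mult)
    finally have "(\<Prod>b\<in>Basis. 1 + (x \<bullet> b)\<^sup>2) * w x \<le> (1 + norm x) ^ D * w x"
      by (rule mult_right_mono) (auto simp: w_def intro!: prod_nonneg)
    moreover have "(\<Prod>b\<in>Basis. 1 + (x \<bullet> b)\<^sup>2) * w x = 1"
      unfolding w_def prod.distrib[symmetric]
      by (rule prod.neutral) (simp add: add_nonneg_eq_0_iff)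
    ultimately show ?thesis by simp
  qed
  have "\<bar>LINT x|lborel. p x * f x\<bar> \<le> (C * (LINT x|lborel. w x)) * schwartz_norm (d + D) f"
    if f: "test_function f" for f
  proof -
    have int: "integrable lborel (\<lambda>x. p x * f x)"
      by (rule integrable_test[OF polynomial_smooth[OF assms] f])
    have sw: "(1 + norm x) ^ (d + D) * \<bar>f x\<bar> \<le> schwartz_norm (d + D) f" for x
    proof -
      have "(\<lambda>(vs, x). (1 + norm x) ^ (d + D) * \<bar>partials vs f x\<bar>) ([], x) \<le> schwartz_norm (d + D) f"
        unfolding schwartz_norm_def by (rule cSUP_upper[OF _ schwartz_bdd[OF f]]) auto
      then show ?thesis by simp
    qed
    have wn: "0 \<le> w x" for x by (auto simp: w_def intro!: prod_nonneg)
    have "\<bar>p x * f x\<bar> \<le> C * schwartz_norm (d + D) f * w x" for x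
    proof -
      have "\<bar>p x * f x\<bar> \<le> (C * (1 + norm x) ^ d) * \<bar>f x\<bar> * 1"
        using p[of x] by (simp add: abs_mult mult_right_mono)
      also have "\<dots> \<le> (C * (1 + norm x) ^ d) * \<bar>f x\<bar> * ((1 + norm x) ^ D * w x)"
        by (rule mult_left_mono[OF w]) (use C in auto)
      also have "\<dots> = C * ((1 + norm x) ^ (d + D) * \<bar>f x\<bar>) * w x" by (simp add: power_add mult_ac)
      also have "\<dots> \<le> C * schwartz_norm (d + D) f * w x"
        by (intro mult_right_mono mult_left_mono sw C wn)
      finally show ?thesis .
    qed
    moreover have wi: "integrable lborel w"
      unfolding w_def by (rule integrable_prod_inverse_one_plus_power2)
    ultimately have "(LINT x|lborel. \<bar>p x * f x\<bar>) \<le> (LINT x|lborel. C * schwartz_norm (d + D) f * w x)"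
      using int by (intro integral_mono) auto
    then have "\<bar>LINT x|lborel. p x * f x\<bar> \<le> C * schwartz_norm (d + D) f * (LINT x|lborel. w x)"
      using order_trans[OF integral_abs_bound[of lborel "\<lambda>x. p x * f x"]] wi by simp
    then show ?thesis by (simp add: mult_ac)
  qed
  then show ?thesis unfolding tempered_def by blast
qed

section \<open>Densities of functional derivatives and their uniqueness\<close>

lemma integrable_continuous_compact_supp:
  fixes k :: "'a::euclidean_space \<Rightarrow> 'b::{banach, second_countable_topology}"
  assumes "continuous_on UNIV k" "compact K" "\<And>x. x \<notin> K \<Longrightarrow> k x = 0"
  shows "integrable lborel k"
proof -
  have "integrable lborel (\<lambda>x. indicator K x *\<^sub>R k x)"
    using assms by (intro borel_integrable_compact) (auto intro: continuous_on_subset)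
  moreover have "(\<lambda>x. indicator K x *\<^sub>R k x) = k"
    using assms(3) by (fastforce simp: indicator_def)
  ultimately show ?thesis by simp
qed

text \<open>By Stone-Weierstrass a polynomial approximates \<open>u\<close> itself on
  \<open>K\<close>, so the integral of \<open>u * u\<close> is at most \<open>e\<close> times the L1
  norm of \<open>u\<close> for every positive \<open>e\<close>. Outside \<open>K\<close>, where
  nothing is known about the polynomial, the integrand vanishes.\<close>

lemma polynomial_orthogonal_imp_zero:
  fixes u :: "'a::euclidean_space \<Rightarrow> real"
  assumes u: "continuous_on UNIV u" "compact K" "\<And>x. x \<notin> K \<Longrightarrow> u x = 0"
    and orth: "\<And>p. real_polynomial_function p \<Longrightarrow> (LINT x|lborel. u x * p x) = 0"
  shows "u x = 0"
proof -
  have int: "integrable lborel (\<lambda>x. u x * v x)" if "continuous_on UNIV v" for v :: "'a \<Rightarrow> real"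
    by (rule integrable_continuous_compact_supp[OF _ u(2)]) (use u that in \<open>auto intro!: continuous_intros\<close>)
  have inta: "integrable lborel (\<lambda>x. \<bar>u x\<bar>)"
    by (rule integrable_continuous_compact_supp[OF _ u(2)]) (use u in \<open>auto intro!: continuous_intros\<close>)
  have "(LINT x|lborel. u x * u x) \<le> e * (LINT x|lborel. \<bar>u x\<bar>)" if e: "e > 0" for e
  proof -
    obtain p where p: "real_polynomial_function p" "\<And>x. x \<in> K \<Longrightarrow> \<bar>u x - p x\<bar> < e"
      using Stone_Weierstrass_real_polynomial_function[OF u(2) _ e] continuous_on_subset[OF u(1) subset_UNIV] by blast
    have pc: "continuous_on UNIV p" by (rule smooth_continuous[OF polynomial_smooth[OF p(1)]])
    have "(LINT x|lborel. u x * u x) = (LINT x|lborel. u x * u x - u x * p x)"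
      using int[OF u(1)] int[OF pc] orth[OF p(1)] by simp
    also have "\<dots> \<le> (LINT x|lborel. e * \<bar>u x\<bar>)"
    proof (rule integral_mono)
      show "u x * u x - u x * p x \<le> e * \<bar>u x\<bar>" for x
      proof (cases "x \<in> K")
        case True
        have "u x * u x - u x * p x \<le> \<bar>u x\<bar> * \<bar>u x - p x\<bar>"
          by (metis abs_ge_self abs_mult right_diff_distrib)
        also have "\<dots> \<le> \<bar>u x\<bar> * e" using p(2)[OF True] by (intro mult_left_mono) auto
        finally show ?thesis by (simp add: mult.commute)
      qed (simp add: u(3))
    qed (use int[OF u(1)] int[OF pc] inta in auto)
    finally show ?thesis by simp
  qed
  then have le: "\<forall>e>0. (LINT x|lborel. u x * u x) \<le> e * (LINT x|lborel. \<bar>u x\<bar>)" by blast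
  have "(LINT x|lborel. u x * u x) \<le> 0"
  proof (rule field_le_epsilon)
    fix e :: real assume e: "e > 0"
    define Z where "Z = (LINT x|lborel. \<bar>u x\<bar>)"
    have "Z \<ge> 0" by (simp add: Z_def)
    \<comment> \<open>The denominator is \<open>Z + 1\<close> because the L1 norm \<open>Z\<close>
      may be zero.\<close>
    then have "e / (Z + 1) * Z \<le> e" using e by (simp add: field_simps)
    with le[rule_format, of "e / (Z + 1)"] e \<open>Z \<ge> 0\<close> show "(LINT x|lborel. u x * u x) \<le> 0 + e"
      unfolding Z_def[symmetric] by auto
  qed
  moreover have "(LINT x|lborel. u x * u x) \<ge> 0" by simp
  ultimately have "(LINT x|lborel. u x * u x) = 0" by simp
  then have "AE x in lborel. u x * u x = 0"
    using integral_nonneg_eq_0_iff_AE[OF int[OF u(1)]] by simp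
  then have ae: "AE x in lborel. u x = 0" by simp
  \<comment> \<open>Continuity upgrades almost everywhere to everywhere: a nonempty open set is not
    negligible.\<close>
  show ?thesis
  proof (rule ccontr)
    assume "u x \<noteq> 0"
    have op: "open {x. u x \<noteq> 0}"
      by (rule open_Collect_neq) (use u(1) in \<open>auto intro: continuous_intros\<close>)
    have "{x. u x \<noteq> 0} \<in> null_sets lborel"
      using ae op by (subst AE_iff_null_sets) auto
    then have "negligible {x. u x \<noteq> 0}"
      by (simp add: negligible_iff_null_sets null_sets_completionI)
    with open_not_negligible[OF op] \<open>u x \<noteq> 0\<close> show False by auto
  qed
qed

lemma compact_supp_iff:
  "compact (supp (k :: 'a::euclidean_space \<Rightarrow> 'b::zero)) \<longleftrightarrow> (\<exists>K. compact K \<and> (\<forall>x. x \<notin> K \<longrightarrow> k x = 0))"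
proof
  assume "compact (supp k)"
  then show "\<exists>K. compact K \<and> (\<forall>x. x \<notin> K \<longrightarrow> k x = 0)" using notin_supp by blast
next
  assume "\<exists>K. compact K \<and> (\<forall>x. x \<notin> K \<longrightarrow> k x = 0)"
  then obtain K where K: "compact K" "{x. k x \<noteq> 0} \<subseteq> K" by blast
  then have "bounded {x. k x \<noteq> 0}" using compact_imp_bounded bounded_subset by blast
  then show "compact (supp k)" by (simp add: supp_def)
qed

text \<open>The predicate under the definite description in \<open>func_deriv\<close>, with the
  density as an argument.\<close>

definition has_func_deriv :: "functional \<Rightarrow> config \<Rightarrow> (spacetime \<Rightarrow> complex) \<Rightarrow> bool" where
  "has_func_deriv A \<phi> k \<longleftrightarrow> continuous_on UNIV k \<and> compact (supp k) \<and>
     (\<forall>h. ((\<lambda>t. A (\<phi> + t *\<^sub>R h)) has_vector_derivative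
             (LINT y|lborel. k y * of_real (config_fun h y))) (at 0))"

lemma integrable_has_func_deriv:
  assumes "has_func_deriv A \<phi> k"
  shows "integrable lborel (\<lambda>y. k y * of_real (config_fun h y))"
proof -
  obtain K where "compact K" "\<forall>x. x \<notin> K \<longrightarrow> k x = 0"
    using assms unfolding has_func_deriv_def compact_supp_iff by blast
  moreover have "continuous_on UNIV (config_fun h)"
    using config_fun[of h] smooth_continuous by blast
  ultimately show ?thesis using assms unfolding has_func_deriv_def
    by (intro integrable_continuous_compact_supp[of _ K]) (auto intro!: continuous_intros)
qed

text \<open>Both densities give the same directional derivative along every polynomial, so the real
  and imaginary parts of their difference are orthogonal to all polynomials.\<close>

lemma has_func_deriv_unique:
  assumes k: "has_func_deriv A \<phi> k" and k': "has_func_deriv A \<phi> k'"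
  shows "k = k'"
proof -
  define d where "d = (\<lambda>x. k x - k' x)"
  obtain K where K: "compact K" "\<And>x. x \<notin> K \<Longrightarrow> d x = 0"
  proof -
    obtain K1 K2 where "compact K1" "\<forall>x. x \<notin> K1 \<longrightarrow> k x = 0" "compact K2" "\<forall>x. x \<notin> K2 \<longrightarrow> k' x = 0"
      using k k' unfolding has_func_deriv_def compact_supp_iff by blast
    then show ?thesis by (intro that[of "K1 \<union> K2"]) (auto simp: d_def)
  qed
  have dc: "continuous_on UNIV d"
    using k k' unfolding d_def has_func_deriv_def by (auto intro!: continuous_intros)
  have orth: "(LINT x|lborel. d x * of_real (p x)) = 0" if "real_polynomial_function p" for p
  proof -
    have p: "config_fun (Config p) = p"
      using that by (intro Config_inverse) (simp add: polynomial_smooth polynomial_tempered)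
    have "(LINT y|lborel. k y * of_real (config_fun (Config p) y)) =
          (LINT y|lborel. k' y * of_real (config_fun (Config p) y))"
      using k k' unfolding has_func_deriv_def by (blast intro: vector_derivative_unique_at)
    then show ?thesis
      using integrable_has_func_deriv[OF k, of "Config p"] integrable_has_func_deriv[OF k', of "Config p"]
      by (simp add: p d_def left_diff_distrib)
  qed
  have int: "integrable lborel (\<lambda>x. d x * of_real (p x))" if "real_polynomial_function p" for p
    by (rule integrable_continuous_compact_supp[OF _ K(1)])
       (use dc K(2) smooth_continuous[OF polynomial_smooth[OF that]] in \<open>auto intro!: continuous_intros\<close>)
  have "Re (d x) = 0" for x
  proof (rule polynomial_orthogonal_imp_zero[OF _ K(1)])
    show "(LINT x|lborel. Re (d x) * p x) = 0" if "real_polynomial_function p" for p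
      using orth[OF that] integral_Re[OF int[OF that]] by simp
  qed (use dc K(2) in \<open>auto intro!: continuous_intros\<close>)
  moreover have "Im (d x) = 0" for x
  proof (rule polynomial_orthogonal_imp_zero[OF _ K(1)])
    show "(LINT x|lborel. Im (d x) * p x) = 0" if "real_polynomial_function p" for p
      using orth[OF that] integral_Im[OF int[OF that]] by simp
  qed (use dc K(2) in \<open>auto intro!: continuous_intros\<close>)
  ultimately have "d x = 0" for x by (simp add: complex_eq_iff)
  then show ?thesis by (auto simp: d_def fun_eq_iff)
qed

lemma func_deriv_eq: "has_func_deriv A \<phi> k \<Longrightarrow> func_deriv x A \<phi> = k x"
  unfolding func_deriv_def has_func_deriv_def[symmetric]
  by (subst the_equality[of _ k]) (auto intro: has_func_deriv_unique)

lemma has_func_deriv_add: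
  assumes k: "has_func_deriv A \<phi> k" and k': "has_func_deriv B \<phi> k'"
  shows "has_func_deriv (\<lambda>\<phi>. A \<phi> + B \<phi>) \<phi> (\<lambda>x. k x + k' x)"
  unfolding has_func_deriv_def
proof (intro conjI allI)
  show "continuous_on UNIV (\<lambda>x. k x + k' x)"
    using k k' unfolding has_func_deriv_def by (auto intro!: continuous_intros)
  obtain K1 K2 where "compact K1" "\<forall>x. x \<notin> K1 \<longrightarrow> k x = 0" "compact K2" "\<forall>x. x \<notin> K2 \<longrightarrow> k' x = 0"
    using k k' unfolding has_func_deriv_def compact_supp_iff by blast
  then show "compact (supp (\<lambda>x. k x + k' x))"
    unfolding compact_supp_iff by (intro exI[of _ "K1 \<union> K2"]) auto
  fix h
  show "((\<lambda>t. A (\<phi> + t *\<^sub>R h) + B (\<phi> + t *\<^sub>R h)) has_vector_derivative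
      (LINT y|lborel. (k y + k' y) * of_real (config_fun h y))) (at 0)"
    using integrable_has_func_deriv[OF k, of h] integrable_has_func_deriv[OF k', of h] k k'
    unfolding has_func_deriv_def distrib_right by (auto intro!: has_vector_derivative_add)
qed

lemma has_func_deriv_zero: "has_func_deriv (\<lambda>\<phi>. 0) \<phi> (\<lambda>x. 0)"
  unfolding has_func_deriv_def by (simp add: supp_def)

lemma has_func_deriv_sum:
  assumes "\<And>a. a \<in> S \<Longrightarrow> has_func_deriv (A a) \<phi> (k a)"
  shows "has_func_deriv (\<lambda>\<phi>. \<Sum>a\<in>S. A a \<phi>) \<phi> (\<lambda>x. \<Sum>a\<in>S. k a x)"
  using assms
  by (induction S rule: infinite_finite_induct) (auto simp: has_func_deriv_zero has_func_deriv_add)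

section \<open>Kernels and monomials\<close>

interpretation lborels: product_sigma_finite "\<lambda>_::nat. lborel :: spacetime measure"
  by (rule product_sigma_finite.intro) (rule sigma_finite_lborel)

abbreviation vol :: "nat set \<Rightarrow> (nat \<Rightarrow> spacetime) measure" where
  "vol I \<equiv> (\<Pi>\<^sub>M i\<in>I. lborel)"

text \<open>Kernels are functions of all coordinates that only depend on those in \<open>I\<close>; in this way the
  kernel of a product of functionals is the pointwise product of their kernels.\<close>

definition kern :: "nat set \<Rightarrow> spacetime set \<Rightarrow> ((nat \<Rightarrow> spacetime) \<Rightarrow> complex) set" where
  "kern I U = {c. continuous_on UNIV c \<and> (\<forall>x y. (\<forall>i\<in>I. x i = y i) \<longrightarrow> c x = c y) \<and>
     (\<exists>K. compact K \<and> K \<subseteq> U \<and> (\<forall>x. c x \<noteq> 0 \<longrightarrow> (\<forall>i\<in>I. x i \<in> K)))}"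

section \<open>Closure properties of kernels\<close>

lemma kern_continuous: "c \<in> kern I U \<Longrightarrow> continuous_on UNIV c"
  by (simp add: kern_def)

lemma kern_local: "c \<in> kern I U \<Longrightarrow> (\<And>i. i \<in> I \<Longrightarrow> x i = y i) \<Longrightarrow> c x = c y"
  by (simp add: kern_def)

lemma kern_supp:
  assumes "c \<in> kern I U"
  obtains K where "compact K" "K \<subseteq> U" "\<And>x i. c x \<noteq> 0 \<Longrightarrow> i \<in> I \<Longrightarrow> x i \<in> K"
  using assms unfolding kern_def by blast

lemma kern_mono: "U \<subseteq> U' \<Longrightarrow> c \<in> kern I U \<Longrightarrow> c \<in> kern I U'"
  unfolding kern_def by blast

lemma kern_mult:
  assumes "c \<in> kern I U" "d \<in> kern J U"
  shows "(\<lambda>x. c x * d x) \<in> kern (I \<union> J) U"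
proof -
  obtain K where K: "compact K" "K \<subseteq> U" "\<And>x i. c x \<noteq> 0 \<Longrightarrow> i \<in> I \<Longrightarrow> x i \<in> K"
    using kern_supp[OF assms(1)] by metis
  obtain L where L: "compact L" "L \<subseteq> U" "\<And>x i. d x \<noteq> 0 \<Longrightarrow> i \<in> J \<Longrightarrow> x i \<in> L"
    using kern_supp[OF assms(2)] by metis
  have "c x * d x = c y * d y" if "\<forall>i\<in>I \<union> J. x i = y i" for x y
    using kern_local[OF assms(1), of x y] kern_local[OF assms(2), of x y] that by simp
  moreover have "compact (K \<union> L)" "K \<union> L \<subseteq> U" "\<And>x. c x * d x \<noteq> 0 \<longrightarrow> (\<forall>i\<in>I \<union> J. x i \<in> K \<union> L)"
    using K L by auto
  ultimately show ?thesis
    using assms unfolding kern_def mem_Collect_eq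
    by (intro conjI exI[of _ "K \<union> L"]) (auto intro!: continuous_intros)
qed

lemma kern_times_continuous:
  assumes "c \<in> kern I U" "continuous_on UNIV d" "\<And>x y. (\<And>i. i \<in> I \<Longrightarrow> x i = y i) \<Longrightarrow> d x = d y"
  shows "(\<lambda>x. c x * d x) \<in> kern I U"
proof -
  have "c x * d x = c y * d y" if "\<forall>i\<in>I. x i = y i" for x y
    using kern_local[OF assms(1), of x y] assms(3)[of x y] that by simp
  then show ?thesis using assms(1,2) unfolding kern_def by (auto intro!: continuous_intros)
qed

lemma kern_scale: "c \<in> kern I U \<Longrightarrow> (\<lambda>x. z * c x) \<in> kern I U"
  unfolding kern_def by (auto intro!: continuous_intros)

lemma kern_cnj: "c \<in> kern I U \<Longrightarrow> (\<lambda>x. cnj (c x)) \<in> kern I U"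
  unfolding kern_def by (auto intro!: continuous_intros)

lemma kern_zero: "(\<lambda>x. 0) \<in> kern I U"
  unfolding kern_def by auto

lemma kern_prod:
  assumes "finite I" "\<And>i. i \<in> I \<Longrightarrow> continuous_on UNIV (f i)"
    "\<And>i. i \<in> I \<Longrightarrow> compact K" "\<And>i y. i \<in> I \<Longrightarrow> f i y \<noteq> 0 \<Longrightarrow> y \<in> K" "I \<noteq> {} \<Longrightarrow> K \<subseteq> U"
  shows "(\<lambda>x. \<Prod>i\<in>I. f i (x i)) \<in> kern I U"
proof (cases "I = {}")
  case True then show ?thesis by (auto simp: kern_def)
next
  case False
  have "continuous_on UNIV (\<lambda>x::nat\<Rightarrow>spacetime. f i (x i))" if "i \<in> I" for i
    by (rule continuous_on_compose2[OF assms(2)[OF that]]) auto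
  then have "continuous_on UNIV (\<lambda>x::nat\<Rightarrow>spacetime. \<Prod>i\<in>I. f i (x i))"
    by (rule continuous_on_prod)
  then show ?thesis using False assms unfolding kern_def mem_Collect_eq
    by (intro conjI exI[of _ K]) auto
qed

section \<open>Freezing coordinates and integrating kernels\<close>

lemma continuous_on_fun_upd:
  fixes f :: "'z::topological_space \<Rightarrow> nat \<Rightarrow> 'a::topological_space"
  assumes "continuous_on S f" "continuous_on S g"
  shows "continuous_on S (\<lambda>z. (f z)(i := g z))"
proof (rule continuous_on_coordinatewise_then_product)
  fix j
  show "continuous_on S (\<lambda>z. ((f z)(i := g z)) j)"
    using assms by (cases "j = i") (auto intro: continuous_on_product_then_coordinatewise)
qed

lemma kern_fun_upd:
  assumes "c \<in> kern I U" "J = I - {i}"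
  shows "(\<lambda>x. c (x(i := y))) \<in> kern J U"
proof -
  obtain K where K: "compact K" "K \<subseteq> U" "\<And>x i. c x \<noteq> 0 \<Longrightarrow> i \<in> I \<Longrightarrow> x i \<in> K"
    using kern_supp[OF assms(1)] by metis
  have "continuous_on UNIV (\<lambda>x. c (x(i := y)))"
    by (rule continuous_on_compose2[OF kern_continuous[OF assms(1)]])
       (intro continuous_on_fun_upd continuous_on_id continuous_on_const, simp)
  moreover have "c (x(i := y)) = c (x'(i := y))" if "\<forall>j\<in>J. x j = x' j" for x x'
    by (rule kern_local[OF assms(1)]) (use that assms(2) in auto)
  moreover have "x j \<in> K" if "c (x(i := y)) \<noteq> 0" "j \<in> J" for x j
    using K(3)[OF that(1), of j] that(2) assms(2) by auto
  ultimately show ?thesis using K(1,2) unfolding kern_def by blast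
qed

lemma kern_bounded:
  assumes "c \<in> kern I U"
  obtains B where "B \<ge> 0" "\<And>x. norm (c x) \<le> B"
proof -
  obtain K where K: "compact K" "K \<subseteq> U" "\<And>x i. c x \<noteq> 0 \<Longrightarrow> i \<in> I \<Longrightarrow> x i \<in> K"
    using kern_supp[OF assms(1)] by metis
  define S where "S = {x::nat\<Rightarrow>spacetime. \<forall>i. x i \<in> (if i \<in> I then K else {undefined})}"
  have "compact S"
  proof -
    have "S = PiE UNIV (\<lambda>i. if i \<in> I then K else {undefined})" by (auto simp: S_def PiE_def Pi_def)
    moreover have "compactin (product_topology (\<lambda>i. euclidean) UNIV)
        (PiE UNIV (\<lambda>i::nat. if i \<in> I then K else {undefined::spacetime}))"
      using K(1) by (subst compactin_PiE) auto
    ultimately show ?thesis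
      using compactin_euclidean_iff[of S] by (simp add: euclidean_product_topology)
  qed
  then have "bounded (c ` S)"
    by (intro compact_imp_bounded compact_continuous_image continuous_on_subset[OF kern_continuous[OF assms]]) auto
  then obtain B where B: "\<And>x. x \<in> S \<Longrightarrow> norm (c x) \<le> B" unfolding bounded_iff by blast
  have "norm (c x) \<le> max B 0" for x
  proof (cases "c x = 0")
    case False
    have eq: "c x = c (restrict x I)" by (rule kern_local[OF assms]) auto
    have "restrict x I \<in> S" using K(3)[OF False] by (auto simp: S_def)
    then show ?thesis using B eq by (simp add: max.coboundedI1)
  qed auto
  then show ?thesis using that by (meson max.cobounded2)
qed

text \<open>Links continuity on the whole function space to measurability for \<open>vol I\<close>:
  on the space of that measure the coordinates outside \<open>I\<close> are constantly
  \<open>undefined\<close>.\<close>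

lemma measurable_vol_borel: "(\<lambda>x. x) \<in> borel_measurable (vol I)"
proof (rule measurable_coordinatewise_then_product)
  fix i
  show "(\<lambda>x. x i) \<in> borel_measurable (vol I)"
  proof (cases "i \<in> I")
    case True
    then have "(\<lambda>x. x i) \<in> measurable (vol I) lborel" by (rule measurable_component_singleton)
    then show ?thesis by simp
  next
    case False
    then have "x i = undefined" if "x \<in> space (vol I)" for x
      using that by (auto simp: space_PiM PiE_def extensional_def)
    then show ?thesis by (subst measurable_cong[where g = "\<lambda>x. undefined"]) auto
  qed
qed

lemma borel_measurable_continuous_vol:
  assumes "continuous_on UNIV (f :: (nat \<Rightarrow> spacetime) \<Rightarrow> 'b::topological_space)"
  shows "f \<in> borel_measurable (vol I)"
  using measurable_compose[OF measurable_vol_borel borel_measurable_continuous_onI[OF assms]] .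

lemma integrable_indicator_vol:
  assumes "finite I" "compact K"
  shows "integrable (vol I) (\<lambda>x. indicator (PiE I (\<lambda>_. K)) x :: real)"
proof -
  have "emeasure (vol I) (PiE I (\<lambda>_. K)) = (\<Prod>i\<in>I. emeasure lborel K)"
    using assms by (subst lborels.emeasure_PiM) (auto simp: borel_compact)
  also have "\<dots> < \<infinity>"
    using emeasure_lborel_cbox_finite emeasure_compact_finite[OF assms(2)]
    by (simp add: power_less_top_ennreal)
  finally show ?thesis
    using assms by (intro integrable_real_indicator) (auto simp: borel_compact intro!: sets_PiM_I_finite)
qed

text \<open>One integrable majorant serves all values of the coordinates outside \<open>J\<close> at
  once. Dominated convergence needs this uniformity when those coordinates are parameters.\<close>

lemma kern_dominated:
  assumes "c \<in> kern I U" "finite I" "J \<subseteq> I"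
  obtains B K where "compact K" "integrable (vol J) (\<lambda>x. B * indicator (PiE J (\<lambda>_. K)) x)"
    "\<And>x y. x \<in> space (vol J) \<Longrightarrow> (\<And>i. i \<in> J \<Longrightarrow> y i = x i) \<Longrightarrow> norm (c y) \<le> B * indicator (PiE J (\<lambda>_. K)) x"
proof -
  obtain K where K: "compact K" "K \<subseteq> U" "\<And>x i. c x \<noteq> 0 \<Longrightarrow> i \<in> I \<Longrightarrow> x i \<in> K"
    using kern_supp[OF assms(1)] by metis
  obtain B where B: "B \<ge> 0" "\<And>x. norm (c x) \<le> B" using kern_bounded[OF assms(1)] by blast
  have fin: "finite J" using assms finite_subset by blast
  show ?thesis
  proof (rule that[OF K(1)])
    show "integrable (vol J) (\<lambda>x. B * indicator (PiE J (\<lambda>_. K)) x)"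
      using integrable_indicator_vol[OF fin K(1)] by simp
    fix x y :: "nat \<Rightarrow> spacetime" assume x: "x \<in> space (vol J)" and y: "\<And>i. i \<in> J \<Longrightarrow> y i = x i"
    show "norm (c y) \<le> B * indicator (PiE J (\<lambda>_. K)) x"
    proof (cases "c y = 0")
      case False
      then have "x i \<in> K" if "i \<in> J" for i using K(3)[OF False, of i] y[OF that] that assms(3) by auto
      then have "x \<in> PiE J (\<lambda>_. K)" using x by (auto simp: space_PiM PiE_def)
      then show ?thesis using B(2) by simp
    qed (use B(1) in auto)
  qed
qed

lemma kern_integrable:
  assumes "c \<in> kern I U" "finite I"
  shows "integrable (vol I) c"
proof -
  obtain B K where *: "compact K" "integrable (vol I) (\<lambda>x. B * indicator (PiE I (\<lambda>_. K)) x)"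
    "\<And>x y. x \<in> space (vol I) \<Longrightarrow> (\<And>i. i \<in> I \<Longrightarrow> y i = x i) \<Longrightarrow> norm (c y) \<le> B * indicator (PiE I (\<lambda>_. K)) x"
    using kern_dominated[OF assms order_refl] by metis
  show ?thesis
  proof (rule Bochner_Integration.integrable_bound[OF *(2)])
    show "c \<in> borel_measurable (vol I)"
      by (rule borel_measurable_continuous_vol[OF kern_continuous[OF assms(1)]])
    show "AE x in vol I. norm (c x) \<le> norm (B * indicator (PiE I (\<lambda>_. K)) x)"
      by (intro AE_I2 order_trans[OF *(3)]) auto
  qed
qed

text \<open>The map \<open>s\<close> inserts the parameter \<open>z\<close> into coordinates that
  are not integrated. Dominated convergence along sequences suffices, as \<open>'z\<close> is a
  metric space.\<close>

lemma continuous_integral_kern: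
  fixes s :: "'z::metric_space \<Rightarrow> (nat \<Rightarrow> spacetime) \<Rightarrow> nat \<Rightarrow> spacetime"
  assumes "c \<in> kern I U" "finite I" "J \<subseteq> I"
    and s: "\<And>x. continuous_on UNIV (\<lambda>z. s z x)" "\<And>z. continuous_on UNIV (s z)"
      "\<And>z x i. i \<in> J \<Longrightarrow> s z x i = x i"
  shows "continuous_on UNIV (\<lambda>z. LINT x|vol J. c (s z x))"
proof -
  obtain B K where *: "compact K" "integrable (vol J) (\<lambda>x. B * indicator (PiE J (\<lambda>_. K)) x)"
    "\<And>x y. x \<in> space (vol J) \<Longrightarrow> (\<And>i. i \<in> J \<Longrightarrow> y i = x i) \<Longrightarrow> norm (c y) \<le> B * indicator (PiE J (\<lambda>_. K)) x"
    using kern_dominated[OF assms(1-3)] by metis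
  have c: "continuous_on UNIV c" by (rule kern_continuous[OF assms(1)])
  have m: "(\<lambda>x. c (s z x)) \<in> borel_measurable (vol J)" for z
    by (rule borel_measurable_continuous_vol) (rule continuous_on_compose2[OF c s(2)], simp)
  have "(\<lambda>n. LINT x|vol J. c (s (u n) x)) \<longlonglongrightarrow> (LINT x|vol J. c (s a x))"
    if u: "u \<longlonglongrightarrow> a" for u :: "nat \<Rightarrow> 'z" and a
  proof (rule integral_dominated_convergence[OF m m *(2)])
    have "(\<lambda>n. c (s (u n) x)) \<longlonglongrightarrow> c (s a x)" for x
    proof -
      have "isCont (\<lambda>z. c (s z x)) a"
        using continuous_on_compose2[OF c s(1)] by (simp add: continuous_on_eq_continuous_at)
      then show ?thesis using u isCont_tendsto_compose by blast
    qed
    then show "AE x in vol J. (\<lambda>n. c (s (u n) x)) \<longlonglongrightarrow> c (s a x)" by simp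
    show "AE x in vol J. norm (c (s (u n) x)) \<le> B * indicator (PiE J (\<lambda>_. K)) x" for n
      by (intro AE_I2 *(3) s(3))
  qed
  then have "\<forall>a. isCont (\<lambda>z. LINT x|vol J. c (s z x)) a"
    unfolding continuous_at_sequentially comp_def by blast
  then show ?thesis by (simp add: continuous_on_eq_continuous_at)
qed

text \<open>Fubini; it isolates the vertex whose leg is being differentiated.\<close>

lemma integral_vol_insert:
  assumes "c \<in> kern I U" "finite I" "i \<in> I" "J = I - {i}"
  shows "(LINT x|vol I. c x) = (LINT y|lborel. LINT x|vol J. c (x(i := y)))"
proof -
  have I: "I = J \<union> {i}" "J \<inter> {i} = {}" using assms by auto
  have int: "integrable (vol I) c" by (rule kern_integrable[OF assms(1,2)])
  interpret P: pair_sigma_finite "vol {i}" "vol J"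
  proof -
    interpret A: finite_product_sigma_finite "\<lambda>_. lborel::spacetime measure" "{i}" by standard auto
    interpret B: finite_product_sigma_finite "\<lambda>_. lborel::spacetime measure" J by standard (use assms in auto)
    show "pair_sigma_finite (vol {i}) (vol J)" ..
  qed
  have "(LINT x|vol I. c x) = (LINT y|vol {i}. LINT x|vol J. c (merge {i} J (y, x)))"
    using I assms(2) int lborels.product_integral_fold[of "{i}" J c] by (simp add: Un_commute)
  also have "\<dots> = (LINT y|vol {i}. LINT x|vol J. c (x(i := y i)))"
    by (intro Bochner_Integration.integral_cong refl kern_local[OF assms(1)]) (use assms in \<open>auto simp: merge_def\<close>)
  also have "\<dots> = (LINT y|lborel. LINT x|vol J. c (x(i := y)))"
  proof (rule lborels.product_integral_singleton)
    have "continuous_on UNIV (\<lambda>y. LINT x|vol J. c (x(i := y)))"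
      by (rule continuous_integral_kern[OF assms(1,2)])
         (intro continuous_on_fun_upd continuous_on_id continuous_on_const continuous_on_fst continuous_on_snd | use assms in force)+
    then show "(\<lambda>y. LINT x|vol J. c (x(i := y))) \<in> borel_measurable lborel"
      using borel_measurable_continuous_onI by auto
  qed
  finally show ?thesis .
qed

lemma continuous_compact_integral_fun_upd:
  assumes "c \<in> kern I U" "finite I" "i \<in> I" "J = I - {i}"
  shows "continuous_on UNIV (\<lambda>y. LINT x|vol J. c (x(i := y)))"
    and "compact (supp (\<lambda>y. LINT x|vol J. c (x(i := y))))"
proof -
  show "continuous_on UNIV (\<lambda>y. LINT x|vol J. c (x(i := y)))"
    by (rule continuous_integral_kern[OF assms(1,2)])
         (intro continuous_on_fun_upd continuous_on_id continuous_on_const continuous_on_fst continuous_on_snd | use assms in force)+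
  obtain K where K: "compact K" "K \<subseteq> U" "\<And>x i. c x \<noteq> 0 \<Longrightarrow> i \<in> I \<Longrightarrow> x i \<in> K"
    using kern_supp[OF assms(1)] by metis
  have "c (x(i := y)) = 0" if "y \<notin> K" for x y
    using K(3)[of "x(i := y)" i] that assms(3) by auto
  then show "compact (supp (\<lambda>y. LINT x|vol J. c (x(i := y))))"
    unfolding compact_supp_iff using K(1) by auto
qed

text \<open>\<open>Gamma_op\<close> integrates over pairs \<open>z\<close> of points. Read from
  right to left, this puts the two contracted vertices back among the integration variables of the
  kernel.\<close>

lemma integral_vol_insert2:
  assumes "c \<in> kern I U" "finite I" "i \<in> I" "j \<in> I" "i \<noteq> j" "J = I - {i} - {j}"
  shows "integrable lborel (\<lambda>z. LINT x|vol J. c (x(j := snd z, i := fst z)))" (is "integrable _ ?h")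
    and "(LINT x|vol I. c x) = (LINT z|lborel. LINT x|vol J. c (x(j := snd z, i := fst z)))"
proof -
  obtain K where K: "compact K" "K \<subseteq> U" "\<And>x i. c x \<noteq> 0 \<Longrightarrow> i \<in> I \<Longrightarrow> x i \<in> K"
    using kern_supp[OF assms(1)] by metis
  show int: "integrable lborel ?h"
  proof (rule integrable_continuous_compact_supp)
    show "continuous_on UNIV ?h"
      by (rule continuous_integral_kern[OF assms(1,2)])
         (intro continuous_on_fun_upd continuous_on_id continuous_on_const continuous_on_fst continuous_on_snd | use assms in force)+
    show "compact (K \<times> K)" by (rule compact_Times[OF K(1) K(1)])
    fix z assume z: "z \<notin> K \<times> K"
    have "c (x(j := snd z, i := fst z)) = 0" for x
      using K(3)[of "x(j := snd z, i := fst z)" i] K(3)[of "x(j := snd z, i := fst z)" j] z assms(3-5)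
      by (cases z) auto
    then show "?h z = 0" by simp
  qed
  have "(LINT x|vol I. c x) = (LINT y|lborel. LINT x|vol (I - {i}). c (x(i := y)))"
    by (rule integral_vol_insert[OF assms(1-3) refl])
  also have "\<dots> = (LINT y|lborel. LINT y'|lborel. LINT x|vol J. c (x(j := y', i := y)))"
    using assms by (intro Bochner_Integration.integral_cong refl integral_vol_insert[OF kern_fun_upd]) auto
  also have "\<dots> = (LINT z|lborel. ?h z)"
    using lborel_pair.integral_fst'[of ?h] int by (simp add: lborel_prod)
  finally show "(LINT x|vol I. c x) = (LINT z|lborel. ?h z)" .
qed

lemma integral_vol_mult:
  assumes "c \<in> kern I U" "d \<in> kern J U" "finite I" "finite J" "I \<inter> J = {}"
  shows "(LINT x|vol (I \<union> J). c x * d x) = (LINT x|vol I. c x) * (LINT x|vol J. d x)"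
proof -
  have "(LINT x|vol (I \<union> J). c x * d x) =
      (LINT x|vol I. LINT y|vol J. c (merge I J (x, y)) * d (merge I J (x, y)))"
    using assms kern_integrable[OF kern_mult[OF assms(1,2)]] by (intro lborels.product_integral_fold) auto
  also have "\<dots> = (LINT x|vol I. LINT y|vol J. c x * d y)"
  proof (intro Bochner_Integration.integral_cong refl)
    fix x y
    have "c (merge I J (x, y)) = c x" by (rule kern_local[OF assms(1)]) (auto simp: merge_def)
    moreover have "d (merge I J (x, y)) = d y"
      by (rule kern_local[OF assms(2)]) (use assms(5) in \<open>auto simp: merge_def\<close>)
    ultimately show "c (merge I J (x, y)) * d (merge I J (x, y)) = c x * d y" by simp
  qed
  finally show ?thesis by simp
qed

text \<open>The pushforward of the product measure under a bijection of index sets has the right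
  value on boxes, which determines it. The restriction in \<open>?f\<close> only makes the image
  extensional, which \<open>c\<close> does not notice.\<close>

lemma integral_vol_relabel:
  assumes "continuous_on UNIV (c :: _ \<Rightarrow> complex)" and loc: "\<And>x y. (\<And>i. i \<in> J \<Longrightarrow> x i = y i) \<Longrightarrow> c x = c y"
    and "finite I" "bij_betw r J I"
  shows "(LINT x|vol J. c x) = (LINT x|vol I. c (\<lambda>j. x (r j)))"
proof -
  let ?f = "\<lambda>x. \<lambda>j\<in>J. x (r j)"
  have finJ: "finite J" using assms bij_betw_finite by blast
  have f: "?f \<in> measurable (vol I) (vol J)"
    by (rule measurable_restrict) (use assms(4) in \<open>auto intro!: measurable_component_singleton simp: bij_betw_def\<close>)
  have "distr (vol I) (vol J) ?f = vol J"
  proof (rule lborels.PiM_eqI[OF finJ])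
    fix A assume A: "\<And>i. i \<in> J \<Longrightarrow> A i \<in> sets (lborel::spacetime measure)"
    define s where "s = inv_into J r"
    have s: "s (r j) = j" if "j \<in> J" for j using assms(4) that by (simp add: s_def bij_betw_inv_into_left)
    have rs: "r (s i) = i" "s i \<in> J" if "i \<in> I" for i
      using assms(4) that bij_betw_inv_into_right[OF assms(4)] bij_betw_inv_into[OF assms(4)]
      by (auto simp: s_def bij_betw_def)
    have rI: "r j \<in> I" if "j \<in> J" for j using assms(4) that by (auto simp: bij_betw_def)
    have "?f -` PiE J A \<inter> space (vol I) = PiE I (\<lambda>i. A (s i))"
    proof (intro equalityI subsetI)
      fix x assume "x \<in> ?f -` PiE J A \<inter> space (vol I)"
      then have x: "?f x \<in> PiE J A" "x \<in> extensional I" by (auto simp: space_PiM PiE_def)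
      have "x i \<in> A (s i)" if "i \<in> I" for i
        using PiE_mem[OF x(1) rs(2)[OF that]] rs[OF that] by simp
      then show "x \<in> PiE I (\<lambda>i. A (s i))" using x(2) by (auto simp: PiE_def)
    next
      fix x assume x: "x \<in> PiE I (\<lambda>i. A (s i))"
      have "x (r j) \<in> A j" if "j \<in> J" for j using PiE_mem[OF x rI[OF that]] s[OF that] by simp
      then show "x \<in> ?f -` PiE J A \<inter> space (vol I)" using x by (auto simp: space_PiM PiE_def)
    qed
    then have "emeasure (distr (vol I) (vol J) ?f) (PiE J A) = emeasure (vol I) (PiE I (\<lambda>i. A (s i)))"
      using f A finJ by (subst emeasure_distr) (auto intro!: sets_PiM_I_finite)
    also have "\<dots> = (\<Prod>i\<in>I. emeasure lborel (A (s i)))"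
      using assms(3) A rs by (intro lborels.emeasure_PiM) auto
    also have "\<dots> = (\<Prod>j\<in>J. emeasure lborel (A j))"
      using s prod.reindex_bij_betw[OF assms(4), of "\<lambda>i. emeasure lborel (A (s i))"] by simp
    finally show "emeasure (distr (vol I) (vol J) ?f) (PiE J A) = (\<Prod>j\<in>J. emeasure lborel (A j))" .
  qed simp
  then have "(LINT x|vol J. c x) = (LINT x|distr (vol I) (vol J) ?f. c x)" by simp
  also have "\<dots> = (LINT x|vol I. c (?f x))"
    by (rule integral_distr[OF f borel_measurable_continuous_vol[OF assms(1)]])
  also have "\<dots> = (LINT x|vol I. c (\<lambda>j. x (r j)))"
    by (intro Bochner_Integration.integral_cong refl loc) auto
  finally show ?thesis .
qed

text \<open>A leg \<open>(i, a)\<close> is the \<open>a\<close>-th factor \<open>\<phi>(x\<^sub>i)\<close> at the vertex \<open>i\<close>.\<close>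

definition legs :: "config \<Rightarrow> (nat \<times> nat) set \<Rightarrow> (nat \<Rightarrow> spacetime) \<Rightarrow> complex" where
  "legs \<phi> E x = (\<Prod>e\<in>E. of_real (config_fun \<phi> (x (fst e))))"

definition monomial :: "nat set \<Rightarrow> ((nat \<Rightarrow> spacetime) \<Rightarrow> complex) \<Rightarrow> (nat \<times> nat) set \<Rightarrow> functional" where
  "monomial I c E = (\<lambda>\<phi>. LINT x|vol I. c x * legs \<phi> E x)"

text \<open>There is one kernel for all vertices because after a contraction it no longer factorises
  between the two arguments.\<close>

definition bimonomial ::
  "nat set \<Rightarrow> ((nat \<Rightarrow> spacetime) \<Rightarrow> complex) \<Rightarrow> (nat \<times> nat) set \<Rightarrow> (nat \<times> nat) set \<Rightarrow> bifunctional" where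
  "bimonomial I c E E' = (\<lambda>\<phi> \<psi>. LINT x|vol I. c x * legs \<phi> E x * legs \<psi> E' x)"

section \<open>Legs and the derivative of a monomial\<close>

lemma continuous_on_coordinate: "continuous_on S (\<lambda>x::nat \<Rightarrow> spacetime. x i)"
  by (rule continuous_on_product_then_coordinatewise[OF continuous_on_id])

lemma continuous_legs: "continuous_on UNIV (legs \<phi> E)"
proof -
  have "continuous_on UNIV (\<lambda>x::nat \<Rightarrow> spacetime. config_fun \<phi> (x i))" for i
    by (rule continuous_on_compose2[OF smooth_continuous continuous_on_coordinate]) (use config_fun[of \<phi>] in auto)
  then show ?thesis unfolding legs_def by (intro continuous_on_prod continuous_on_of_real)
qed

lemma legs_cong: "(\<And>e. e \<in> E \<Longrightarrow> x (fst e) = y (fst e)) \<Longrightarrow> legs \<phi> E x = legs \<phi> E y"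
  by (simp add: legs_def)

lemma legs_Un: "finite E \<Longrightarrow> finite E' \<Longrightarrow> E \<inter> E' = {} \<Longrightarrow> legs \<phi> (E \<union> E') x = legs \<phi> E x * legs \<phi> E' x"
  by (simp add: legs_def prod.union_disjoint)

lemma kern_legs:
  assumes "c \<in> kern I U" "fst ` E \<subseteq> I"
  shows "(\<lambda>x. c x * legs \<phi> E x) \<in> kern I U"
  by (rule kern_times_continuous[OF assms(1) continuous_legs legs_cong]) (use assms(2) in auto)

lemma legs_add_scaleR:
  assumes "finite E"
  shows "legs (\<phi> + t *\<^sub>R h) E x = (\<Sum>B\<in>Pow E. of_real t ^ card B * (legs h B x * legs \<phi> (E - B) x))"
proof -
  have "legs (\<phi> + t *\<^sub>R h) E x =
      (\<Prod>e\<in>E. of_real t * of_real (config_fun h (x (fst e))) + of_real (config_fun \<phi> (x (fst e))))"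
    by (simp add: legs_def config_fun_add config_fun_scaleR add.commute)
  also have "\<dots> = (\<Sum>B\<in>Pow E. (\<Prod>e\<in>B. of_real t * of_real (config_fun h (x (fst e)))) *
      (\<Prod>e\<in>E - B. of_real (config_fun \<phi> (x (fst e)))))"
    by (rule prod_add[OF assms])
  finally show ?thesis by (simp add: legs_def prod.distrib mult.assoc)
qed

text \<open>Along \<open>h\<close> the monomial is a polynomial in \<open>t\<close> whose
  coefficients are indexed by the sets \<open>B\<close> of legs that receive \<open>h\<close>; only
  one-element sets contribute to the derivative at 0. Splitting off the vertex of that one leg
  exhibits the density.\<close>

lemma has_func_deriv_monomial:
  assumes c: "c \<in> kern I U" and I: "finite I" and E: "finite E" "fst ` E \<subseteq> I"
  shows "has_func_deriv (monomial I c E) \<phi>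
    (\<lambda>y. \<Sum>e\<in>E. LINT x|vol (I - {fst e}). c (x(fst e := y)) * legs \<phi> (E - {e}) (x(fst e := y)))"
    (is "has_func_deriv _ _ (\<lambda>y. \<Sum>e\<in>E. ?k e y)")
proof -
  have kE: "(\<lambda>x. c x * legs \<phi> (E - {e}) x) \<in> kern I U" for e
    using E(2) by (intro kern_legs[OF c]) auto
  have kc: "continuous_on UNIV (?k e)" "compact (supp (?k e))" if "e \<in> E" for e
    using continuous_compact_integral_fun_upd[OF kE I, of "fst e" "I - {fst e}" e] E(2) that by auto
  have ki: "integrable lborel (\<lambda>y. ?k e y * of_real (config_fun h y))" if "e \<in> E" for e h
  proof -
    have "\<exists>K. compact K \<and> (\<forall>x. x \<notin> K \<longrightarrow> ?k e x = 0)"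
      using kc(2)[OF that] unfolding compact_supp_iff .
    then obtain K where "compact K" "\<forall>x. x \<notin> K \<longrightarrow> ?k e x = 0" by blast
    moreover have "continuous_on UNIV (config_fun h)" using config_fun[of h] smooth_continuous by blast
    ultimately show ?thesis using kc(1)[OF that]
      by (intro integrable_continuous_compact_supp[of _ K]) (auto intro!: continuous_intros)
  qed
  have deriv: "((\<lambda>t. monomial I c E (\<phi> + t *\<^sub>R h)) has_vector_derivative
      (\<Sum>e\<in>E. LINT y|lborel. ?k e y * of_real (config_fun h y))) (at 0)" for h
  proof -
    define C where "C B = (LINT x|vol I. c x * (legs h B x * legs \<phi> (E - B) x))" for B
    have int: "integrable (vol I) (\<lambda>x. c x * (legs h B x * legs \<phi> (E - B) x))" if "B \<in> Pow E" for B
    proof -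
      have "(\<lambda>x. c x * legs h B x * legs \<phi> (E - B) x) \<in> kern I U"
        using that E by (intro kern_legs c) auto
      then show ?thesis using kern_integrable[OF _ I] by (simp add: mult.assoc)
    qed
    have monomial_eq: "monomial I c E (\<phi> + t *\<^sub>R h) = (\<Sum>B\<in>Pow E. of_real t ^ card B * C B)" for t
    proof -
      have "c x * legs (\<phi> + t *\<^sub>R h) E x =
          (\<Sum>B\<in>Pow E. of_real t ^ card B * (c x * (legs h B x * legs \<phi> (E - B) x)))" for x
        unfolding legs_add_scaleR[OF E(1)] sum_distrib_left by (intro sum.cong refl) (simp only: mult_ac)
      then have "monomial I c E (\<phi> + t *\<^sub>R h) =
          (LINT x|vol I. (\<Sum>B\<in>Pow E. of_real t ^ card B * (c x * (legs h B x * legs \<phi> (E - B) x))))"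
        unfolding monomial_def by simp
      also have "\<dots> = (\<Sum>B\<in>Pow E. of_real t ^ card B * C B)"
        unfolding C_def by (subst Bochner_Integration.integral_sum) (use int in auto)
      finally show ?thesis .
    qed
    have d: "((\<lambda>t. of_real t ^ n * z) has_vector_derivative (if n = 1 then z else 0)) (at (0::real))"
      for n and z :: complex
    proof -
      have "((\<lambda>t. t ^ n *\<^sub>R z) has_vector_derivative (real n * 0 ^ (n - 1)) *\<^sub>R z) (at (0::real))"
        by (intro has_vector_derivative_scaleR[THEN has_vector_derivative_eq_rhs])
           (auto intro!: derivative_eq_intros simp: has_real_derivative_iff_has_vector_derivative[symmetric])
      moreover have "(real n * 0 ^ (n - 1)) *\<^sub>R z = (if n = 1 then z else 0)"
        by (cases "n - 1 = 0") (auto simp: le_Suc_eq)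
      moreover have "(\<lambda>t. t ^ n *\<^sub>R z) = (\<lambda>t. of_real t ^ n * z)"
        by (simp add: scaleR_conv_of_real)
      ultimately show ?thesis by simp
    qed
    have "((\<lambda>t. \<Sum>B\<in>Pow E. of_real t ^ card B * C B) has_vector_derivative
        (\<Sum>B\<in>Pow E. if card B = 1 then C B else 0)) (at 0)"
      by (intro has_vector_derivative_sum d)
    also have "(\<Sum>B\<in>Pow E. if card B = 1 then C B else 0) = (\<Sum>B\<in>(\<lambda>e. {e}) ` E. C B)"
    proof -
      have "{B \<in> Pow E. card B = 1} = (\<lambda>e. {e}) ` E" by (auto simp: card_1_singleton_iff)
      then show ?thesis using E by (simp add: sum.inter_filter[symmetric])
    qed
    also have "\<dots> = (\<Sum>e\<in>E. C {e})" by (subst sum.reindex) (auto simp: inj_on_def)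
    also have "\<dots> = (\<Sum>e\<in>E. LINT y|lborel. ?k e y * of_real (config_fun h y))"
    proof (rule sum.cong[OF refl])
      fix e assume e: "e \<in> E"
      let ?c = "\<lambda>x. c x * legs \<phi> (E - {e}) x * legs h {e} x"
      have "?c \<in> kern I U" using E(2) e by (intro kern_legs[OF kE]) auto
      then have "(LINT x|vol I. ?c x) = (LINT y|lborel. LINT x|vol (I - {fst e}). ?c (x(fst e := y)))"
        using E(2) e by (intro integral_vol_insert[OF _ I]) auto
      then show "C {e} = (LINT y|lborel. ?k e y * of_real (config_fun h y))"
        by (simp add: C_def legs_def mult_ac)
    qed
    finally show ?thesis unfolding monomial_eq .
  qed
  show ?thesis unfolding has_func_deriv_def
  proof (intro conjI allI)
    show "continuous_on UNIV (\<lambda>y. \<Sum>e\<in>E. ?k e y)" using kc(1) by (intro continuous_on_sum)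
    have "\<exists>K. compact K \<and> (\<forall>x. x \<notin> K \<longrightarrow> ?k e x = 0)" if "e \<in> E" for e
      using kc(2)[OF that] unfolding compact_supp_iff .
    then have "\<forall>e\<in>E. \<exists>K. compact K \<and> (\<forall>x. x \<notin> K \<longrightarrow> ?k e x = 0)" by (rule ballI)
    from bchoice[OF this] obtain K where K: "\<forall>e\<in>E. compact (K e) \<and> (\<forall>x. x \<notin> K e \<longrightarrow> ?k e x = 0)" by (rule exE)
    show "compact (supp (\<lambda>y. \<Sum>e\<in>E. ?k e y))"
      unfolding compact_supp_iff
    proof (intro exI conjI allI impI)
      show "compact (\<Union>e\<in>E. K e)" by (rule compact_UN[OF E(1)]) (use K in blast)
      fix y assume "y \<notin> (\<Union>e\<in>E. K e)"
      then have "?k e y = 0" if "e \<in> E" for e using bspec[OF K that] that by blast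
      then show "(\<Sum>e\<in>E. ?k e y) = 0" by (rule sum.neutral[OF ballI])
    qed
    fix h
    show "((\<lambda>t. monomial I c E (\<phi> + t *\<^sub>R h)) has_vector_derivative
        (LINT y|lborel. (\<Sum>e\<in>E. ?k e y) * of_real (config_fun h y))) (at 0)"
    proof -
      have "(LINT y|lborel. (\<Sum>e\<in>E. ?k e y) * of_real (config_fun h y)) =
          (\<Sum>e\<in>E. LINT y|lborel. ?k e y * of_real (config_fun h y))"
        unfolding sum_distrib_right by (rule Bochner_Integration.integral_sum) (rule ki)
      then show ?thesis by (simp only: deriv)
    qed
  qed
qed

section \<open>The exponential of the contraction operator\<close>

text \<open>Conditions under which one application of \<open>Gamma_op\<close> behaves additively:
  the derivatives given by definite descriptions exist and the integrand is integrable.\<close>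

definition regular :: "(spacetime \<Rightarrow> complex) \<Rightarrow> bifunctional \<Rightarrow> bool" where
  "regular D F \<longleftrightarrow> (\<forall>\<phi> \<psi>. \<exists>k. has_func_deriv (\<lambda>\<phi>'. F \<phi>' \<psi>) \<phi> k) \<and>
     (\<forall>y \<phi> \<psi>. \<exists>k. has_func_deriv (func_deriv_left y F \<phi>) \<psi> k) \<and>
     (\<forall>\<phi> \<psi>. integrable lborel
        (\<lambda>z. D (fst z - snd z) * func_deriv_right (snd z) (func_deriv_left (fst z) F) \<phi> \<psi>))"

lemma regular_add:
  assumes F: "regular D F" and G: "regular D G"
  shows "regular D (\<lambda>\<phi> \<psi>. F \<phi> \<psi> + G \<phi> \<psi>)"
    and "Gamma_op D (\<lambda>\<phi> \<psi>. F \<phi> \<psi> + G \<phi> \<psi>) = (\<lambda>\<phi> \<psi>. Gamma_op D F \<phi> \<psi> + Gamma_op D G \<phi> \<psi>)"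
proof -
  let ?H = "\<lambda>\<phi> \<psi>. F \<phi> \<psi> + G \<phi> \<psi>"
  have 1: "\<exists>k. has_func_deriv (\<lambda>\<phi>'. ?H \<phi>' \<psi>) \<phi> k"
    and l: "func_deriv_left y ?H \<phi> \<psi> = func_deriv_left y F \<phi> \<psi> + func_deriv_left y G \<phi> \<psi>" for y \<phi> \<psi>
  proof -
    obtain k k' where k: "has_func_deriv (\<lambda>\<phi>'. F \<phi>' \<psi>) \<phi> k" "has_func_deriv (\<lambda>\<phi>'. G \<phi>' \<psi>) \<phi> k'"
      using F G unfolding regular_def by metis
    show "\<exists>k. has_func_deriv (\<lambda>\<phi>'. ?H \<phi>' \<psi>) \<phi> k" using has_func_deriv_add[OF k] by blast
    show "func_deriv_left y ?H \<phi> \<psi> = func_deriv_left y F \<phi> \<psi> + func_deriv_left y G \<phi> \<psi>"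
      unfolding func_deriv_left_def func_deriv_eq[OF has_func_deriv_add[OF k]]
        func_deriv_eq[OF k(1)] func_deriv_eq[OF k(2)] ..
  qed
  have l': "func_deriv_left y ?H \<phi> = (\<lambda>\<psi>. func_deriv_left y F \<phi> \<psi> + func_deriv_left y G \<phi> \<psi>)" for y \<phi>
    by (rule ext) (rule l)
  have 2: "\<exists>k. has_func_deriv (func_deriv_left y ?H \<phi>) \<psi> k"
    and r: "func_deriv_right z (func_deriv_left y ?H) \<phi> \<psi> =
      func_deriv_right z (func_deriv_left y F) \<phi> \<psi> + func_deriv_right z (func_deriv_left y G) \<phi> \<psi>" for y z \<phi> \<psi>
  proof -
    obtain k k' where k: "has_func_deriv (func_deriv_left y F \<phi>) \<psi> k" "has_func_deriv (func_deriv_left y G \<phi>) \<psi> k'"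
      using F G unfolding regular_def by metis
    show "\<exists>k. has_func_deriv (func_deriv_left y ?H \<phi>) \<psi> k"
      unfolding l' using has_func_deriv_add[OF k] by blast
    show "func_deriv_right z (func_deriv_left y ?H) \<phi> \<psi> =
      func_deriv_right z (func_deriv_left y F) \<phi> \<psi> + func_deriv_right z (func_deriv_left y G) \<phi> \<psi>"
      unfolding func_deriv_right_def l' func_deriv_eq[OF has_func_deriv_add[OF k]]
        func_deriv_eq[OF k(1)] func_deriv_eq[OF k(2)] ..
  qed
  have i: "integrable lborel (\<lambda>z. D (fst z - snd z) * func_deriv_right (snd z) (func_deriv_left (fst z) F) \<phi> \<psi>)"
    "integrable lborel (\<lambda>z. D (fst z - snd z) * func_deriv_right (snd z) (func_deriv_left (fst z) G) \<phi> \<psi>)" for \<phi> \<psi>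
    using F G unfolding regular_def by blast+
  show "regular D ?H"
    unfolding regular_def r distrib_left using 1 2 i by (auto intro!: Bochner_Integration.integrable_add)
  show "Gamma_op D ?H = (\<lambda>\<phi> \<psi>. Gamma_op D F \<phi> \<psi> + Gamma_op D G \<phi> \<psi>)"
    unfolding Gamma_op_def r distrib_left using i by (simp add: Bochner_Integration.integral_add)
qed

lemma regular_zero: "regular D (\<lambda>\<phi> \<psi>. 0)" and Gamma_op_zero: "Gamma_op D (\<lambda>\<phi> \<psi>. 0) = (\<lambda>\<phi> \<psi>. 0)"
proof -
  have l: "func_deriv_left y (\<lambda>\<phi> \<psi>. 0) = (\<lambda>\<phi> \<psi>. 0)" for y
    unfolding func_deriv_left_def func_deriv_eq[OF has_func_deriv_zero] ..
  have r: "func_deriv_right y (\<lambda>\<phi> \<psi>. 0) = (\<lambda>\<phi> \<psi>. 0)" for y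
    unfolding func_deriv_right_def func_deriv_eq[OF has_func_deriv_zero] ..
  show "regular D (\<lambda>\<phi> \<psi>. 0)" unfolding regular_def l r using has_func_deriv_zero by auto
  show "Gamma_op D (\<lambda>\<phi> \<psi>. 0) = (\<lambda>\<phi> \<psi>. 0)" unfolding Gamma_op_def l r by simp
qed

lemma regular_sum:
  assumes "\<And>a. a \<in> S \<Longrightarrow> regular D (F a)"
  shows "regular D (\<lambda>\<phi> \<psi>. \<Sum>a\<in>S. F a \<phi> \<psi>)"
    and "Gamma_op D (\<lambda>\<phi> \<psi>. \<Sum>a\<in>S. F a \<phi> \<psi>) = (\<lambda>\<phi> \<psi>. \<Sum>a\<in>S. Gamma_op D (F a) \<phi> \<psi>)"
proof -
  have "regular D (\<lambda>\<phi> \<psi>. \<Sum>a\<in>S. F a \<phi> \<psi>) \<and>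
    Gamma_op D (\<lambda>\<phi> \<psi>. \<Sum>a\<in>S. F a \<phi> \<psi>) = (\<lambda>\<phi> \<psi>. \<Sum>a\<in>S. Gamma_op D (F a) \<phi> \<psi>)"
    using assms
    by (induction S rule: infinite_finite_induct) (simp_all add: regular_zero Gamma_op_zero regular_add)
  then show "regular D (\<lambda>\<phi> \<psi>. \<Sum>a\<in>S. F a \<phi> \<psi>)"
    "Gamma_op D (\<lambda>\<phi> \<psi>. \<Sum>a\<in>S. F a \<phi> \<psi>) = (\<lambda>\<phi> \<psi>. \<Sum>a\<in>S. Gamma_op D (F a) \<phi> \<psi>)" by blast+
qed

text \<open>Leibniz rule on both sides: a left and a right leg are chosen and disappear, and their
  vertices get joined by \<open>D\<close>. As the vertex sets are disjoint, fixing the vertex of a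
  left leg leaves all right legs alone (\<open>upd\<close>); \<open>integral_vol_insert2\<close>
  reabsorbs both vertices.\<close>

lemma Gamma_bimonomial:
  assumes D: "continuous_on UNIV D" and c: "c \<in> kern I U" and I: "finite I"
    and E: "finite E" "fst ` E \<subseteq> I" and E': "finite E'" "fst ` E' \<subseteq> I" and dj: "fst ` E \<inter> fst ` E' = {}"
  shows "regular D (bimonomial I c E E')"
    and "Gamma_op D (bimonomial I c E E') = (\<lambda>\<phi> \<psi>. \<Sum>e\<in>E. \<Sum>e'\<in>E'.
      bimonomial I (\<lambda>x. c x * D (x (fst e) - x (fst e'))) (E - {e}) (E' - {e'}) \<phi> \<psi>)"
proof -
  let ?F = "bimonomial I c E E'"
  let ?c1 = "\<lambda>\<phi> e y x. c (x(fst e := y)) * legs \<phi> (E - {e}) (x(fst e := y))"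
  have ne: "fst e \<noteq> fst e'" if "e \<in> E" "e' \<in> E'" for e e' using that dj by auto
  have upd: "legs \<psi> B (x(fst e := y)) = legs \<psi> B x" if "e \<in> E" "B \<subseteq> E'" for \<psi> B x e y
    by (rule legs_cong) (use ne[OF that(1)] that(2) in \<open>force simp: fun_upd_def\<close>)
  \<comment> \<open>For the left derivative the legs of the second configuration count as part of
    the kernel.\<close>
  have F1: "(\<lambda>\<phi>'. ?F \<phi>' \<psi>) = monomial I (\<lambda>x. c x * legs \<psi> E' x) E" for \<psi>
    by (simp add: bimonomial_def monomial_def mult_ac)
  have d1: "has_func_deriv (\<lambda>\<phi>'. ?F \<phi>' \<psi>) \<phi>
      (\<lambda>y. \<Sum>e\<in>E. LINT x|vol (I - {fst e}). c (x(fst e := y)) * legs \<psi> E' (x(fst e := y)) *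
         legs \<phi> (E - {e}) (x(fst e := y)))" for \<phi> \<psi>
    unfolding F1 by (rule has_func_deriv_monomial[OF kern_legs[OF c E'(2)] I E])
  have l: "func_deriv_left y ?F \<phi> = (\<lambda>\<psi>. \<Sum>e\<in>E. monomial (I - {fst e}) (?c1 \<phi> e y) E' \<psi>)" for y \<phi>
    unfolding func_deriv_left_def func_deriv_eq[OF d1] monomial_def
    by (intro ext sum.cong Bochner_Integration.integral_cong refl) (simp add: upd mult_ac)
  have c1: "?c1 \<phi> e y \<in> kern (I - {fst e}) U" if "e \<in> E" for \<phi> e y
    using E(2) by (intro kern_fun_upd[OF kern_legs[OF c]]) auto
  have d2: "has_func_deriv (func_deriv_left y ?F \<phi>) \<psi>
     (\<lambda>y'. \<Sum>e\<in>E. \<Sum>e'\<in>E'. LINT x|vol (I - {fst e} - {fst e'}).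
        ?c1 \<phi> e y (x(fst e' := y')) * legs \<psi> (E' - {e'}) (x(fst e' := y')))" for y \<phi> \<psi>
    unfolding l
  proof (rule has_func_deriv_sum)
    fix e assume e: "e \<in> E"
    have "fst ` E' \<subseteq> I - {fst e}" using ne[OF e] E'(2) by fastforce
    then show "has_func_deriv (monomial (I - {fst e}) (?c1 \<phi> e y) E') \<psi> (\<lambda>y'. \<Sum>e'\<in>E'. LINT x|vol (I - {fst e} - {fst e'}).
        ?c1 \<phi> e y (x(fst e' := y')) * legs \<psi> (E' - {e'}) (x(fst e' := y')))"
      using I E'(1) by (intro has_func_deriv_monomial[OF c1[OF e]]) auto
  qed
  define G where "G \<phi> \<psi> e e' = (\<lambda>x. c x * D (x (fst e) - x (fst e')) * legs \<phi> (E - {e}) x * legs \<psi> (E' - {e'}) x)"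
    for \<phi> \<psi> e e'
  have G: "G \<phi> \<psi> e e' \<in> kern I U" if "e \<in> E" "e' \<in> E'" for \<phi> \<psi> e e'
  proof -
    have "continuous_on UNIV (\<lambda>x::nat \<Rightarrow> spacetime. D (x (fst e) - x (fst e')))"
      by (rule continuous_on_compose2[OF D]) (auto intro!: continuous_on_diff continuous_on_coordinate)
    moreover have "fst e \<in> I" "fst e' \<in> I" using that E(2) E'(2) by auto
    ultimately have "(\<lambda>x. c x * D (x (fst e) - x (fst e'))) \<in> kern I U"
      by (intro kern_times_continuous[OF c]) auto
    then show ?thesis unfolding G_def using E(2) E'(2) by (intro kern_legs) auto
  qed
  have r: "D (fst z - snd z) * func_deriv_right (snd z) (func_deriv_left (fst z) ?F) \<phi> \<psi> =
     (\<Sum>e\<in>E. \<Sum>e'\<in>E'. LINT x|vol (I - {fst e} - {fst e'}). G \<phi> \<psi> e e' (x(fst e' := snd z, fst e := fst z)))" for z \<phi> \<psi>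
    unfolding func_deriv_right_def func_deriv_eq[OF d2] sum_distrib_left
  proof (intro sum.cong refl)
    fix e e' assume e: "e \<in> E" "e' \<in> E'"
    have "D (fst z - snd z) * (?c1 \<phi> e (fst z) (x(fst e' := snd z)) * legs \<psi> (E' - {e'}) (x(fst e' := snd z))) =
        G \<phi> \<psi> e e' (x(fst e' := snd z, fst e := fst z))" for x
      unfolding G_def using upd[OF e(1), of "E' - {e'}" \<psi> "x(fst e' := snd z)" "fst z"] ne[OF e] by simp
    then show "D (fst z - snd z) * (LINT x|vol (I - {fst e} - {fst e'}).
        ?c1 \<phi> e (fst z) (x(fst e' := snd z)) * legs \<psi> (E' - {e'}) (x(fst e' := snd z))) =
        (LINT x|vol (I - {fst e} - {fst e'}). G \<phi> \<psi> e e' (x(fst e' := snd z, fst e := fst z)))"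
      by (simp flip: integral_mult_right_zero)
  qed
  have i2: "integrable lborel (\<lambda>z. LINT x|vol (I - {fst e} - {fst e'}). G \<phi> \<psi> e e' (x(fst e' := snd z, fst e := fst z)))"
    "(LINT x|vol I. G \<phi> \<psi> e e' x) =
      (LINT z|lborel. LINT x|vol (I - {fst e} - {fst e'}). G \<phi> \<psi> e e' (x(fst e' := snd z, fst e := fst z)))"
    if "e \<in> E" "e' \<in> E'" for e e' \<phi> \<psi>
  proof -
    have "fst e \<in> I" "fst e' \<in> I" using that E(2) E'(2) by auto
    from integral_vol_insert2[OF G[OF that] I this ne[OF that] refl]
    show "integrable lborel (\<lambda>z. LINT x|vol (I - {fst e} - {fst e'}). G \<phi> \<psi> e e' (x(fst e' := snd z, fst e := fst z)))"
      "(LINT x|vol I. G \<phi> \<psi> e e' x) =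
        (LINT z|lborel. LINT x|vol (I - {fst e} - {fst e'}). G \<phi> \<psi> e e' (x(fst e' := snd z, fst e := fst z)))" .
  qed
  show "regular D ?F"
    unfolding regular_def
  proof (intro conjI allI)
    show "\<exists>k. has_func_deriv (\<lambda>\<phi>'. ?F \<phi>' \<psi>) \<phi> k" for \<phi> \<psi> by (rule exI) (rule d1)
    show "\<exists>k. has_func_deriv (func_deriv_left y ?F \<phi>) \<psi> k" for y \<phi> \<psi> by (rule exI) (rule d2)
    show "integrable lborel (\<lambda>z. D (fst z - snd z) * func_deriv_right (snd z) (func_deriv_left (fst z) ?F) \<phi> \<psi>)" for \<phi> \<psi>
      unfolding r by (intro Bochner_Integration.integrable_sum i2(1))
  qed
  show "Gamma_op D ?F = (\<lambda>\<phi> \<psi>. \<Sum>e\<in>E. \<Sum>e'\<in>E'.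
      bimonomial I (\<lambda>x. c x * D (x (fst e) - x (fst e'))) (E - {e}) (E' - {e'}) \<phi> \<psi>)"
  proof (intro ext)
    fix \<phi> \<psi>
    let ?K = "\<lambda>e e' z. LINT x|vol (I - {fst e} - {fst e'}). G \<phi> \<psi> e e' (x(fst e' := snd z, fst e := fst z))"
    have "Gamma_op D ?F \<phi> \<psi> = (LINT z|lborel. (\<Sum>e\<in>E. \<Sum>e'\<in>E'. ?K e e' z))"
      unfolding Gamma_op_def r ..
    also have "\<dots> = (\<Sum>e\<in>E. LINT z|lborel. (\<Sum>e'\<in>E'. ?K e e' z))"
      by (rule Bochner_Integration.integral_sum) (intro Bochner_Integration.integrable_sum i2(1))
    also have "\<dots> = (\<Sum>e\<in>E. \<Sum>e'\<in>E'. LINT z|lborel. ?K e e' z)"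
      by (intro sum.cong refl Bochner_Integration.integral_sum i2(1))
    also have "\<dots> = (\<Sum>e\<in>E. \<Sum>e'\<in>E'. LINT x|vol I. G \<phi> \<psi> e e' x)"
      by (intro sum.cong refl i2(2)[symmetric])
    finally show "Gamma_op D ?F \<phi> \<psi> = (\<Sum>e\<in>E. \<Sum>e'\<in>E'.
      bimonomial I (\<lambda>x. c x * D (x (fst e) - x (fst e'))) (E - {e}) (E' - {e'}) \<phi> \<psi>)"
      unfolding G_def bimonomial_def .
  qed
qed

text \<open>Every iterate is \<open>regular\<close> and the series breaks off, which makes
  \<open>exp_Gamma\<close> additive.\<close>

definition good :: "(spacetime \<Rightarrow> complex) \<Rightarrow> bifunctional \<Rightarrow> bool" where
  "good D F \<longleftrightarrow> (\<forall>k. regular D ((Gamma_op D ^^ k) F)) \<and> (\<exists>N. \<forall>k\<ge>N. (Gamma_op D ^^ k) F = (\<lambda>\<phi> \<psi>. 0))"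

lemma good_add:
  assumes "good D F" "good D G"
  shows "good D (\<lambda>\<phi> \<psi>. F \<phi> \<psi> + G \<phi> \<psi>)"
    and "exp_Gamma D (\<lambda>\<phi> \<psi>. F \<phi> \<psi> + G \<phi> \<psi>) = (\<lambda>\<phi> \<psi>. exp_Gamma D F \<phi> \<psi> + exp_Gamma D G \<phi> \<psi>)"
proof -
  have k: "(Gamma_op D ^^ k) (\<lambda>\<phi> \<psi>. F \<phi> \<psi> + G \<phi> \<psi>) =
      (\<lambda>\<phi> \<psi>. (Gamma_op D ^^ k) F \<phi> \<psi> + (Gamma_op D ^^ k) G \<phi> \<psi>)" for k
    using assms by (induction k) (simp_all add: good_def regular_add)
  obtain N N' where N: "\<And>k. k \<ge> N \<Longrightarrow> (Gamma_op D ^^ k) F = (\<lambda>\<phi> \<psi>. 0)" "\<And>k. k \<ge> N' \<Longrightarrow> (Gamma_op D ^^ k) G = (\<lambda>\<phi> \<psi>. 0)"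
    using assms unfolding good_def by metis
  show "good D (\<lambda>\<phi> \<psi>. F \<phi> \<psi> + G \<phi> \<psi>)"
    unfolding good_def k using assms N by (auto simp: good_def regular_add intro!: exI[of _ "max N N'"])
  have "summable (\<lambda>k. (Gamma_op D ^^ k) F \<phi> \<psi> / fact k)" "summable (\<lambda>k. (Gamma_op D ^^ k) G \<phi> \<psi> / fact k)" for \<phi> \<psi>
    using N by (auto intro!: summable_finite[of "{..<max N N'}"] simp flip: not_le)
  then show "exp_Gamma D (\<lambda>\<phi> \<psi>. F \<phi> \<psi> + G \<phi> \<psi>) = (\<lambda>\<phi> \<psi>. exp_Gamma D F \<phi> \<psi> + exp_Gamma D G \<phi> \<psi>)"
    unfolding exp_Gamma_def k add_divide_distrib by (simp add: suminf_add)
qed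

text \<open>These matchings are partial: legs that no pair covers remain as fields.\<close>

definition matchings :: "'a set \<Rightarrow> 'a set set set" where
  "matchings E = {M. \<Union>M \<subseteq> E \<and> disjoint M \<and> (\<forall>p\<in>M. card p = 2)}"

text \<open>The contractions made by iterating \<open>Gamma_op\<close>, which always takes one leg
  from each factor.\<close>

definition crossings :: "'a set \<Rightarrow> 'a set \<Rightarrow> 'a set set set" where
  "crossings E E' = {M \<in> matchings (E \<union> E'). \<forall>p\<in>M. p \<inter> E \<noteq> {} \<and> p \<inter> E' \<noteq> {}}"

section \<open>Counting crossings\<close>

lemma finite_matchings: "finite E \<Longrightarrow> finite (matchings E)"
  by (rule finite_subset[of _ "Pow (Pow E)"]) (auto simp: matchings_def)

lemma finite_crossings: "finite E \<Longrightarrow> finite E' \<Longrightarrow> finite (crossings E E')"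
  by (simp add: crossings_def finite_matchings)

lemma matching_finite: "finite E \<Longrightarrow> M \<in> matchings E \<Longrightarrow> finite M"
  by (rule finite_subset[of _ "Pow E"]) (auto simp: matchings_def)

lemma crossing_finite: "finite E \<Longrightarrow> finite E' \<Longrightarrow> M \<in> crossings E E' \<Longrightarrow> finite M"
  using matching_finite[of "E \<union> E'" M] by (simp add: crossings_def)

lemma crossing_pair:
  assumes "M \<in> crossings E E'" "p \<in> M" "E \<inter> E' = {}"
  obtains e e' where "p = {e, e'}" "e \<in> E" "e' \<in> E'" "e \<noteq> e'" "p \<inter> E = {e}" "p \<inter> E' = {e'}"
proof -
  have "card p = 2" "p \<inter> E \<noteq> {}" "p \<inter> E' \<noteq> {}" using assms(1,2) by (auto simp: crossings_def matchings_def)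
  moreover then obtain e e' where "e \<in> p" "e \<in> E" "e' \<in> p" "e' \<in> E'" by blast
  moreover then have ne: "e \<noteq> e'" using assms(3) by auto
  ultimately have p: "p = {e, e'}" by (auto simp: card_2_iff)
  then have "p \<inter> E = {e}" "p \<inter> E' = {e'}" using \<open>e \<in> E\<close> \<open>e' \<in> E'\<close> assms(3) by auto
  with that p ne \<open>e \<in> E\<close> \<open>e' \<in> E'\<close> show ?thesis by blast
qed

lemma insert_crossing:
  assumes "B \<in> crossings E E'" "e \<in> E - \<Union>B" "e' \<in> E' - \<Union>B" "E \<inter> E' = {}"
  shows "insert {e, e'} B \<in> crossings E E'"
proof -
  have B: "\<Union>B \<subseteq> E \<union> E'" "disjoint B" "\<forall>p\<in>B. card p = 2" "\<forall>p\<in>B. p \<inter> E \<noteq> {} \<and> p \<inter> E' \<noteq> {}"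
    using assms(1) by (auto simp: crossings_def matchings_def)
  have "e \<noteq> e'" using assms by auto
  have "disjnt {e, e'} q" if "q \<in> B" for q using that assms(2,3) by (auto simp: disjnt_def)
  then have "disjoint (insert {e, e'} B)" using B(2) by (simp add: pairwise_insert disjnt_sym)
  then show ?thesis using B assms(2,3) \<open>e \<noteq> e'\<close>
    unfolding crossings_def matchings_def mem_Collect_eq by (intro conjI) auto
qed

lemma remove_crossing: "B \<in> crossings E E' \<Longrightarrow> B - {p} \<in> crossings E E'"
  unfolding crossings_def matchings_def using pairwise_subset[of disjnt B "B - {p}"] by auto

text \<open>Double counting: a crossing of size \<open>Suc k\<close> arises from crossings of size
  \<open>k\<close> in \<open>Suc k\<close> ways, one for each of its pairs being added last. The
  bijection remembers the added pair.\<close>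

lemma sum_crossings_insert:
  assumes "finite E" "finite E'" "E \<inter> E' = {}"
  shows "(\<Sum>B | B \<in> crossings E E' \<and> card B = k. \<Sum>e\<in>E - \<Union>B. \<Sum>e'\<in>E' - \<Union>B. f (insert {e, e'} B)) =
     of_nat (Suc k) * (\<Sum>B | B \<in> crossings E E' \<and> card B = Suc k. f B :: complex)"
proof -
  let ?C = "\<lambda>k. {B \<in> crossings E E'. card B = k}"
  have fin: "finite (?C k)" for k using finite_crossings[OF assms(1,2)] by auto
  have finB: "finite B" if "B \<in> ?C k" for B k using that crossing_finite[OF assms(1,2)] by auto
  have "(\<Sum>B\<in>?C k. \<Sum>e\<in>E - \<Union>B. \<Sum>e'\<in>E' - \<Union>B. f (insert {e, e'} B)) =
     (\<Sum>(B, e, e') \<in> (SIGMA B:?C k. (E - \<Union>B) \<times> (E' - \<Union>B)). f (insert {e, e'} B))"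
    unfolding sum.cartesian_product by (rule sum.Sigma) (use assms fin in auto)
  also have "\<dots> = (\<Sum>(B, p) \<in> (SIGMA B:?C (Suc k). B). f B)"
  proof (rule sum.reindex_bij_witness[where j = "\<lambda>(B, e, e'). (insert {e, e'} B, {e, e'})"
        and i = "\<lambda>(B, p). (B - {p}, the_elem (p \<inter> E), the_elem (p \<inter> E'))"])
    fix a assume "a \<in> (SIGMA B:?C k. (E - \<Union>B) \<times> (E' - \<Union>B))"
    then obtain B e e' where a: "a = (B, e, e')" and B: "B \<in> crossings E E'" "card B = k"
      and e: "e \<in> E" "e \<notin> \<Union>B" "e' \<in> E'" "e' \<notin> \<Union>B" by auto
    have n: "{e, e'} \<notin> B" using e by auto
    have ne: "e \<noteq> e'" and ne': "e \<notin> E'" "e' \<notin> E" using e assms(3) by auto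
    have i: "{e, e'} \<inter> E = {e}" "{e, e'} \<inter> E' = {e'}" using e ne' by auto
    show "(case (case a of (B, e, e') \<Rightarrow> (insert {e, e'} B, {e, e'})) of
        (B, p) \<Rightarrow> (B - {p}, the_elem (p \<inter> E), the_elem (p \<inter> E'))) = a"
      using n by (simp add: a i)
    have "insert {e, e'} B \<in> ?C (Suc k)"
      using insert_crossing[OF B(1) _ _ assms(3), of e e'] e n B finB[of B k] by simp
    then show "(case a of (B, e, e') \<Rightarrow> (insert {e, e'} B, {e, e'})) \<in> (SIGMA B:?C (Suc k). B)"
      unfolding a prod.case by (intro SigmaI) auto
    show "(case (case a of (B, e, e') \<Rightarrow> (insert {e, e'} B, {e, e'})) of (B, p) \<Rightarrow> f B) =
       (case a of (B, e, e') \<Rightarrow> f (insert {e, e'} B))" by (simp add: a)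
  next
    fix b assume "b \<in> (SIGMA B:?C (Suc k). B)"
    then obtain B p where b: "b = (B, p)" and B: "B \<in> crossings E E'" "card B = Suc k" "p \<in> B" by auto
    obtain e e' where p: "p = {e, e'}" "e \<in> E" "e' \<in> E'" "e \<noteq> e'" "p \<inter> E = {e}" "p \<inter> E' = {e'}"
      using crossing_pair[OF B(1,3) assms(3)] by metis
    have ins: "insert p (B - {p}) = B" using B(3) by auto
    have dB: "disjoint B" using B(1) by (simp add: crossings_def matchings_def)
    have np: "q \<inter> p = {}" if "q \<in> B - {p}" for q
      using pairwiseD[OF dB, of q p] that B(3) by (simp add: disjnt_def)
    have m: "B - {p} \<in> ?C k" using remove_crossing[OF B(1), of p] B(2,3) by simp
    have u: "x \<notin> \<Union>(B - {p})" if "x \<in> p" for x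
    proof
      assume "x \<in> \<Union>(B - {p})"
      then obtain q where "x \<in> q" "q \<in> B - {p}" by (rule UnionE)
      then show False using np[of q] that by auto
    qed
    show "(case (case b of (B, p) \<Rightarrow> (B - {p}, the_elem (p \<inter> E), the_elem (p \<inter> E'))) of
        (B, e, e') \<Rightarrow> (insert {e, e'} B, {e, e'})) = b"
      by (simp only: b prod.case p(5,6) the_elem_eq p(1)[symmetric] ins)
    show "(case b of (B, p) \<Rightarrow> (B - {p}, the_elem (p \<inter> E), the_elem (p \<inter> E'))) \<in>
        (SIGMA B:?C k. (E - \<Union>B) \<times> (E' - \<Union>B))"
      unfolding b prod.case p(5,6) the_elem_eq
      using p(2,3) u[of e] u[of e'] unfolding p(1)[symmetric] by (intro SigmaI m DiffI) (auto simp: p(1))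
  qed
  also have "\<dots> = (\<Sum>B\<in>?C (Suc k). \<Sum>p\<in>B. f B)"
    by (rule sum.Sigma[symmetric]) (use fin finB in blast)+
  also have "\<dots> = (\<Sum>B\<in>?C (Suc k). of_nat (Suc k) * f B)" by (intro sum.cong) auto
  finally show ?thesis by (simp only: sum_distrib_left)
qed

text \<open>\<open>D\<close> need not be even, so a pair is read from its leg in \<open>E\<close> to
  its leg in \<open>E'\<close>. For a crossing of disjoint sets both intersections are
  singletons.\<close>

definition edge ::
  "(spacetime \<Rightarrow> complex) \<Rightarrow> (nat \<times> nat) set \<Rightarrow> (nat \<times> nat) set \<Rightarrow> (nat \<times> nat) set \<Rightarrow> (nat \<Rightarrow> spacetime) \<Rightarrow> complex"
  where "edge D E E' p x = D (x (fst (the_elem (p \<inter> E))) - x (fst (the_elem (p \<inter> E'))))"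

lemma kern_edges:
  assumes D: "continuous_on UNIV D" and c: "c \<in> kern I U" and E: "fst ` E \<subseteq> I" "fst ` E' \<subseteq> I" "E \<inter> E' = {}"
    and B: "B \<in> crossings E E'"
  shows "(\<lambda>x. c x * (\<Prod>p\<in>B. edge D E E' p x)) \<in> kern I U"
proof (rule kern_times_continuous[OF c])
  show "continuous_on UNIV (\<lambda>x. \<Prod>p\<in>B. edge D E E' p x)"
    unfolding edge_def
    by (intro continuous_on_prod continuous_on_compose2[OF D] continuous_on_diff continuous_on_coordinate) auto
  fix x y :: "nat \<Rightarrow> spacetime" assume xy: "\<And>i. i \<in> I \<Longrightarrow> x i = y i"
  show "(\<Prod>p\<in>B. edge D E E' p x) = (\<Prod>p\<in>B. edge D E E' p y)"
  proof (rule prod.cong[OF refl])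
    fix p assume "p \<in> B"
    then obtain e e' where "e \<in> E" "e' \<in> E'" "p \<inter> E = {e}" "p \<inter> E' = {e'}"
      using crossing_pair[OF B _ E(3)] by metis
    moreover then have "fst e \<in> I" "fst e' \<in> I" using E by auto
    ultimately show "edge D E E' p x = edge D E E' p y" by (simp add: edge_def xy)
  qed
qed

section \<open>Iterated contractions of bimonomials\<close>

lemma bimonomial_scale: "bimonomial I (\<lambda>x. z * c x) E E' \<phi> \<psi> = z * bimonomial I c E E' \<phi> \<psi>"
  by (simp add: bimonomial_def mult.assoc)

lemma monomial_scale: "monomial I (\<lambda>x. z * c x) E \<phi> = z * monomial I c E \<phi>"
  by (simp add: monomial_def mult.assoc)

text \<open>All orders of performing \<open>k\<close> contractions lead to the same crossing, whence
  \<open>fact k\<close>. In \<open>H\<close> this factor sits inside the kernel, so that each stage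
  is literally a sum of bimonomials.\<close>

lemma Gamma_power_bimonomial:
  assumes D: "continuous_on UNIV D" and c: "c \<in> kern I U" and I: "finite I"
    and E: "finite E" "fst ` E \<subseteq> I" and E': "finite E'" "fst ` E' \<subseteq> I" and dj: "fst ` E \<inter> fst ` E' = {}"
  shows "(Gamma_op D ^^ k) (bimonomial I c E E') = (\<lambda>\<phi> \<psi>. \<Sum>B | B \<in> crossings E E' \<and> card B = k.
      fact k * bimonomial I (\<lambda>x. c x * (\<Prod>p\<in>B. edge D E E' p x)) (E - \<Union>B) (E' - \<Union>B) \<phi> \<psi>)" (is "?Gk k")
    and "regular D ((Gamma_op D ^^ k) (bimonomial I c E E'))"
proof -
  define G where "G = (\<lambda>B. bimonomial I (\<lambda>x. c x * (\<Prod>p\<in>B. edge D E E' p x)) (E - \<Union>B) (E' - \<Union>B))"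
  define H where "H k B = bimonomial I (\<lambda>x. fact k * (c x * (\<Prod>p\<in>B. edge D E E' p x))) (E - \<Union>B) (E' - \<Union>B)" for k B
  have HG: "H k B \<phi> \<psi> = fact k * G B \<phi> \<psi>" for k B \<phi> \<psi> by (simp add: H_def G_def bimonomial_scale)
  have EE: "E \<inter> E' = {}" using dj by auto
  let ?C = "\<lambda>k. {B. B \<in> crossings E E' \<and> card B = k}"
  have ker: "(\<lambda>x. fact k * (c x * (\<Prod>p\<in>B. edge D E E' p x))) \<in> kern I U" if "B \<in> crossings E E'" for k B
    by (intro kern_scale kern_edges[OF D c E(2) E'(2) EE that])
  have sub: "finite (E - \<Union>B)" "fst ` (E - \<Union>B) \<subseteq> I" "finite (E' - \<Union>B)" "fst ` (E' - \<Union>B) \<subseteq> I"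
     "fst ` (E - \<Union>B) \<inter> fst ` (E' - \<Union>B) = {}" for B :: "(nat \<times> nat) set set"
    using E E' dj by auto
  have reg: "regular D (H k B)" if "B \<in> ?C k" for k B
    unfolding H_def by (rule Gamma_bimonomial(1)[OF D ker I sub]) (use that in auto)
  have Gam: "Gamma_op D (H k B) \<phi> \<psi> =
      fact k * (\<Sum>e\<in>E - \<Union>B. \<Sum>e'\<in>E' - \<Union>B. G (insert {e, e'} B) \<phi> \<psi>)" if B: "B \<in> ?C k" for k B \<phi> \<psi>
  proof -
    have BB: "B \<in> crossings E E'" using B by auto
    have fB: "finite B" using crossing_finite[OF E(1) E'(1) BB] .
    have "Gamma_op D (H k B) \<phi> \<psi> = (\<Sum>e\<in>E - \<Union>B. \<Sum>e'\<in>E' - \<Union>B.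
       bimonomial I (\<lambda>x. fact k * (c x * (\<Prod>p\<in>B. edge D E E' p x)) * D (x (fst e) - x (fst e')))
         (E - \<Union>B - {e}) (E' - \<Union>B - {e'}) \<phi> \<psi>)"
      unfolding H_def by (subst Gamma_bimonomial(2)[OF D ker[OF BB] I sub]) simp
    also have "\<dots> = (\<Sum>e\<in>E - \<Union>B. \<Sum>e'\<in>E' - \<Union>B. fact k * G (insert {e, e'} B) \<phi> \<psi>)"
    proof (intro sum.cong refl)
      fix e e' assume e: "e \<in> E - \<Union>B" "e' \<in> E' - \<Union>B"
      have ne: "e \<notin> E'" "e' \<notin> E" using e EE by auto
      have n: "{e, e'} \<notin> B" using e by auto
      have i: "{e, e'} \<inter> E = {e}" "{e, e'} \<inter> E' = {e'}" using e ne by auto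
      have s: "E - \<Union>B - {e} = E - \<Union>(insert {e, e'} B)" "E' - \<Union>B - {e'} = E' - \<Union>(insert {e, e'} B)"
        using ne by auto
      have "(\<lambda>x. fact k * (c x * (\<Prod>p\<in>B. edge D E E' p x)) * D (x (fst e) - x (fst e'))) =
         (\<lambda>x. fact k * (c x * (\<Prod>p\<in>insert {e, e'} B. edge D E E' p x)))"
        using n fB by (auto simp: edge_def i mult_ac)
      then show "bimonomial I (\<lambda>x. fact k * (c x * (\<Prod>p\<in>B. edge D E E' p x)) * D (x (fst e) - x (fst e')))
         (E - \<Union>B - {e}) (E' - \<Union>B - {e'}) \<phi> \<psi> = fact k * G (insert {e, e'} B) \<phi> \<psi>"
        unfolding s by (simp only: bimonomial_scale G_def)
    qed
    finally show ?thesis by (simp add: sum_distrib_left)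
  qed
  have main: "(Gamma_op D ^^ k) (bimonomial I c E E') = (\<lambda>\<phi> \<psi>. \<Sum>B\<in>?C k. H k B \<phi> \<psi>)" for k
  proof (induction k)
    case 0
    have "?C 0 = {{}}" using crossing_finite[OF E(1) E'(1)] by (auto simp: crossings_def matchings_def)
    then show ?case by (simp add: H_def)
  next
    case (Suc k)
    have "(Gamma_op D ^^ Suc k) (bimonomial I c E E') = Gamma_op D (\<lambda>\<phi> \<psi>. \<Sum>B\<in>?C k. H k B \<phi> \<psi>)"
      by (simp add: Suc.IH)
    also have "\<dots> = (\<lambda>\<phi> \<psi>. \<Sum>B\<in>?C k. Gamma_op D (H k B) \<phi> \<psi>)"
      by (rule regular_sum(2)) (rule reg)
    also have "\<dots> = (\<lambda>\<phi> \<psi>. \<Sum>B\<in>?C (Suc k). H (Suc k) B \<phi> \<psi>)"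
    proof (intro ext)
      fix \<phi> \<psi>
      have "(\<Sum>B\<in>?C k. Gamma_op D (H k B) \<phi> \<psi>) =
          fact k * (\<Sum>B\<in>?C k. \<Sum>e\<in>E - \<Union>B. \<Sum>e'\<in>E' - \<Union>B. G (insert {e, e'} B) \<phi> \<psi>)"
        unfolding sum_distrib_left[of "fact k" _ "?C k"] by (intro sum.cong refl) (rule Gam)
      also have "\<dots> = fact (Suc k) * (\<Sum>B\<in>?C (Suc k). G B \<phi> \<psi>)"
        unfolding sum_crossings_insert[OF E(1) E'(1) EE, of "\<lambda>B. G B \<phi> \<psi>"]
        by (simp add: mult_ac)
      finally show "(\<Sum>B\<in>?C k. Gamma_op D (H k B) \<phi> \<psi>) = (\<Sum>B\<in>?C (Suc k). H (Suc k) B \<phi> \<psi>)"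
        by (simp add: HG sum_distrib_left)
    qed
    finally show ?case .
  qed
  show "?Gk k" unfolding main HG by (simp add: G_def)
  show "regular D ((Gamma_op D ^^ k) (bimonomial I c E E'))"
    unfolding main by (rule regular_sum(1)) (rule reg)
qed

text \<open>The exponential divides by \<open>fact k\<close>, so every crossing is counted exactly
  once.\<close>

lemma exp_Gamma_bimonomial:
  assumes D: "continuous_on UNIV D" and c: "c \<in> kern I U" and I: "finite I"
    and E: "finite E" "fst ` E \<subseteq> I" and E': "finite E'" "fst ` E' \<subseteq> I" and dj: "fst ` E \<inter> fst ` E' = {}"
  shows "good D (bimonomial I c E E')"
    and "exp_Gamma D (bimonomial I c E E') = (\<lambda>\<phi> \<psi>. \<Sum>B\<in>crossings E E'.
      bimonomial I (\<lambda>x. c x * (\<Prod>p\<in>B. edge D E E' p x)) (E - \<Union>B) (E' - \<Union>B) \<phi> \<psi>)"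
proof -
  note G = Gamma_power_bimonomial[OF assms]
  define N where "N = Suc (Max (card ` crossings E E'))"
  have fin: "finite (crossings E E')" by (rule finite_crossings[OF E(1) E'(1)])
  have lt: "card B < N" if "B \<in> crossings E E'" for B
    unfolding N_def using that fin by (simp add: le_imp_less_Suc)
  have emp: "{B. B \<in> crossings E E' \<and> card B = k} = {}" if "k \<ge> N" for k
    using lt that by fastforce
  show "good D (bimonomial I c E E')"
    unfolding good_def
  proof (intro conjI allI exI[of _ N] impI)
    show "regular D ((Gamma_op D ^^ k) (bimonomial I c E E'))" for k by (rule G(2))
    show "(Gamma_op D ^^ k) (bimonomial I c E E') = (\<lambda>\<phi> \<psi>. 0)" if "N \<le> k" for k
      unfolding G(1) emp[OF that] by simp
  qed
  let ?G = "\<lambda>B. bimonomial I (\<lambda>x. c x * (\<Prod>p\<in>B. edge D E E' p x)) (E - \<Union>B) (E' - \<Union>B)"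
  show "exp_Gamma D (bimonomial I c E E') = (\<lambda>\<phi> \<psi>. \<Sum>B\<in>crossings E E'. ?G B \<phi> \<psi>)"
  proof (intro ext)
    fix \<phi> \<psi>
    have "exp_Gamma D (bimonomial I c E E') \<phi> \<psi> = (\<Sum>k. \<Sum>B | B \<in> crossings E E' \<and> card B = k. ?G B \<phi> \<psi>)"
      unfolding exp_Gamma_def G(1) by (simp add: sum_divide_distrib)
    also have "\<dots> = (\<Sum>k<N. \<Sum>B | B \<in> crossings E E' \<and> card B = k. ?G B \<phi> \<psi>)"
      by (rule suminf_finite) (simp_all only: finite_lessThan lessThan_iff not_less emp sum.empty)
    also have "\<dots> = (\<Sum>B\<in>crossings E E'. ?G B \<phi> \<psi>)"
      using lt by (intro sum.group[OF fin]) auto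
    finally show "exp_Gamma D (bimonomial I c E E') \<phi> \<psi> = (\<Sum>B\<in>crossings E E'. ?G B \<phi> \<psi>)" .
  qed
qed

text \<open>Common form of \<open>star\<close> and \<open>T_prod\<close>, for
  \<open>D = Delta_plus m lam\<close> and \<open>D = Delta_F m lam\<close>.\<close>

definition prod_of :: "(spacetime \<Rightarrow> complex) \<Rightarrow> functional \<Rightarrow> functional \<Rightarrow> functional" where
  "prod_of D A B = diag (exp_Gamma D (tensor A B))"

section \<open>Products of monomials\<close>

lemma tensor_monomial:
  assumes c: "c \<in> kern I U" "finite I" "fst ` E \<subseteq> I" and d: "d \<in> kern J U" "finite J" "fst ` E' \<subseteq> J"
    and dj: "I \<inter> J = {}"
  shows "tensor (monomial I c E) (monomial J d E') = bimonomial (I \<union> J) (\<lambda>x. c x * d x) E E'"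
proof (intro ext)
  fix \<phi> \<psi>
  have "(LINT x|vol (I \<union> J). (c x * legs \<phi> E x) * (d x * legs \<psi> E' x)) =
      (LINT x|vol I. c x * legs \<phi> E x) * (LINT x|vol J. d x * legs \<psi> E' x)"
    by (rule integral_vol_mult[OF kern_legs[OF c(1,3)] kern_legs[OF d(1,3)] c(2) d(2) dj])
  then show "tensor (monomial I c E) (monomial J d E') \<phi> \<psi> = bimonomial (I \<union> J) (\<lambda>x. c x * d x) E E' \<phi> \<psi>"
    by (simp add: tensor_def monomial_def bimonomial_def mult_ac)
qed

lemma prod_of_monomial:
  assumes D: "continuous_on UNIV D"
    and c: "c \<in> kern I U" "finite I" "finite E" "fst ` E \<subseteq> I"
    and d: "d \<in> kern J U" "finite J" "finite E'" "fst ` E' \<subseteq> J" and dj: "I \<inter> J = {}"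
  shows "good D (tensor (monomial I c E) (monomial J d E'))"
    and "prod_of D (monomial I c E) (monomial J d E') = (\<lambda>\<phi>. \<Sum>B\<in>crossings E E'.
      monomial (I \<union> J) (\<lambda>x. c x * d x * (\<Prod>p\<in>B. edge D E E' p x)) (E \<union> E' - \<Union>B) \<phi>)"
proof -
  have s: "fst ` E \<subseteq> I \<union> J" "fst ` E' \<subseteq> I \<union> J" "fst ` E \<inter> fst ` E' = {}" "finite (I \<union> J)"
    using c d dj by auto
  have EE: "E \<inter> E' = {}" using s(3) by auto
  note t = tensor_monomial[OF c(1,2,4) d(1,2,4) dj]
  note e = exp_Gamma_bimonomial[OF D kern_mult[OF c(1) d(1)] s(4) c(3) s(1) d(3) s(2,3)]
  show "good D (tensor (monomial I c E) (monomial J d E'))" unfolding t by (rule e(1))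
  have "legs \<phi> (E - \<Union>B) x * legs \<phi> (E' - \<Union>B) x = legs \<phi> (E \<union> E' - \<Union>B) x" for \<phi> B x
    using c(3) d(3) EE by (subst legs_Un[symmetric]) (auto simp: Un_Diff)
  then show "prod_of D (monomial I c E) (monomial J d E') = (\<lambda>\<phi>. \<Sum>B\<in>crossings E E'.
      monomial (I \<union> J) (\<lambda>x. c x * d x * (\<Prod>p\<in>B. edge D E E' p x)) (E \<union> E' - \<Union>B) \<phi>)"
    unfolding prod_of_def diag_def t e(2) by (simp add: monomial_def bimonomial_def mult.assoc)
qed

section \<open>Wick sums\<close>

lemma matchingsI: "\<Union>M \<subseteq> E \<Longrightarrow> disjoint M \<Longrightarrow> (\<And>p. p \<in> M \<Longrightarrow> card p = 2) \<Longrightarrow> M \<in> matchings E"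
  by (simp add: matchings_def)

lemma matchingsD:
  assumes "M \<in> matchings E"
  shows "\<Union>M \<subseteq> E" "disjoint M" "\<And>p. p \<in> M \<Longrightarrow> card p = 2"
  using assms by (auto simp: matchings_def)

lemma matching_pair:
  assumes "M \<in> matchings E" "p \<in> M"
  obtains e e' where "p = {e, e'}" "e \<noteq> e'" "e \<in> E" "e' \<in> E"
proof -
  obtain e e' where p: "p = {e, e'}" "e \<noteq> e'"
    using matchingsD(3)[OF assms] unfolding card_2_iff by blast
  moreover have "p \<subseteq> E" using matchingsD(1)[OF assms(1)] assms(2) by auto
  ultimately show ?thesis using that by auto
qed

lemma matching_disjnt: "M \<in> matchings E \<Longrightarrow> p \<in> M \<Longrightarrow> q \<in> M \<Longrightarrow> p \<noteq> q \<Longrightarrow> p \<inter> q = {}"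
  using pairwiseD[OF matchingsD(2)] by (simp add: disjnt_def)

text \<open>A pair lies in \<open>E\<close>, in \<open>E'\<close> or in neither, and these three
  cases recover \<open>M\<close>, \<open>N\<close> and \<open>B\<close> from their union.\<close>

lemma matching_union:
  assumes E: "E \<inter> E' = {}" and M: "M \<in> matchings E" and N: "N \<in> matchings E'"
    and B: "B \<in> crossings (E - \<Union>M) (E' - \<Union>N)"
  shows "M \<union> N \<union> B \<in> matchings (E \<union> E')" and "M \<inter> N = {}" and "(M \<union> N) \<inter> B = {}"
    and "{p \<in> M \<union> N \<union> B. p \<subseteq> E} = M" and "{p \<in> M \<union> N \<union> B. p \<subseteq> E'} = N"
    and "{p \<in> M \<union> N \<union> B. \<not> p \<subseteq> E \<and> \<not> p \<subseteq> E'} = B"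
proof -
  have B': "B \<in> matchings ((E - \<Union>M) \<union> (E' - \<Union>N))" using B by (simp add: crossings_def)
  have ne: "p \<noteq> {}" if "p \<in> M \<union> N \<union> B" for p
    using that matchingsD(3)[OF M, of p] matchingsD(3)[OF N, of p] matchingsD(3)[OF B', of p] by auto
  have pM: "p \<subseteq> E" "\<not> p \<subseteq> E'" if "p \<in> M" for p
  proof -
    show "p \<subseteq> E" using that matchingsD(1)[OF M] by auto
    then show "\<not> p \<subseteq> E'" using ne[of p] that E by auto
  qed
  have pN: "p \<subseteq> E'" "\<not> p \<subseteq> E" if "p \<in> N" for p
  proof -
    show "p \<subseteq> E'" using that matchingsD(1)[OF N] by auto
    then show "\<not> p \<subseteq> E" using ne[of p] that E by auto
  qed
  have pB: "\<not> p \<subseteq> E" "\<not> p \<subseteq> E'" "p \<subseteq> (E - \<Union>M) \<union> (E' - \<Union>N)" if "p \<in> B" for p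
  proof -
    have "p \<inter> (E - \<Union>M) \<noteq> {}" "p \<inter> (E' - \<Union>N) \<noteq> {}" using B that by (auto simp: crossings_def)
    then show "\<not> p \<subseteq> E" "\<not> p \<subseteq> E'" using E by auto
    show "p \<subseteq> (E - \<Union>M) \<union> (E' - \<Union>N)" using that matchingsD(1)[OF B'] by auto
  qed
  show MN: "M \<inter> N = {}"
  proof (rule equals0I)
    show False if "p \<in> M \<inter> N" for p using that pM(1)[of p] pN(2)[of p] by blast
  qed
  show MNB: "(M \<union> N) \<inter> B = {}"
  proof (rule equals0I)
    show False if "p \<in> (M \<union> N) \<inter> B" for p using that pM(1)[of p] pN(1)[of p] pB(1,2)[of p] by blast
  qed
  show "{p \<in> M \<union> N \<union> B. p \<subseteq> E} = M"
  proof (rule Set.set_eqI)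
    show "p \<in> {p \<in> M \<union> N \<union> B. p \<subseteq> E} \<longleftrightarrow> p \<in> M" for p
      using pM(1)[of p] pM(2)[of p] pN(1)[of p] pN(2)[of p] pB(1)[of p] pB(2)[of p] by blast
  qed
  show "{p \<in> M \<union> N \<union> B. p \<subseteq> E'} = N"
  proof (rule Set.set_eqI)
    show "p \<in> {p \<in> M \<union> N \<union> B. p \<subseteq> E'} \<longleftrightarrow> p \<in> N" for p
      using pM(1)[of p] pM(2)[of p] pN(1)[of p] pN(2)[of p] pB(1)[of p] pB(2)[of p] by blast
  qed
  show "{p \<in> M \<union> N \<union> B. \<not> p \<subseteq> E \<and> \<not> p \<subseteq> E'} = B"
  proof (rule Set.set_eqI)
    show "p \<in> {p \<in> M \<union> N \<union> B. \<not> p \<subseteq> E \<and> \<not> p \<subseteq> E'} \<longleftrightarrow> p \<in> B" for p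
      using pM(1)[of p] pM(2)[of p] pN(1)[of p] pN(2)[of p] pB(1)[of p] pB(2)[of p] by blast
  qed
  show "M \<union> N \<union> B \<in> matchings (E \<union> E')"
  proof (rule matchingsI)
    show "\<Union>(M \<union> N \<union> B) \<subseteq> E \<union> E'"
      using matchingsD(1)[OF M] matchingsD(1)[OF N] matchingsD(1)[OF B'] by auto
    show "card p = 2" if "p \<in> M \<union> N \<union> B" for p
      using that matchingsD(3)[OF M, of p] matchingsD(3)[OF N, of p] matchingsD(3)[OF B', of p] by blast
    have 1: "p \<inter> q = {}" if "p \<in> M" "q \<in> N" for p q
      using pM[OF that(1)] pN[OF that(2)] E by blast
    have 2: "p \<inter> q = {}" if "p \<in> M" "q \<in> B" for p q
      using pM[OF that(1)] pB(3)[OF that(2)] that(1) E by blast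
    have 3: "p \<inter> q = {}" if "p \<in> N" "q \<in> B" for p q
      using pN[OF that(1)] pB(3)[OF that(2)] that(1) E by blast
    show "disjoint (M \<union> N \<union> B)"
    proof (rule pairwiseI)
      fix p q assume pq: "p \<in> M \<union> N \<union> B" "q \<in> M \<union> N \<union> B" "p \<noteq> q"
      show "disjnt p q"
        unfolding disjnt_def using pq(1,2)
      proof (elim UnE)
        show "p \<inter> q = {}" if "p \<in> M" "q \<in> M" using matching_disjnt[OF M that pq(3)] .
        show "p \<inter> q = {}" if "p \<in> N" "q \<in> N" using matching_disjnt[OF N that pq(3)] .
        show "p \<inter> q = {}" if "p \<in> B" "q \<in> B" using matching_disjnt[OF B' that pq(3)] .
        show "p \<inter> q = {}" if "p \<in> N" "q \<in> M" using 1[OF that(2,1)] by (simp add: Int_commute)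
        show "p \<inter> q = {}" if "p \<in> B" "q \<in> M" using 2[OF that(2,1)] by (simp add: Int_commute)
        show "p \<inter> q = {}" if "p \<in> B" "q \<in> N" using 3[OF that(2,1)] by (simp add: Int_commute)
      qed (rule 1 2 3; assumption)+
    qed
  qed
qed

lemma matching_split:
  assumes E: "E \<inter> E' = {}" and L: "L \<in> matchings (E \<union> E')"
  defines "M \<equiv> {p \<in> L. p \<subseteq> E}" and "N \<equiv> {p \<in> L. p \<subseteq> E'}" and "B \<equiv> {p \<in> L. \<not> p \<subseteq> E \<and> \<not> p \<subseteq> E'}"
  shows "M \<in> matchings E" "N \<in> matchings E'" "B \<in> crossings (E - \<Union>M) (E' - \<Union>N)" "M \<union> N \<union> B = L"
proof -
  have sub: "disjoint {p \<in> L. P p}" for P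
    using pairwise_subset[OF matchingsD(2)[OF L]] by auto
  show "M \<in> matchings E" "N \<in> matchings E'"
    unfolding M_def N_def using matchingsD(3)[OF L] by (auto intro!: matchingsI sub)
  show "M \<union> N \<union> B = L" by (auto simp: M_def N_def B_def)
  have p: "p \<subseteq> E - \<Union>M \<union> (E' - \<Union>N)" "p \<inter> (E - \<Union>M) \<noteq> {}" "p \<inter> (E' - \<Union>N) \<noteq> {}" if "p \<in> B" for p
  proof -
    have pL: "p \<in> L" "\<not> p \<subseteq> E" "\<not> p \<subseteq> E'" using that by (auto simp: B_def)
    have pE: "p \<subseteq> E \<union> E'" using matchingsD(1)[OF L] pL(1) by auto
    have pM: "p \<inter> \<Union>M = {}" using matching_disjnt[OF L pL(1)] pL by (auto simp: M_def)
    have pN: "p \<inter> \<Union>N = {}" using matching_disjnt[OF L pL(1)] pL by (auto simp: N_def)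
    show "p \<subseteq> E - \<Union>M \<union> (E' - \<Union>N)" using pE pM pN by blast
    show "p \<inter> (E - \<Union>M) \<noteq> {}" "p \<inter> (E' - \<Union>N) \<noteq> {}" using pE pM pN pL(2,3) by blast+
  qed
  have "B \<in> matchings (E - \<Union>M \<union> (E' - \<Union>N))"
  proof (rule matchingsI)
    show "\<Union>B \<subseteq> E - \<Union>M \<union> (E' - \<Union>N)" using p(1) by (rule Union_least)
    show "disjoint B" unfolding B_def by (rule sub)
    show "card p = 2" if "p \<in> B" for p using that matchingsD(3)[OF L] by (simp add: B_def)
  qed
  then show "B \<in> crossings (E - \<Union>M) (E' - \<Union>N)"
    unfolding crossings_def using p(2,3) by blast
qed

text \<open>This is why Wick sums are closed under products: the inner contractions of both factors
  and the crossing added by the product make up one matching of all legs.\<close>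

lemma sum_matchings_union:
  assumes fin: "finite E" "finite E'" and E: "E \<inter> E' = {}"
  shows "(\<Sum>L\<in>matchings (E \<union> E'). f L) =
    (\<Sum>M\<in>matchings E. \<Sum>N\<in>matchings E'. \<Sum>B\<in>crossings (E - \<Union>M) (E' - \<Union>N). f (M \<union> N \<union> B))"
proof -
  let ?S = "SIGMA M:matchings E. SIGMA N:matchings E'. crossings (E - \<Union>M) (E' - \<Union>N)"
  have "(\<Sum>L\<in>matchings (E \<union> E'). f L) = (\<Sum>(M, N, B)\<in>?S. f (M \<union> N \<union> B))"
  proof (rule sum.reindex_bij_witness[where i = "\<lambda>(M, N, B). M \<union> N \<union> B"
        and j = "\<lambda>L. ({p \<in> L. p \<subseteq> E}, {p \<in> L. p \<subseteq> E'}, {p \<in> L. \<not> p \<subseteq> E \<and> \<not> p \<subseteq> E'})"])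
    fix L assume L: "L \<in> matchings (E \<union> E')"
    note s = matching_split[OF E L]
    show "(case ({p \<in> L. p \<subseteq> E}, {p \<in> L. p \<subseteq> E'}, {p \<in> L. \<not> p \<subseteq> E \<and> \<not> p \<subseteq> E'}) of (M, N, B) \<Rightarrow> M \<union> N \<union> B) = L"
      unfolding prod.case by (rule s(4))
    show "({p \<in> L. p \<subseteq> E}, {p \<in> L. p \<subseteq> E'}, {p \<in> L. \<not> p \<subseteq> E \<and> \<not> p \<subseteq> E'}) \<in> ?S"
      by (intro SigmaI s(1-3))
    show "(case ({p \<in> L. p \<subseteq> E}, {p \<in> L. p \<subseteq> E'}, {p \<in> L. \<not> p \<subseteq> E \<and> \<not> p \<subseteq> E'}) of (M, N, B) \<Rightarrow> f (M \<union> N \<union> B)) = f L"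
      unfolding prod.case s(4) ..
  next
    fix b assume "b \<in> ?S"
    then obtain M N B where b: "b = (M, N, B)" and m: "M \<in> matchings E" "N \<in> matchings E'"
      "B \<in> crossings (E - \<Union>M) (E' - \<Union>N)" by auto
    note s = matching_union[OF E m]
    show "(case b of (M, N, B) \<Rightarrow> M \<union> N \<union> B) \<in> matchings (E \<union> E')" unfolding b prod.case by (rule s(1))
    have "(let L = (case b of (M, N, B) \<Rightarrow> M \<union> N \<union> B) in
        ({p \<in> L. p \<subseteq> E}, {p \<in> L. p \<subseteq> E'}, {p \<in> L. \<not> p \<subseteq> E \<and> \<not> p \<subseteq> E'})) = b"
      unfolding b prod.case Let_def s(4-6) ..
    then show "({p \<in> (case b of (M, N, B) \<Rightarrow> M \<union> N \<union> B). p \<subseteq> E}, {p \<in> (case b of (M, N, B) \<Rightarrow> M \<union> N \<union> B). p \<subseteq> E'},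
        {p \<in> (case b of (M, N, B) \<Rightarrow> M \<union> N \<union> B). \<not> p \<subseteq> E \<and> \<not> p \<subseteq> E'}) = b"
      unfolding Let_def .
  qed
  also have "\<dots> = (\<Sum>M\<in>matchings E. \<Sum>(N, B)\<in>(SIGMA N:matchings E'. crossings (E - \<Union>M) (E' - \<Union>N)). f (M \<union> N \<union> B))"
    by (rule sum.Sigma[symmetric]) (use fin in \<open>auto intro!: finite_matchings finite_crossings\<close>)
  also have "\<dots> = (\<Sum>M\<in>matchings E. \<Sum>N\<in>matchings E'. \<Sum>B\<in>crossings (E - \<Union>M) (E' - \<Union>N). f (M \<union> N \<union> B))"
    by (intro sum.cong refl sum.Sigma[symmetric]) (use fin in \<open>auto intro!: finite_matchings finite_crossings\<close>)
  finally show ?thesis .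
qed

text \<open>A pair is an unordered set, so \<open>SOME\<close> chooses an orientation; the value is
  determined as soon as \<open>Q\<close> agrees on both orientations.\<close>

definition pair_value :: "(nat \<Rightarrow> nat \<Rightarrow> complex) \<Rightarrow> (nat \<times> nat) set \<Rightarrow> complex" where
  "pair_value Q p = (SOME z. \<exists>e e'. p = {e, e'} \<and> e \<noteq> e' \<and> z = Q (fst e) (fst e'))"

lemma pair_value_eq:
  assumes "e \<noteq> e'" "Q (fst e) (fst e') = Q (fst e') (fst e)"
  shows "pair_value Q {e, e'} = Q (fst e) (fst e')"
  unfolding pair_value_def
proof (rule some_equality)
  show "\<exists>a a'. {e, e'} = {a, a'} \<and> a \<noteq> a' \<and> Q (fst e) (fst e') = Q (fst a) (fst a')" using assms(1) by blast
  show "z = Q (fst e) (fst e')" if "\<exists>a a'. {e, e'} = {a, a'} \<and> a \<noteq> a' \<and> z = Q (fst a) (fst a')" for z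
    using that assms(2) by (auto simp: doubleton_eq_iff)
qed

section \<open>Propagator assignments and diagrams\<close>

type_synonym propagators = "nat \<Rightarrow> nat \<Rightarrow> spacetime \<Rightarrow> complex"

text \<open>The symmetry admits functions that are not even, such as
  \<open>Delta_plus m lam\<close>, on unordered pairs: exchanging the legs reflects the argument and
  uses the assignment for the exchanged vertices.\<close>

definition propagator :: "propagators \<Rightarrow> bool" where
  "propagator Q \<longleftrightarrow> (\<forall>i j. continuous_on UNIV (Q i j)) \<and> (\<forall>i j z. Q j i (- z) = Q i j z)"

lemma propagator_continuous: "propagator Q \<Longrightarrow> continuous_on UNIV (Q i j)"
  unfolding propagator_def by (elim conjE allE)

lemma propagator_sym: "propagator Q \<Longrightarrow> Q j i (- z) = Q i j z"
  unfolding propagator_def by (elim conjE) (drule spec, drule spec, erule spec)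

definition pairing :: "propagators \<Rightarrow> (nat \<Rightarrow> spacetime) \<Rightarrow> (nat \<times> nat) set \<Rightarrow> complex" where
  "pairing Q x = pair_value (\<lambda>i j. Q i j (x i - x j))"

text \<open>The product of the fields at all legs together with all its partial contractions by
  \<open>Q\<close>, as in Wick's theorem.\<close>

definition wick :: "(nat \<times> nat) set \<Rightarrow> propagators \<Rightarrow> config \<Rightarrow> (nat \<Rightarrow> spacetime) \<Rightarrow> complex" where
  "wick E Q \<phi> x = (\<Sum>M\<in>matchings E. (\<Prod>p\<in>M. pairing Q x p) * legs \<phi> (E - \<Union>M) x)"

definition diagram ::
  "nat set \<Rightarrow> ((nat \<Rightarrow> spacetime) \<Rightarrow> complex) \<Rightarrow> (nat \<times> nat) set \<Rightarrow> propagators \<Rightarrow> functional" where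
  "diagram I c E Q = (\<lambda>\<phi>. LINT x|vol I. c x * wick E Q \<phi> x)"

lemma pairing_eq:
  assumes "propagator Q" "e \<noteq> e'"
  shows "pairing Q x {e, e'} = Q (fst e) (fst e') (x (fst e) - x (fst e'))"
proof -
  have "Q (fst e') (fst e) (- (x (fst e) - x (fst e'))) = Q (fst e) (fst e') (x (fst e) - x (fst e'))"
    by (rule propagator_sym[OF assms(1)])
  then show ?thesis unfolding pairing_def using assms(2) by (subst pair_value_eq) simp_all
qed

lemma kern_pairings:
  assumes c: "c \<in> kern I U" and Q: "propagator Q" and E: "fst ` E \<subseteq> I" and M: "M \<in> matchings E"
  shows "(\<lambda>x. c x * (\<Prod>p\<in>M. pairing Q x p)) \<in> kern I U"
proof (rule kern_times_continuous[OF c])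
  have 1: "continuous_on UNIV (\<lambda>x. pairing Q x p)" if p: "p \<in> M" for p
  proof -
    obtain e e' where "p = {e, e'}" "e \<noteq> e'" "e \<in> E" "e' \<in> E" using matching_pair[OF M p] .
    moreover have "continuous_on UNIV (\<lambda>x. Q (fst e) (fst e') (x (fst e) - x (fst e')))"
      by (rule continuous_on_compose2[of UNIV "Q (fst e) (fst e')"])
         (auto intro!: propagator_continuous[OF Q] continuous_on_diff continuous_on_coordinate)
    ultimately show ?thesis using pairing_eq[OF Q] by simp
  qed
  show "continuous_on UNIV (\<lambda>x. \<Prod>p\<in>M. pairing Q x p)" using 1 by (rule continuous_on_prod)
  fix x y :: "nat \<Rightarrow> spacetime" assume xy: "\<And>i. i \<in> I \<Longrightarrow> x i = y i"
  show "(\<Prod>p\<in>M. pairing Q x p) = (\<Prod>p\<in>M. pairing Q y p)"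
  proof (rule prod.cong[OF refl])
    fix p assume "p \<in> M"
    then obtain e e' where "p = {e, e'}" "e \<noteq> e'" "e \<in> E" "e' \<in> E" using matching_pair[OF M] by metis
    moreover then have "fst e \<in> I" "fst e' \<in> I" using E by auto
    ultimately show "pairing Q x p = pairing Q y p" by (simp add: pairing_eq[OF Q] xy)
  qed
qed

lemma diagram_eq_sum:
  assumes c: "c \<in> kern I U" and Q: "propagator Q" and E: "fst ` E \<subseteq> I" and I: "finite I"
  shows "diagram I c E Q = (\<lambda>\<phi>. \<Sum>M\<in>matchings E. monomial I (\<lambda>x. c x * (\<Prod>p\<in>M. pairing Q x p)) (E - \<Union>M) \<phi>)"
proof (rule ext)
  fix \<phi>
  have "diagram I c E Q \<phi> =
      (LINT x|vol I. (\<Sum>M\<in>matchings E. c x * (\<Prod>p\<in>M. pairing Q x p) * legs \<phi> (E - \<Union>M) x))"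
    unfolding diagram_def wick_def sum_distrib_left by (simp add: mult.assoc)
  also have "\<dots> = (\<Sum>M\<in>matchings E. LINT x|vol I. c x * (\<Prod>p\<in>M. pairing Q x p) * legs \<phi> (E - \<Union>M) x)"
    by (rule Bochner_Integration.integral_sum, rule kern_integrable[OF kern_legs[OF kern_pairings[OF c Q E]] I])
       (use E in auto)
  finally show "diagram I c E Q \<phi> = (\<Sum>M\<in>matchings E. monomial I (\<lambda>x. c x * (\<Prod>p\<in>M. pairing Q x p)) (E - \<Union>M) \<phi>)"
    unfolding monomial_def .
qed

lemma wick_cong:
  assumes Q: "propagator Q" and R: "propagator R"
    and eq: "\<And>i j. i \<in> fst ` E \<Longrightarrow> j \<in> fst ` E \<Longrightarrow> Q i j (x i - x j) = R i j (x i - x j)"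
  shows "wick E Q \<phi> x = wick E R \<phi> x"
  unfolding wick_def
proof (intro sum.cong refl arg_cong2[where f = "(*)"] prod.cong)
  fix M p assume "M \<in> matchings E" "p \<in> M"
  then obtain e e' where "p = {e, e'}" "e \<noteq> e'" "e \<in> E" "e' \<in> E" using matching_pair by metis
  then show "pairing Q x p = pairing R x p"
    using eq[of "fst e" "fst e'"] by (simp add: pairing_eq[OF Q] pairing_eq[OF R])
qed

lemma diagram_cong:
  assumes "propagator Q" "propagator R"
    and "\<And>x. c x = d x" "\<And>x i j. c x \<noteq> 0 \<Longrightarrow> i \<in> fst ` E \<Longrightarrow> j \<in> fst ` E \<Longrightarrow> Q i j (x i - x j) = R i j (x i - x j)"
  shows "diagram I c E Q = diagram I d E R"
proof -
  have "c x * wick E Q \<phi> x = d x * wick E R \<phi> x" for x \<phi>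
  proof (cases "c x = 0")
    case False
    then show ?thesis using wick_cong[OF assms(1,2), of E x \<phi>] assms(3,4) by metis
  qed (use assms(3)[of x] in simp)
  then show ?thesis by (simp add: diagram_def)
qed

lemma wick_zero:
  assumes "finite E"
  shows "wick E (\<lambda>i j z. 0) \<phi> x = legs \<phi> E x"
proof -
  have Q: "propagator (\<lambda>i j z. 0)" by (simp add: propagator_def)
  have em: "{} \<in> matchings E" by (simp add: matchings_def)
  have "(\<Prod>p\<in>M. pairing (\<lambda>i j z. 0) x p) = 0" if M: "M \<in> matchings E" "M \<noteq> {}" for M
  proof -
    obtain p where p: "p \<in> M" using M(2) by auto
    obtain e e' where "p = {e, e'}" "e \<noteq> e'" using matching_pair[OF M(1) p] .
    then have "pairing (\<lambda>i j z. 0) x p = 0" using pairing_eq[OF Q] by simp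
    then show ?thesis using p matching_finite[OF assms M(1)] by (auto intro!: prod_zero)
  qed
  then have "wick E (\<lambda>i j z. 0) \<phi> x = (\<Sum>M\<in>matchings E. if M = {} then legs \<phi> E x else 0)"
    unfolding wick_def by (intro sum.cong refl) auto
  then show ?thesis using em finite_matchings[OF assms] by simp
qed

lemma monomial_diagram: "finite E \<Longrightarrow> monomial I c E = diagram I c E (\<lambda>i j z. 0)"
  by (simp add: monomial_def diagram_def wick_zero)

section \<open>Products of diagrams\<close>

lemma continuous_on_reflect:
  fixes D :: "spacetime \<Rightarrow> complex"
  assumes "continuous_on UNIV D"
  shows "continuous_on UNIV (\<lambda>z. D (- z))"
  by (rule continuous_on_compose2[OF assms]) (intro continuous_on_minus continuous_on_id, rule subset_UNIV)

text \<open>Inner propagators of each factor are kept, and \<open>D\<close> points from the left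
  factor to the right one; the reflected branch is what the symmetry in \<open>propagator\<close>
  dictates.\<close>

definition join :: "nat set \<Rightarrow> nat set \<Rightarrow> (spacetime \<Rightarrow> complex) \<Rightarrow> propagators \<Rightarrow> propagators \<Rightarrow> propagators" where
  "join I J D Q R = (\<lambda>i j. if i \<in> I \<and> j \<in> I then Q i j else if i \<in> J \<and> j \<in> J then R i j
     else if i \<in> I \<and> j \<in> J then D else if i \<in> J \<and> j \<in> I then (\<lambda>z. D (- z)) else (\<lambda>z. 0))"

lemma propagator_join:
  assumes "continuous_on UNIV D" "propagator Q" "propagator R" "I \<inter> J = {}"
  shows "propagator (join I J D Q R)"
proof -
  have D: "continuous_on UNIV (\<lambda>z. D (- z))" by (rule continuous_on_reflect[OF assms(1)])
  have Qi: "Q j i (- z) = Q i j z" and Ri: "R j i (- z) = R i j z" for i j z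
    using propagator_sym assms(2,3) by simp_all
  have *: "continuous_on UNIV (join I J D Q R i j) \<and> (\<forall>z. join I J D Q R j i (- z) = join I J D Q R i j z)" for i j
  proof -
    consider "i \<in> I \<and> j \<in> I" | "i \<in> J \<and> j \<in> J" | "i \<in> I \<and> j \<in> J" | "i \<in> J \<and> j \<in> I"
      | "(i \<notin> I \<and> i \<notin> J) \<or> (j \<notin> I \<and> j \<notin> J)" by argo
    then show ?thesis
    proof cases
      case 1
      then have "join I J D Q R i j = Q i j" "join I J D Q R j i = Q j i" by (auto simp: join_def)
      then show ?thesis using propagator_continuous[OF assms(2)] Qi[of j i] by simp
    next
      case 2
      then have "join I J D Q R i j = R i j" "join I J D Q R j i = R j i" using assms(4) by (auto simp: join_def)
      then show ?thesis using propagator_continuous[OF assms(3)] Ri[of j i] by simp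
    next
      case 3
      then have "join I J D Q R i j = D" "join I J D Q R j i = (\<lambda>z. D (- z))" using assms(4) by (auto simp: join_def)
      then show ?thesis using assms(1) by simp
    next
      case 4
      then have "join I J D Q R j i = D" "join I J D Q R i j = (\<lambda>z. D (- z))" using assms(4) by (auto simp: join_def)
      then show ?thesis using D by simp
    next
      case 5
      then have "join I J D Q R j i = (\<lambda>z. 0)" "join I J D Q R i j = (\<lambda>z. 0)" by (auto simp: join_def)
      then show ?thesis by simp
    qed
  qed
  then show ?thesis unfolding propagator_def by (intro conjI allI) (rule conjunct1[OF *], rule spec[OF conjunct2[OF *]])
qed

lemma good_zero: "good D (\<lambda>\<phi> \<psi>. 0)"
proof -
  have "(Gamma_op D ^^ k) (\<lambda>\<phi> \<psi>. 0) = (\<lambda>\<phi> \<psi>. 0)" for k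
    by (induction k) (simp_all add: Gamma_op_zero)
  then show ?thesis by (simp add: good_def regular_zero)
qed

lemma exp_Gamma_zero: "exp_Gamma D (\<lambda>\<phi> \<psi>. 0) = (\<lambda>\<phi> \<psi>. 0)"
proof -
  have "(Gamma_op D ^^ k) (\<lambda>\<phi> \<psi>. 0) = (\<lambda>\<phi> \<psi>. 0)" for k
    by (induction k) (simp_all add: Gamma_op_zero)
  then show ?thesis by (simp add: exp_Gamma_def)
qed

lemma good_sum:
  assumes "\<And>a. a \<in> S \<Longrightarrow> good D (F a)"
  shows "good D (\<lambda>\<phi> \<psi>. \<Sum>a\<in>S. F a \<phi> \<psi>)"
    and "exp_Gamma D (\<lambda>\<phi> \<psi>. \<Sum>a\<in>S. F a \<phi> \<psi>) = (\<lambda>\<phi> \<psi>. \<Sum>a\<in>S. exp_Gamma D (F a) \<phi> \<psi>)"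
proof -
  have "good D (\<lambda>\<phi> \<psi>. \<Sum>a\<in>S. F a \<phi> \<psi>) \<and>
    exp_Gamma D (\<lambda>\<phi> \<psi>. \<Sum>a\<in>S. F a \<phi> \<psi>) = (\<lambda>\<phi> \<psi>. \<Sum>a\<in>S. exp_Gamma D (F a) \<phi> \<psi>)"
    using assms
    by (induction S rule: infinite_finite_induct) (simp_all add: good_zero exp_Gamma_zero good_add)
  then show "good D (\<lambda>\<phi> \<psi>. \<Sum>a\<in>S. F a \<phi> \<psi>)"
    "exp_Gamma D (\<lambda>\<phi> \<psi>. \<Sum>a\<in>S. F a \<phi> \<psi>) = (\<lambda>\<phi> \<psi>. \<Sum>a\<in>S. exp_Gamma D (F a) \<phi> \<psi>)" by blast+
qed

lemma prod_of_sum: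
  assumes "\<And>a b. a \<in> S \<Longrightarrow> b \<in> T \<Longrightarrow> good D (tensor (A a) (B b))"
  shows "good D (tensor (\<lambda>\<phi>. \<Sum>a\<in>S. A a \<phi>) (\<lambda>\<phi>. \<Sum>b\<in>T. B b \<phi>))"
    and "prod_of D (\<lambda>\<phi>. \<Sum>a\<in>S. A a \<phi>) (\<lambda>\<phi>. \<Sum>b\<in>T. B b \<phi>) = (\<lambda>\<phi>. \<Sum>a\<in>S. \<Sum>b\<in>T. prod_of D (A a) (B b) \<phi>)"
proof -
  have t: "tensor (\<lambda>\<phi>. \<Sum>a\<in>S. A a \<phi>) (\<lambda>\<phi>. \<Sum>b\<in>T. B b \<phi>) = (\<lambda>\<phi> \<psi>. \<Sum>a\<in>S. \<Sum>b\<in>T. tensor (A a) (B b) \<phi> \<psi>)"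
    by (simp add: tensor_def sum_product)
  have g: "good D (\<lambda>\<phi> \<psi>. \<Sum>b\<in>T. tensor (A a) (B b) \<phi> \<psi>)" if "a \<in> S" for a
    by (rule good_sum(1)) (rule assms[OF that])
  show "good D (tensor (\<lambda>\<phi>. \<Sum>a\<in>S. A a \<phi>) (\<lambda>\<phi>. \<Sum>b\<in>T. B b \<phi>))"
    unfolding t by (rule good_sum(1)) (rule g)
  have "exp_Gamma D (\<lambda>\<phi> \<psi>. \<Sum>a\<in>S. \<Sum>b\<in>T. tensor (A a) (B b) \<phi> \<psi>) =
      (\<lambda>\<phi> \<psi>. \<Sum>a\<in>S. exp_Gamma D (\<lambda>\<phi> \<psi>. \<Sum>b\<in>T. tensor (A a) (B b) \<phi> \<psi>) \<phi> \<psi>)"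
    by (rule good_sum(2)) (rule g)
  also have "\<dots> = (\<lambda>\<phi> \<psi>. \<Sum>a\<in>S. \<Sum>b\<in>T. exp_Gamma D (tensor (A a) (B b)) \<phi> \<psi>)"
    by (intro ext sum.cong refl) (subst good_sum(2)[OF assms], simp_all)
  finally show "prod_of D (\<lambda>\<phi>. \<Sum>a\<in>S. A a \<phi>) (\<lambda>\<phi>. \<Sum>b\<in>T. B b \<phi>) = (\<lambda>\<phi>. \<Sum>a\<in>S. \<Sum>b\<in>T. prod_of D (A a) (B b) \<phi>)"
    unfolding prod_of_def t diag_def by simp
qed

text \<open>Expand both factors into monomials over their matchings, let the product of monomials
  add crossings of the uncontracted legs, and reassemble the triple sum by
  \<open>sum_matchings_union\<close>. A pair gets its value from \<open>Q\<close>, \<open>R\<close>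
  or \<open>D\<close> according to where its legs lie.\<close>

lemma prod_of_diagram:
  assumes D: "continuous_on UNIV D" and Q: "propagator Q" and R: "propagator R"
    and c: "c \<in> kern I U" "finite I" "finite E" "fst ` E \<subseteq> I"
    and d: "d \<in> kern J U" "finite J" "finite E'" "fst ` E' \<subseteq> J" and dj: "I \<inter> J = {}"
  shows "prod_of D (diagram I c E Q) (diagram J d E' R) =
    diagram (I \<union> J) (\<lambda>x. c x * d x) (E \<union> E') (join I J D Q R)"
proof -
  let ?j = "join I J D Q R"
  have j: "propagator ?j" by (rule propagator_join[OF D Q R dj])
  have EE: "E \<inter> E' = {}" using c(4) d(4) dj by auto
  let ?A = "\<lambda>M. monomial I (\<lambda>x. c x * (\<Prod>p\<in>M. pairing Q x p)) (E - \<Union>M)"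
  let ?B = "\<lambda>N. monomial J (\<lambda>x. d x * (\<Prod>p\<in>N. pairing R x p)) (E' - \<Union>N)"
  let ?P = "\<lambda>L. monomial (I \<union> J) (\<lambda>x. c x * d x * (\<Prod>p\<in>L. pairing ?j x p)) (E \<union> E' - \<Union>L)"
  have sub: "finite (E - \<Union>M)" "fst ` (E - \<Union>M) \<subseteq> I" "finite (E' - \<Union>M)" "fst ` (E' - \<Union>M) \<subseteq> J" for M
    using c d by auto
  have kA: "(\<lambda>x. c x * (\<Prod>p\<in>M. pairing Q x p)) \<in> kern I U" if "M \<in> matchings E" for M
    by (rule kern_pairings[OF c(1) Q c(4) that])
  have kB: "(\<lambda>x. d x * (\<Prod>p\<in>M. pairing R x p)) \<in> kern J U" if "M \<in> matchings E'" for M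
    by (rule kern_pairings[OF d(1) R d(4) that])
  have pr: "prod_of D (?A M) (?B N) = (\<lambda>\<phi>. \<Sum>B\<in>crossings (E - \<Union>M) (E' - \<Union>N). ?P (M \<union> N \<union> B) \<phi>)"
    if M: "M \<in> matchings E" and N: "N \<in> matchings E'" for M N
    unfolding prod_of_monomial(2)[OF D kA[OF M] c(2) sub(1,2) kB[OF N] d(2) sub(3,4) dj]
  proof (intro ext sum.cong refl)
    fix \<phi> B assume B: "B \<in> crossings (E - \<Union>M) (E' - \<Union>N)"
    note u = matching_union[OF EE M N B]
    have fin: "finite M" "finite N" "finite B"
      using matching_finite[OF c(3) M] matching_finite[OF d(3) N] crossing_finite[OF sub(1,3) B] by auto
    have s: "(E - \<Union>M) \<union> (E' - \<Union>N) - \<Union>B = E \<union> E' - \<Union>(M \<union> N \<union> B)"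
      using matchingsD(1)[OF M] matchingsD(1)[OF N] EE by auto
    have m: "pairing ?j x p = pairing Q x p" if p: "p \<in> M" for x p
    proof -
      obtain e e' where e: "p = {e, e'}" "e \<noteq> e'" "e \<in> E" "e' \<in> E" using matching_pair[OF M p] .
      then have "fst e \<in> I" "fst e' \<in> I" using c(4) by auto
      then show ?thesis unfolding e(1) pairing_eq[OF j e(2)] pairing_eq[OF Q e(2)] by (simp add: join_def)
    qed
    have n: "pairing ?j x p = pairing R x p" if p: "p \<in> N" for x p
    proof -
      obtain e e' where e: "p = {e, e'}" "e \<noteq> e'" "e \<in> E'" "e' \<in> E'" using matching_pair[OF N p] .
      then have "fst e \<in> J" "fst e' \<in> J" "fst e \<notin> I" using d(4) dj by auto
      then show ?thesis unfolding e(1) pairing_eq[OF j e(2)] pairing_eq[OF R e(2)] by (simp add: join_def)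
    qed
    have b: "pairing ?j x p = edge D (E - \<Union>M) (E' - \<Union>N) p x" if p: "p \<in> B" for x p
    proof -
      have "(E - \<Union>M) \<inter> (E' - \<Union>N) = {}" using EE by auto
      then obtain e e' where e: "p = {e, e'}" "e \<in> E - \<Union>M" "e' \<in> E' - \<Union>N" "e \<noteq> e'"
        "p \<inter> (E - \<Union>M) = {e}" "p \<inter> (E' - \<Union>N) = {e'}"
        by (rule crossing_pair[OF B p])
      have "fst e \<in> I" "fst e' \<in> J" using e(2,3) c(4) d(4) by auto
      moreover then have "fst e' \<notin> I" "fst e \<notin> J" using dj by auto
      ultimately have "pairing ?j x p = D (x (fst e) - x (fst e'))"
        unfolding e(1) pairing_eq[OF j e(4)] by (simp add: join_def)
      then show ?thesis by (simp add: edge_def e(5,6))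
    qed
    have "(\<Prod>p\<in>M \<union> N \<union> B. pairing ?j x p) =
        (\<Prod>p\<in>M. pairing Q x p) * (\<Prod>p\<in>N. pairing R x p) * (\<Prod>p\<in>B. edge D (E - \<Union>M) (E' - \<Union>N) p x)" for x
      using fin u(2,3) m n b by (simp add: prod.union_disjoint)
    then have "(\<lambda>x. c x * (\<Prod>p\<in>M. pairing Q x p) * (d x * (\<Prod>p\<in>N. pairing R x p)) * (\<Prod>p\<in>B. edge D (E - \<Union>M) (E' - \<Union>N) p x))
      = (\<lambda>x. c x * d x * (\<Prod>p\<in>M \<union> N \<union> B. pairing ?j x p))"
      by (simp add: mult_ac)
    then show "monomial (I \<union> J) (\<lambda>x. c x * (\<Prod>p\<in>M. pairing Q x p) * (d x * (\<Prod>p\<in>N. pairing R x p)) *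
        (\<Prod>p\<in>B. edge D (E - \<Union>M) (E' - \<Union>N) p x)) (E - \<Union>M \<union> (E' - \<Union>N) - \<Union>B) \<phi> = ?P (M \<union> N \<union> B) \<phi>"
      unfolding s by simp
  qed
  have "prod_of D (diagram I c E Q) (diagram J d E' R) =
      (\<lambda>\<phi>. \<Sum>M\<in>matchings E. \<Sum>N\<in>matchings E'. prod_of D (?A M) (?B N) \<phi>)"
    unfolding diagram_eq_sum[OF c(1) Q c(4,2)] diagram_eq_sum[OF d(1) R d(4,2)]
    by (rule prod_of_sum(2)) (rule prod_of_monomial(1)[OF D kA c(2) sub(1,2) kB d(2) sub(3,4) dj])
  also have "\<dots> = (\<lambda>\<phi>. \<Sum>M\<in>matchings E. \<Sum>N\<in>matchings E'. \<Sum>B\<in>crossings (E - \<Union>M) (E' - \<Union>N). ?P (M \<union> N \<union> B) \<phi>)"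
    by (intro ext sum.cong refl) (simp only: pr)
  also have "\<dots> = (\<lambda>\<phi>. \<Sum>L\<in>matchings (E \<union> E'). ?P L \<phi>)"
    by (rule ext) (rule sum_matchings_union[OF c(3) d(3) EE, symmetric])
  also have "\<dots> = diagram (I \<union> J) (\<lambda>x. c x * d x) (E \<union> E') ?j"
    by (rule diagram_eq_sum[OF kern_mult[OF c(1) d(1)] j, symmetric]) (use c d in auto)
  finally show ?thesis .
qed

section \<open>The algebra of polynomial functionals\<close>

text \<open>Unlike \<open>local_alg\<close>, this provides induction on functionals, arbitrary
  finite vertex sets and, through the empty vertex set, constants.\<close>

inductive_set polyf :: "spacetime set \<Rightarrow> functional set" for U where
  monomial: "finite I \<Longrightarrow> c \<in> kern I U \<Longrightarrow> finite E \<Longrightarrow> fst ` E \<subseteq> I \<Longrightarrow> monomial I c E \<in> polyf U"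
| add: "A \<in> polyf U \<Longrightarrow> B \<in> polyf U \<Longrightarrow> A + B \<in> polyf U"

section \<open>Linear structure and relabelling of polynomial functionals\<close>

lemma polyf_mono: "U \<subseteq> U' \<Longrightarrow> A \<in> polyf U \<Longrightarrow> A \<in> polyf U'"
  by (rotate_tac 1, induction A rule: polyf.induct) (auto intro: polyf.intros kern_mono)

lemma polyf_zero: "0 \<in> polyf U"
proof -
  have "monomial {} (\<lambda>x. 0) {} = 0" by (simp add: monomial_def fun_eq_iff)
  then show ?thesis using polyf.monomial[OF finite.emptyI kern_zero finite.emptyI, of U] by simp
qed

lemma polyf_sum: "(\<And>a. a \<in> S \<Longrightarrow> A a \<in> polyf U) \<Longrightarrow> (\<Sum>a\<in>S. A a) \<in> polyf U"
  by (induction S rule: infinite_finite_induct) (auto intro: polyf_zero polyf.add)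

lemma sum_fun_apply: "(\<Sum>a\<in>S. A a) x = (\<Sum>a\<in>S. (A a x :: complex))"
  by (induction S rule: infinite_finite_induct) auto

lemma polyf_scale: "A \<in> polyf U \<Longrightarrow> (\<lambda>\<phi>. z * A \<phi>) \<in> polyf U"
proof (induction A rule: polyf.induct)
  case (monomial I c E)
  have "(\<lambda>\<phi>. z * monomial I c E \<phi>) = monomial I (\<lambda>x. z * c x) E" by (simp add: monomial_scale fun_eq_iff)
  then show ?case using polyf.monomial[OF monomial(1) kern_scale[OF monomial(2)] monomial(3,4)] by simp
next
  case (add A B)
  have "(\<lambda>\<phi>. z * (A + B) \<phi>) = (\<lambda>\<phi>. z * A \<phi>) + (\<lambda>\<phi>. z * B \<phi>)" by (simp add: fun_eq_iff distrib_left)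
  then show ?case using polyf.add[OF add.IH] by simp
qed

lemma monomial_relabel:
  assumes I: "finite I" and c: "c \<in> kern I U" and E: "finite E" "fst ` E \<subseteq> I" and r: "inj_on r I"
  shows "monomial I c E = monomial (r ` I) (\<lambda>x. c (\<lambda>i. x (r i))) (map_prod r id ` E)"
    and "(\<lambda>x. c (\<lambda>i. x (r i))) \<in> kern (r ` I) U" and "finite (map_prod r id ` E)"
    and "fst ` map_prod r id ` E \<subseteq> r ` I"
proof -
  have cr: "continuous_on UNIV (\<lambda>x::nat\<Rightarrow>spacetime. \<lambda>i. x (r i))"
    by (intro continuous_on_coordinatewise_then_product continuous_on_coordinate)
  obtain K where K: "compact K" "K \<subseteq> U" "\<And>x i. c x \<noteq> 0 \<Longrightarrow> i \<in> I \<Longrightarrow> x i \<in> K"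
    using kern_supp[OF c] by metis
  show "(\<lambda>x. c (\<lambda>i. x (r i))) \<in> kern (r ` I) U"
    unfolding kern_def mem_Collect_eq
  proof (intro conjI allI impI exI[of _ K] K(1,2) ballI)
    show "continuous_on UNIV (\<lambda>x. c (\<lambda>i. x (r i)))"
      by (rule continuous_on_compose2[OF kern_continuous[OF c] cr]) auto
    show "c (\<lambda>i. x (r i)) = c (\<lambda>i. y (r i))" if "\<forall>i\<in>r ` I. x i = y i" for x y
      by (rule kern_local[OF c]) (use that in auto)
    show "x j \<in> K" if "c (\<lambda>i. x (r i)) \<noteq> 0" "j \<in> r ` I" for x j
      using K(3)[OF that(1)] that(2) by auto
  qed
  show "finite (map_prod r id ` E)" using E(1) by simp
  show "fst ` map_prod r id ` E \<subseteq> r ` I" using E(2) by auto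
  show "monomial I c E = monomial (r ` I) (\<lambda>x. c (\<lambda>i. x (r i))) (map_prod r id ` E)"
  proof (rule ext)
    fix \<phi>
    have inj: "inj_on (map_prod r id) E"
    proof (rule inj_onI)
      fix a b assume ab: "a \<in> E" "b \<in> E" "map_prod r id a = map_prod r id b"
      then have "fst a \<in> I" "fst b \<in> I" "r (fst a) = r (fst b)" "snd a = snd b" using E(2) by (auto simp: map_prod_def split_beta)
      then show "a = b" using r by (auto simp: inj_on_def prod_eq_iff)
    qed
    note k = kern_legs[OF c E(2), of \<phi>]
    have "(LINT x|vol I. c x * legs \<phi> E x) = (LINT x|vol (r ` I). c (\<lambda>i. x (r i)) * legs \<phi> E (\<lambda>i. x (r i)))"
      by (rule integral_vol_relabel[OF kern_continuous[OF k] kern_local[OF k]])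
         (use I r in \<open>auto simp: bij_betw_def\<close>)
    moreover have "legs \<phi> E (\<lambda>i. x (r i)) = legs \<phi> (map_prod r id ` E) x" for x
      unfolding legs_def by (subst prod.reindex[OF inj]) simp
    ultimately show "monomial I c E \<phi> = monomial (r ` I) (\<lambda>x. c (\<lambda>i. x (r i))) (map_prod r id ` E) \<phi>"
      by (simp add: monomial_def)
  qed
qed

text \<open>Vertices are mere names: shifting them by a bound \<open>s\<close> of \<open>F\<close>
  avoids any given finite set. Thus a second factor may be assumed disjoint from the first, as the
  product formulas require.\<close>

lemma polyf_induct_fresh [consumes 2, case_names monomial add]:
  assumes "finite F" "A \<in> polyf U"
    and "\<And>I c E. finite I \<Longrightarrow> c \<in> kern I U \<Longrightarrow> finite E \<Longrightarrow> fst ` E \<subseteq> I \<Longrightarrow> F \<inter> I = {} \<Longrightarrow> P (monomial I c E)"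
    and "\<And>A B. A \<in> polyf U \<Longrightarrow> B \<in> polyf U \<Longrightarrow> P A \<Longrightarrow> P B \<Longrightarrow> P (A + B)"
  shows "P A"
  using assms(2)
proof (induction A rule: polyf.induct)
  case (monomial I c E)
  obtain s where s: "\<forall>i\<in>F. i < s" using assms(1) finite_nat_set_iff_bounded by auto
  have "inj_on (\<lambda>i. i + s) I" by (simp add: inj_on_def)
  note m = monomial_relabel[OF monomial this]
  have "F \<inter> (\<lambda>i. i + s) ` I = {}" using s by fastforce
  with m monomial(1) show ?case by (subst m(1)) (rule assms(3), auto)
next
  case (add A B)
  then show ?case by (rule assms(4))
qed

section \<open>Bilinearity of the product\<close>

lemma tensor_add: "tensor (A + B) C = (\<lambda>\<phi> \<psi>. tensor A C \<phi> \<psi> + tensor B C \<phi> \<psi>)"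
  "tensor C (A + B) = (\<lambda>\<phi> \<psi>. tensor C A \<phi> \<psi> + tensor C B \<phi> \<psi>)"
  by (simp_all add: tensor_def distrib_left distrib_right)

context
  fixes D :: "spacetime \<Rightarrow> complex"
  assumes D: "continuous_on UNIV D"
begin

lemma good_tensor:
  assumes "A \<in> polyf U" "B \<in> polyf U"
  shows "good D (tensor A B)"
  using assms(1)
proof (induction A rule: polyf.induct)
  case (monomial I c E)
  note m = monomial
  show ?case
    using m(1) assms(2)
  proof (induction B rule: polyf_induct_fresh)
    case (monomial J d E')
    show ?case by (rule prod_of_monomial(1)[OF D m(2,1,3,4) monomial(2,1,3-5)])
  next
    case (add A B)
    then show ?case unfolding tensor_add by (intro good_add(1))
  qed
next
  case (add A A')
  then show ?case unfolding tensor_add by (intro good_add(1))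
qed

lemma prod_of_add_left:
  assumes "A \<in> polyf U" "A' \<in> polyf U" "B \<in> polyf U"
  shows "prod_of D (A + A') B = prod_of D A B + prod_of D A' B"
  unfolding prod_of_def tensor_add
    good_add(2)[OF good_tensor[OF assms(1,3)] good_tensor[OF assms(2,3)]] diag_def
  by (simp add: fun_eq_iff)

lemma prod_of_add_right:
  assumes "A \<in> polyf U" "A' \<in> polyf U" "B \<in> polyf U"
  shows "prod_of D B (A + A') = prod_of D B A + prod_of D B A'"
  unfolding prod_of_def tensor_add
    good_add(2)[OF good_tensor[OF assms(3,1)] good_tensor[OF assms(3,2)]] diag_def
  by (simp add: fun_eq_iff)

lemma prod_of_closed:
  assumes "A \<in> polyf U" "B \<in> polyf U"
  shows "prod_of D A B \<in> polyf U"
  using assms(1)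
proof (induction A rule: polyf.induct)
  case (monomial I c E)
  note m = monomial
  show ?case
    using monomial(1) assms(2)
  proof (induction B rule: polyf_induct_fresh)
    case (monomial J d E')
    have s: "fst ` E \<subseteq> I \<union> J" "fst ` E' \<subseteq> I \<union> J" using m monomial by auto
    have EE: "E \<inter> E' = {}" using m(4) monomial(4,5) by auto
    have "prod_of D (monomial I c E) (monomial J d E') = (\<Sum>B\<in>crossings E E'.
        monomial (I \<union> J) (\<lambda>x. c x * d x * (\<Prod>p\<in>B. edge D E E' p x)) (E \<union> E' - \<Union>B))"
      unfolding prod_of_monomial(2)[OF D m(2,1,3,4) monomial(2,1,3-5)] by (rule ext) (simp only: sum_fun_apply)
    also have "\<dots> \<in> polyf U"
    proof (intro polyf_sum polyf.monomial)
      show "finite (I \<union> J)" using m(1) monomial(1) by simp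
      show "(\<lambda>x. c x * d x * (\<Prod>p\<in>B. edge D E E' p x)) \<in> kern (I \<union> J) U" if "B \<in> crossings E E'" for B
        by (rule kern_edges[OF D kern_mult[OF m(2) monomial(2)] s EE that])
      show "finite (E \<union> E' - \<Union>B)" for B using m(3) monomial(3) by simp
      show "fst ` (E \<union> E' - \<Union>B) \<subseteq> I \<union> J" for B using s by auto
    qed
    finally show ?case .
  next
    case (add B B')
    show ?case unfolding prod_of_add_right[OF add(1,2) polyf.monomial[OF m]] by (rule polyf.add[OF add.IH])
  qed
next
  case (add A A')
  show ?case unfolding prod_of_add_left[OF add(1,2) assms(2)] by (rule polyf.add[OF add.IH])
qed

lemma prod_of_scale_left:
  assumes "A \<in> polyf U" "B \<in> polyf U"
  shows "prod_of D (\<lambda>\<phi>. z * A \<phi>) B = (\<lambda>\<phi>. z * prod_of D A B \<phi>)"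
  using assms(1)
proof (induction A rule: polyf.induct)
  case (monomial I c E)
  note m = monomial
  have e: "(\<lambda>\<phi>. z * monomial I c E \<phi>) = monomial I (\<lambda>x. z * c x) E" by (simp add: monomial_scale fun_eq_iff)
  note m' = m(1) kern_scale[OF m(2)] m(3,4)
  show ?case
    using m(1) assms(2)
  proof (induction B rule: polyf_induct_fresh)
    case (monomial J d E')
    show ?case
      unfolding e prod_of_monomial(2)[OF D m(2,1,3,4) monomial(2,1,3-5)]
        prod_of_monomial(2)[OF D m'(2,1,3,4) monomial(2,1,3-5)]
      by (simp add: sum_distrib_left mult.assoc monomial_scale)
  next
    case (add B B')
    show ?case
      unfolding prod_of_add_right[OF add(1,2) polyf.monomial[OF m]]
        prod_of_add_right[OF add(1,2) polyf_scale[OF polyf.monomial[OF m]]] add.IH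
      by (simp add: fun_eq_iff distrib_left)
  qed
next
  case (add A A')
  have e: "(\<lambda>\<phi>. z * (A + A') \<phi>) = (\<lambda>\<phi>. z * A \<phi>) + (\<lambda>\<phi>. z * A' \<phi>)" by (simp add: fun_eq_iff distrib_left)
  show ?case
    unfolding e prod_of_add_left[OF add(1,2) assms(2)]
      prod_of_add_left[OF polyf_scale[OF add(1)] polyf_scale[OF add(2)] assms(2)] add.IH
    by (simp add: fun_eq_iff distrib_left)
qed

end

section \<open>Commutativity, associativity and unit\<close>

lemma propagator_zero: "propagator (\<lambda>i j z. 0)"
  by (simp add: propagator_def)

lemma join_commute: "I \<inter> J = {} \<Longrightarrow> join I J D Q R = join J I (\<lambda>z. D (- z)) R Q"
  unfolding join_def by (intro ext) auto

lemma join_assoc: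
  assumes "I \<inter> J = {}" "I \<inter> K = {}" "J \<inter> K = {}"
  shows "join (I \<union> J) K D (join I J D Q R) S = join I (J \<union> K) D Q (join J K D R S)"
  unfolding join_def using assms by (intro ext) auto

text \<open>Exchanging the factors reverses each crossing pair and so reflects \<open>D\<close>, by
  \<open>join_commute\<close>. For even \<open>D\<close> the product is therefore
  commutative.\<close>

lemma prod_of_commute:
  assumes D: "continuous_on UNIV D" and AB: "A \<in> polyf U" "B \<in> polyf U"
  shows "prod_of D A B = prod_of (\<lambda>z. D (- z)) B A"
  using AB(1)
proof (induction A rule: polyf.induct)
  have D': "continuous_on UNIV (\<lambda>z. D (- z))" by (rule continuous_on_reflect[OF D])
  {
    case (monomial I c E)
    note m = monomial
    show ?case
      using m(1) AB(2)
    proof (induction B rule: polyf_induct_fresh)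
      case (monomial J d E')
      have JI: "J \<inter> I = {}" using monomial(5) by auto
      show ?case
        unfolding monomial_diagram[OF m(3)] monomial_diagram[OF monomial(3)]
          prod_of_diagram[OF D propagator_zero propagator_zero m(2,1,3,4) monomial(2,1,3-5)]
          prod_of_diagram[OF D' propagator_zero propagator_zero monomial(2,1,3,4) m(2,1,3,4) JI]
          join_commute[OF monomial(5), of D]
        by (simp only: Un_commute mult.commute)
    next
      case (add B B')
      show ?case
        unfolding prod_of_add_right[OF D add(1,2) polyf.monomial[OF m]]
          prod_of_add_left[OF D' add(1,2) polyf.monomial[OF m]] add.IH ..
    qed
  next
    case (add A A')
    show ?case
      unfolding prod_of_add_right[OF D' add(1,2) AB(2)] prod_of_add_left[OF D add(1,2) AB(2)] add.IH ..
  }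
qed

text \<open>Both bracketings yield the diagram with \<open>D\<close> from \<open>I\<close> to
  \<open>J\<close>, from \<open>I\<close> to \<open>K\<close> and from \<open>J\<close> to
  \<open>K\<close>, by \<open>join_assoc\<close>. The inductions on \<open>B\<close> and
  \<open>C\<close> choose fresh vertices.\<close>

lemma prod_of_assoc:
  assumes D: "continuous_on UNIV D" and ABC: "A \<in> polyf U" "B \<in> polyf U" "C \<in> polyf U"
  shows "prod_of D (prod_of D A B) C = prod_of D A (prod_of D B C)"
  using ABC(1)
proof (induction A rule: polyf.induct)
  case (monomial I c E)
  note m = monomial
  note pm = polyf.monomial[OF m]
  show ?case
    using m(1) ABC(2)
  proof (induction B rule: polyf_induct_fresh)
    case (monomial J d E')
    note m' = monomial
    note pm' = polyf.monomial[OF m'(1-4)]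
    have "finite (I \<union> J)" using m(1) m'(1) by simp
    then show ?case
      using ABC(3)
    proof (induction C rule: polyf_induct_fresh)
      case (monomial K e E'')
      note m'' = monomial
      have dj: "I \<inter> K = {}" "J \<inter> K = {}" "I \<inter> (J \<union> K) = {}" using m'(5) m''(5) by auto
      have s: "finite (E \<union> E')" "fst ` (E \<union> E') \<subseteq> I \<union> J" "finite (I \<union> J)"
        "finite (E' \<union> E'')" "fst ` (E' \<union> E'') \<subseteq> J \<union> K" "finite (J \<union> K)" using m m' m'' by auto
      note Z = propagator_zero
      show ?case
        unfolding monomial_diagram[OF m(3)] monomial_diagram[OF m'(3)] monomial_diagram[OF m''(3)]
          prod_of_diagram[OF D Z Z m(2,1,3,4) m'(2,1,3-5)]
          prod_of_diagram[OF D Z Z m'(2,1,3,4) m''(2,1,3,4) dj(2)]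
          prod_of_diagram[OF D propagator_join[OF D Z Z m'(5)] Z kern_mult[OF m(2) m'(2)] s(3,1,2) m''(2,1,3-5)]
          prod_of_diagram[OF D Z propagator_join[OF D Z Z dj(2)] m(2,1,3,4) kern_mult[OF m'(2) m''(2)] s(6,4,5) dj(3)]
          join_assoc[OF m'(5) dj(1,2)]
        by (simp only: Un_assoc mult.assoc)
    next
      case (add C C')
      note p = prod_of_closed[OF D pm pm'] prod_of_closed[OF D pm' add(1)] prod_of_closed[OF D pm' add(2)]
      show ?case
        unfolding prod_of_add_right[OF D add(1,2) p(1)] prod_of_add_right[OF D add(1,2) pm']
          prod_of_add_right[OF D p(2,3) pm] add.IH ..
    qed
  next
    case (add B B')
    note p = prod_of_closed[OF D pm add(1)] prod_of_closed[OF D pm add(2)]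
      prod_of_closed[OF D add(1) ABC(3)] prod_of_closed[OF D add(2) ABC(3)]
    show ?case
      unfolding prod_of_add_right[OF D add(1,2) pm] prod_of_add_left[OF D p(1,2) ABC(3)]
        prod_of_add_left[OF D add(1,2) ABC(3)] prod_of_add_right[OF D p(3,4) pm] add.IH ..
  qed
next
  case (add A A')
  note p = prod_of_closed[OF D add(1) ABC(2)] prod_of_closed[OF D add(2) ABC(2)] prod_of_closed[OF D ABC(2,3)]
  show ?case
    unfolding prod_of_add_left[OF D add(1,2) ABC(2)] prod_of_add_left[OF D p(1,2) ABC(3)]
      prod_of_add_left[OF D add(1,2) p(3)] add.IH ..
qed

lemma vol_empty: "(LINT x|vol {}. (f x :: complex)) = f (\<lambda>_. undefined)"
  by (simp add: PiM_empty lebesgue_integral_count_space_finite)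

lemma one_eq_monomial: "(1 :: functional) = monomial {} (\<lambda>x. 1) {}"
  by (simp add: monomial_def legs_def fun_eq_iff PiM_empty)

lemma kern_one: "(\<lambda>x. 1) \<in> kern {} U"
  unfolding kern_def by auto

lemma polyf_one: "1 \<in> polyf U"
  unfolding one_eq_monomial by (rule polyf.monomial) (auto simp: kern_one)

lemma prod_of_one_left:
  assumes D: "continuous_on UNIV D" and A: "A \<in> polyf U"
  shows "prod_of D 1 A = A"
  using A
proof (induction A rule: polyf.induct)
  case (monomial I c E)
  have 0: "finite {}" "fst ` {} \<subseteq> ({} :: nat set)" "{} \<inter> I = {}" by auto
  have Z: "join {} I D (\<lambda>i j z. 0) (\<lambda>i j z. 0) = (\<lambda>i j z. 0)" by (intro ext) (simp add: join_def)
  show ?case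
    unfolding one_eq_monomial monomial_diagram[OF finite.emptyI] monomial_diagram[OF monomial(3)]
      prod_of_diagram[OF D propagator_zero propagator_zero kern_one finite.emptyI finite.emptyI 0(2) monomial(2,1,3,4) 0(3)] Z
    by simp
next
  case (add A A')
  show ?case unfolding prod_of_add_right[OF D add(1,2) polyf_one] add.IH ..
qed

lemma prod_of_one_right:
  assumes D: "continuous_on UNIV D" and A: "A \<in> polyf U"
  shows "prod_of D A 1 = A"
proof -
  have D': "continuous_on UNIV (\<lambda>z. D (- z))" by (rule continuous_on_reflect[OF D])
  show ?thesis unfolding prod_of_commute[OF D A polyf_one] by (rule prod_of_one_left[OF D' A])
qed

lemma prod_of_scale_right:
  assumes D: "continuous_on UNIV D" and AB: "A \<in> polyf U" "B \<in> polyf U"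
  shows "prod_of D A (\<lambda>\<phi>. z * B \<phi>) = (\<lambda>\<phi>. z * prod_of D A B \<phi>)"
proof -
  have D': "continuous_on UNIV (\<lambda>z. D (- z))" by (rule continuous_on_reflect[OF D])
  show ?thesis
    unfolding prod_of_commute[OF D AB] prod_of_commute[OF D AB(1) polyf_scale[OF AB(2)]]
    by (rule prod_of_scale_left[OF D' AB(2,1)])
qed

lemma prod_of_sum_left:
  assumes D: "continuous_on UNIV D" and B: "B \<in> polyf U" and A: "\<And>a. a \<in> S \<Longrightarrow> A a \<in> polyf U"
  shows "prod_of D (\<Sum>a\<in>S. A a) B = (\<Sum>a\<in>S. prod_of D (A a) B)"
proof -
  have z: "prod_of D 0 B = 0"
    using prod_of_scale_left[OF D polyf_zero B, of 0] by (simp add: zero_fun_def)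
  show ?thesis
    using A by (induction S rule: infinite_finite_induct)
      (simp_all add: z prod_of_add_left[OF D _ _ B] polyf_sum)
qed

lemma prod_of_sum_right:
  assumes D: "continuous_on UNIV D" and B: "B \<in> polyf U" and A: "\<And>a. a \<in> S \<Longrightarrow> A a \<in> polyf U"
  shows "prod_of D B (\<Sum>a\<in>S. A a) = (\<Sum>a\<in>S. prod_of D B (A a))"
proof -
  have z: "prod_of D B 0 = 0"
    using prod_of_scale_right[OF D B polyf_zero, of 0] by (simp add: zero_fun_def)
  show ?thesis
    using A by (induction S rule: infinite_finite_induct)
      (simp_all add: z prod_of_add_right[OF D _ _ B] polyf_sum)
qed

section \<open>The involution\<close>

lemma cnj_legs: "cnj (legs \<phi> E x) = legs \<phi> E x"
  by (simp add: legs_def)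

text \<open>Fields are real, so conjugation acts only on the kernel and on the propagators.\<close>

lemma involution_diagram:
  assumes Q: "propagator Q"
  shows "involution (diagram I c E Q) = diagram I (\<lambda>x. cnj (c x)) E (\<lambda>i j z. cnj (Q i j z))"
proof -
  have Q': "propagator (\<lambda>i j z. cnj (Q i j z))"
    unfolding propagator_def
    using propagator_continuous[OF Q] propagator_sym[OF Q] by (auto intro!: continuous_on_cnj)
  have w: "cnj (wick E Q \<phi> x) = wick E (\<lambda>i j z. cnj (Q i j z)) \<phi> x" for \<phi> x
    unfolding wick_def cnj_sum complex_cnj_mult cnj_prod cnj_legs
  proof (intro sum.cong refl arg_cong2[where f = "(*)"] prod.cong)
    fix M p assume "M \<in> matchings E" "p \<in> M"
    then obtain e e' where "p = {e, e'}" "e \<noteq> e'" by (rule matching_pair)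
    then show "cnj (pairing Q x p) = pairing (\<lambda>i j z. cnj (Q i j z)) x p"
      by (simp add: pairing_eq[OF Q] pairing_eq[OF Q'])
  qed
  show ?thesis
    unfolding involution_def diagram_def
    by (rule ext) (subst Bochner_Integration.integral_cnj[symmetric], simp only: complex_cnj_mult w)
qed

lemma involution_monomial: "finite E \<Longrightarrow> involution (monomial I c E) = monomial I (\<lambda>x. cnj (c x)) E"
  unfolding monomial_diagram involution_diagram[OF propagator_zero] by simp

lemma involution_add: "involution (A + B) = involution A + involution B"
  by (simp add: involution_def fun_eq_iff)

lemma involution_polyf: "A \<in> polyf U \<Longrightarrow> involution A \<in> polyf U"
proof (induction A rule: polyf.induct)
  case (monomial I c E)
  then show ?case unfolding involution_monomial[OF monomial(3)] by (intro polyf.monomial kern_cnj)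
next
  case (add A B)
  show ?case unfolding involution_add by (rule polyf.add[OF add.IH])
qed

text \<open>Reversal of the factors is deferred: for \<open>Delta_plus m lam\<close> it results from
  \<open>cnj_Delta_plus\<close> together with \<open>prod_of_commute\<close>.\<close>

lemma involution_prod_of:
  assumes D: "continuous_on UNIV D" and AB: "A \<in> polyf U" "B \<in> polyf U"
  shows "involution (prod_of D A B) = prod_of (\<lambda>z. cnj (D z)) (involution A) (involution B)"
  using AB(1)
proof (induction A rule: polyf.induct)
  have D': "continuous_on UNIV (\<lambda>z. cnj (D z))" using D by (rule continuous_on_cnj)
  {
    case (monomial I c E)
    note m = monomial
    note mc = m(1) kern_cnj[OF m(2)] m(3,4)
    show ?case
      using m(1) AB(2)
    proof (induction B rule: polyf_induct_fresh)
      case (monomial J d E')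
      note m' = monomial
      note Z = propagator_zero
      have j: "(\<lambda>i j z. cnj (join I J D (\<lambda>i j z. 0) (\<lambda>i j z. 0) i j z)) =
          join I J (\<lambda>z. cnj (D z)) (\<lambda>i j z. 0) (\<lambda>i j z. 0)"
        by (intro ext) (simp add: join_def)
      show ?case
        unfolding involution_monomial[OF m(3)] involution_monomial[OF m'(3)]
        unfolding monomial_diagram[OF m(3)] monomial_diagram[OF m'(3)]
          prod_of_diagram[OF D Z Z m(2,1,3,4) m'(2,1,3-5)]
          prod_of_diagram[OF D' Z Z mc(2,1,3,4) kern_cnj[OF m'(2)] m'(1,3-5)]
          involution_diagram[OF propagator_join[OF D Z Z m'(5)]] j
        by simp
    next
      case (add B B')
      show ?case
        unfolding prod_of_add_right[OF D add(1,2) polyf.monomial[OF m]] involution_add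
          prod_of_add_right[OF D' involution_polyf[OF add(1)] involution_polyf[OF add(2)] involution_polyf[OF polyf.monomial[OF m]]]
          add.IH ..
    qed
  next
    case (add A A')
    show ?case
      unfolding prod_of_add_left[OF D add(1,2) AB(2)] involution_add
          prod_of_add_left[OF D' involution_polyf[OF add(1)] involution_polyf[OF add(2)] involution_polyf[OF AB(2)]]
          add.IH ..
  }
qed

section \<open>Comparison with \<open>local_alg\<close>\<close>

lemma legs_Sigma:
  assumes "finite I"
  shows "legs \<phi> (SIGMA i:I. {..<ns i}) x = of_real (\<Prod>i\<in>I. config_fun \<phi> (x i) ^ ns i)"
proof -
  have "legs \<phi> (SIGMA i:I. {..<ns i}) x = (\<Prod>(i, a)\<in>(SIGMA i:I. {..<ns i}). of_real (config_fun \<phi> (x i)))"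
    unfolding legs_def by (simp add: split_beta)
  also have "\<dots> = (\<Prod>i\<in>I. \<Prod>a<ns i. of_real (config_fun \<phi> (x i)))"
    by (rule prod.Sigma[symmetric]) (use assms in auto)
  finally show ?thesis by simp
qed

text \<open>Precomposing with \<open>restrict\<close> extends a function of extensional points to
  all of \<open>nat \<Rightarrow> spacetime\<close>; the compact set of points is replaced by the
  union of its coordinate projections.\<close>

lemma kern_of_kernels:
  assumes "f \<in> kernels U l"
  shows "(\<lambda>x. f (restrict x {..<l})) \<in> kern {..<l} U"
proof -
  obtain K where f: "continuous_on (\<Pi>\<^sub>E i\<in>{..<l}. UNIV) f" and K: "compact K" "K \<subseteq> (\<Pi>\<^sub>E i\<in>{..<l}. U)"
    "\<forall>x \<in> (\<Pi>\<^sub>E i\<in>{..<l}. UNIV) - K. f x = 0"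
    using assms unfolding kernels_def mem_Collect_eq by (elim conjE exE)
  have r: "continuous_on UNIV (\<lambda>x::nat \<Rightarrow> spacetime. restrict x {..<l})"
  proof (rule continuous_on_coordinatewise_then_product)
    show "continuous_on UNIV (\<lambda>x::nat \<Rightarrow> spacetime. restrict x {..<l} i)" for i
      by (cases "i < l") (simp_all add: continuous_on_coordinate)
  qed
  define K' where "K' = (\<Union>i<l. (\<lambda>x. x i) ` K)"
  have K': "compact K'"
    unfolding K'_def by (intro compact_UN compact_continuous_image continuous_on_coordinate K(1)) auto
  have sub: "K' \<subseteq> U"
    unfolding K'_def by (intro UN_least image_subsetI) (use K(2) PiE_mem in blast)
  have z: "x i \<in> K'" if "f (restrict x {..<l}) \<noteq> 0" "i \<in> {..<l}" for x i
  proof -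
    have "restrict x {..<l} \<in> K" using bspec[OF K(3), of "restrict x {..<l}"] that(1) by (auto simp del: restrict_apply)
    then have "restrict x {..<l} i \<in> (\<lambda>x. x i) ` K" by (rule imageI)
    then show ?thesis using that(2) unfolding K'_def by auto
  qed
  have loc: "f (restrict x {..<l}) = f (restrict y {..<l})" if "\<forall>i\<in>{..<l}. x i = y i" for x y
    using that by (intro arg_cong[of _ _ f] restrict_ext) simp
  have c: "continuous_on UNIV (\<lambda>x. f (restrict x {..<l}))"
    by (rule continuous_on_compose2[OF f r]) (rule image_subsetI, simp add: restrict_PiE_iff)
  show ?thesis
    unfolding kern_def mem_Collect_eq
  proof (intro conjI c allI impI exI[of _ K'] K' sub ballI)
    show "f (restrict x {..<l}) = f (restrict y {..<l})" if "\<forall>i\<in>{..<l}. x i = y i" for x y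
      using that by (rule loc)
    show "x i \<in> K'" if "f (restrict x {..<l}) \<noteq> 0" "i \<in> {..<l}" for x i
      using that by (rule z)
  qed
qed

lemma multilocal_eq_monomial:
  "multilocal l ns f = monomial {..<l} (\<lambda>x. f (restrict x {..<l})) (SIGMA i:{..<l}. {..<ns i})"
  unfolding multilocal_def monomial_def legs_Sigma[OF finite_lessThan]
proof (intro ext Bochner_Integration.integral_cong refl)
  fix \<phi> x assume "x \<in> space (vol {..<l})"
  then have "restrict x {..<l} = x" by (auto simp: space_PiM intro: PiE_restrict)
  then show "f x * of_real (\<Prod>i<l. config_fun \<phi> (x i) ^ ns i) =
      f (restrict x {..<l}) * of_real (\<Prod>i<l. config_fun \<phi> (x i) ^ ns i)" by simp
qed

lemma multilocal_polyf: "f \<in> kernels U l \<Longrightarrow> multilocal l ns f \<in> polyf U"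
  unfolding multilocal_eq_monomial by (rule polyf.monomial) (auto intro: kern_of_kernels)

lemma local_alg_polyf:
  assumes "A \<in> local_alg U"
  shows "A \<in> polyf U"
proof -
  obtain N :: nat and l ns f where A: "\<forall>j<N. 1 \<le> l j \<and> f j \<in> kernels U (l j)"
    "A = (\<Sum>j<N. multilocal (l j) (ns j) (f j))"
    using assms unfolding local_alg_def mem_Collect_eq by (elim exE conjE)
  show ?thesis unfolding A(2) using A(1) by (intro polyf_sum multilocal_polyf) auto
qed

lemma kernels_of_kern:
  assumes c: "c \<in> kern {..<l} U"
  shows "c \<in> kernels U l"
proof -
  obtain K where K: "compact K" "K \<subseteq> U" "\<And>x i. c x \<noteq> 0 \<Longrightarrow> i \<in> {..<l} \<Longrightarrow> x i \<in> K"
    using kern_supp[OF c] by metis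
  have "(\<Pi>\<^sub>E i\<in>{..<l}. K) = PiE UNIV (\<lambda>i. if i \<in> {..<l} then K else {undefined})"
    by (auto simp: PiE_def Pi_def extensional_def)
  moreover have "compactin (product_topology (\<lambda>i. euclidean) UNIV)
      (PiE UNIV (\<lambda>i::nat. if i \<in> {..<l} then K else {undefined::spacetime}))"
    using K(1) by (subst compactin_PiE) auto
  ultimately have comp: "compact (\<Pi>\<^sub>E i\<in>{..<l}. K)"
    using compactin_euclidean_iff[of "\<Pi>\<^sub>E i\<in>{..<l}. K"] by (simp add: euclidean_product_topology)
  have z: "c x = 0" if "x \<in> (\<Pi>\<^sub>E i\<in>{..<l}. UNIV) - (\<Pi>\<^sub>E i\<in>{..<l}. K)" for x
  proof (rule ccontr)
    assume "c x \<noteq> 0"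
    then have "x \<in> (\<Pi>\<^sub>E i\<in>{..<l}. K)" using K(3)[of x] that by (auto simp: PiE_def)
    then show False using that by simp
  qed
  have "(\<Pi>\<^sub>E i\<in>{..<l}. K) \<subseteq> (\<Pi>\<^sub>E i\<in>{..<l}. U)" using K(2) by (intro PiE_mono) auto
  then show ?thesis
    unfolding kernels_def mem_Collect_eq
    using continuous_on_subset[OF kern_continuous[OF c] subset_UNIV] comp z
    by (intro conjI exI[of _ "\<Pi>\<^sub>E i\<in>{..<l}. K"] ballI)
qed

lemma multilocal_local_alg: "f \<in> kernels U l \<Longrightarrow> 1 \<le> l \<Longrightarrow> multilocal l ns f \<in> local_alg U"
  unfolding local_alg_def mem_Collect_eq
  by (intro exI[of _ "1::nat"] exI[of _ "\<lambda>_. l"] exI[of _ "\<lambda>_. ns"] exI[of _ "\<lambda>_. f"]) simp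

text \<open>\<open>multilocal\<close> wants consecutive vertices from 0 and only the number of legs
  at each, so the vertices are renumbered by a bijection and the legs are counted in
  \<open>ns\<close>.\<close>

lemma monomial_local_alg:
  assumes I: "finite I" "I \<noteq> {}" and c: "c \<in> kern I U" and E: "finite E" "fst ` E \<subseteq> I"
  shows "monomial I c E \<in> local_alg U"
proof -
  obtain r where "bij_betw r I {0..<card I}" using ex_bij_betw_finite_nat[OF I(1)] by blast
  then have r: "inj_on r I" "r ` I = {..<card I}" by (auto simp: bij_betw_def atLeast0LessThan)
  define l where "l = card I"
  define d where "d = (\<lambda>x. c (\<lambda>i. x (r i)))"
  define F where "F = map_prod r id ` E"
  define ns where "ns i = card {e \<in> F. fst e = i}" for i
  note m = monomial_relabel[OF I(1) c E r(1), unfolded r(2), folded l_def d_def F_def]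
  have "legs \<phi> F x = of_real (\<Prod>i<l. config_fun \<phi> (x i) ^ ns i)" for \<phi> x
  proof -
    have "legs \<phi> F x = (\<Prod>i<l. \<Prod>e\<in>{e \<in> F. fst e = i}. of_real (config_fun \<phi> (x (fst e))))"
      unfolding legs_def by (rule prod.group[symmetric]) (use m in auto)
    also have "\<dots> = (\<Prod>i<l. of_real (config_fun \<phi> (x i) ^ ns i))"
      unfolding ns_def by (intro prod.cong refl) simp
    finally show ?thesis by simp
  qed
  then have "monomial {..<l} d F = multilocal l ns d"
    by (simp add: monomial_def multilocal_def)
  moreover have "1 \<le> l" using I by (simp add: l_def Suc_le_eq card_gt_0_iff)
  ultimately show ?thesis using m(1) multilocal_local_alg[OF kernels_of_kern[OF m(2)]] by simp
qed

lemma local_alg_add: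
  assumes "A \<in> local_alg U" "B \<in> local_alg U"
  shows "A + B \<in> local_alg U"
proof -
  obtain N :: nat and l ns f where A: "\<forall>j<N. 1 \<le> l j \<and> f j \<in> kernels U (l j)"
    "A = (\<Sum>j<N. multilocal (l j) (ns j) (f j))"
    using assms(1) unfolding local_alg_def mem_Collect_eq by (elim exE conjE)
  obtain N' :: nat and l' ns' f' where B: "\<forall>j<N'. 1 \<le> l' j \<and> f' j \<in> kernels U (l' j)"
    "B = (\<Sum>j<N'. multilocal (l' j) (ns' j) (f' j))"
    using assms(2) unfolding local_alg_def mem_Collect_eq by (elim exE conjE)
  define L where "L j = (if j < N then l j else l' (j - N))" for j
  define NS where "NS j = (if j < N then ns j else ns' (j - N))" for j
  define F where "F j = (if j < N then f j else f' (j - N))" for j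
  have "(\<Sum>j<N + N'. multilocal (L j) (NS j) (F j)) =
      (\<Sum>j<N. multilocal (L j) (NS j) (F j)) + (\<Sum>j<N'. multilocal (L (N + j)) (NS (N + j)) (F (N + j)))"
    by (induction N') (simp_all add: add.assoc)
  then have "A + B = (\<Sum>j<N + N'. multilocal (L j) (NS j) (F j))"
    unfolding A(2) B(2) by (simp add: L_def NS_def F_def)
  moreover have "1 \<le> L j \<and> F j \<in> kernels U (L j)" if "j < N + N'" for j
    using spec[OF A(1), of j] spec[OF B(1), of "j - N"] that by (auto simp: L_def F_def)
  ultimately show ?thesis
    unfolding local_alg_def mem_Collect_eq
    by - (rule exI[of _ "N + N'"], rule exI[of _ L], rule exI[of _ NS], rule exI[of _ F], simp)
qed

text \<open>\<open>local_alg\<close> demands at least one vertex, so a constant is the integral of a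
  normalised bump at a vertex without legs. A tent function serves as the bump, since kernels only
  have to be continuous.\<close>

lemma constant_local_alg: "(\<lambda>\<phi>. z) \<in> local_alg UNIV"
proof -
  define b :: "spacetime \<Rightarrow> real" where "b y = max 0 (1 - norm y)" for y
  have bc: "continuous_on UNIV b" unfolding b_def by (intro continuous_intros)
  have b0: "b y = 0" if "y \<notin> cball 0 1" for y using that by (simp add: b_def dist_norm)
  have int: "integrable lborel b" by (rule integrable_continuous_compact_supp[OF bc compact_cball b0])
  define Z where "Z = (LINT y|lborel. b y)"
  have "Z \<noteq> 0"
  proof
    assume "Z = 0"
    then have "AE y in lborel. b y = 0"
      using integral_nonneg_eq_0_iff_AE[OF int] unfolding Z_def by (simp add: b_def[abs_def])
    then have "{y. b y \<noteq> 0} \<in> null_sets lborel"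
      using bc by (subst AE_iff_null_sets) (auto intro!: borel_open open_Collect_neq)
    then have "negligible {y. b y \<noteq> 0}" by (simp add: negligible_iff_null_sets null_sets_completionI)
    moreover have "open {y. b y \<noteq> 0}" by (rule open_Collect_neq) (use bc in auto)
    moreover have "0 \<in> {y. b y \<noteq> 0}" by (simp add: b_def)
    ultimately show False using open_not_negligible by blast
  qed
  define c where "c = (\<lambda>x::nat \<Rightarrow> spacetime. z / of_real Z * of_real (b (x 0)))"
  have "(\<lambda>x::nat \<Rightarrow> spacetime. \<Prod>i\<in>{0}. of_real (b (x i))) \<in> kern {0} UNIV"
    by (rule kern_prod[where K = "cball 0 1"])
       (use b0 bc in \<open>auto intro!: continuous_on_of_real\<close>)
  then have k: "c \<in> kern {0} UNIV" unfolding c_def by (intro kern_scale) simp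
  have "continuous_on UNIV (\<lambda>y. z / of_real Z * of_real (b y))"
    by (intro continuous_on_mult continuous_on_const continuous_on_of_real bc)
  then have "(\<lambda>y. z / of_real Z * of_real (b y)) \<in> borel_measurable lborel"
    by (simp only: borel_measurable_continuous_onI measurable_lborel2)
  then have "(LINT x|vol {0}. c x) = (LINT y|lborel. z / of_real Z * of_real (b y))"
    unfolding c_def by (rule lborels.product_integral_singleton)
  also have "\<dots> = z" using \<open>Z \<noteq> 0\<close> by (simp add: Z_def)
  finally have "monomial {0} c {} = (\<lambda>\<phi>. z)" by (simp add: monomial_def legs_def)
  then show ?thesis using monomial_local_alg[of "{0}" c UNIV "{}"] k by simp
qed

lemma polyf_local_alg:
  assumes "A \<in> polyf UNIV"
  shows "A \<in> local_alg UNIV"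
  using assms
proof (induction A rule: polyf.induct)
  case (monomial I c E)
  show ?case
  proof (cases "I = {}")
    case True
    then have "monomial I c E = (\<lambda>\<phi>. c (\<lambda>_. undefined))"
      using monomial by (simp add: monomial_def legs_def vol_empty)
    then show ?thesis by (simp add: constant_local_alg)
  qed (use monomial in \<open>auto intro: monomial_local_alg\<close>)
next
  case (add A B)
  then show ?case by (intro local_alg_add)
qed

lemma local_alg_UNIV: "local_alg UNIV = polyf UNIV"
  using local_alg_polyf polyf_local_alg by blast

text \<open>The vertex \<open>i\<close> is arbitrary, so that repeated factors of the interaction
  can sit at distinct vertices.\<close>

lemma interaction_eq_monomial:
  "interaction n g = monomial {i} (\<lambda>x. of_real (g (x i))) ({i} \<times> {..<n})" if "test_function g" for g
proof -
  have gc: "continuous_on UNIV g" using that smooth_continuous by (auto simp: test_function_def)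
  have legs: "legs \<phi> ({i} \<times> {..<n}) x = of_real (config_fun \<phi> (x i) ^ n)" for \<phi> x
    using legs_Sigma[of "{i}" \<phi> "\<lambda>_. n" x] by simp
  have "(LINT x|vol {i}. complex_of_real (g (x i)) * of_real (config_fun \<phi> (x i) ^ n)) =
      (LINT y|lborel. complex_of_real (g y) * of_real (config_fun \<phi> y ^ n))" for \<phi>
  proof (rule lborels.product_integral_singleton)
    have "continuous_on UNIV (config_fun \<phi>)" using config_fun[of \<phi>] smooth_continuous by blast
    then have "continuous_on UNIV (\<lambda>y. complex_of_real (g y) * of_real (config_fun \<phi> y ^ n))"
      using gc by (intro continuous_intros)
    then show "(\<lambda>y. complex_of_real (g y) * of_real (config_fun \<phi> y ^ n)) \<in> borel_measurable lborel"
      using borel_measurable_continuous_onI by auto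
  qed
  then show ?thesis
    unfolding interaction_def monomial_def legs
    by (simp only: of_real_mult[symmetric] integral_complex_of_real)
qed

lemma kern_interactions:
  assumes g: "test_function g" and I: "finite I"
  shows "(\<lambda>x. \<Prod>i\<in>I. complex_of_real (g (x i))) \<in> kern I UNIV"
  by (rule kern_prod[OF I, where K = "supp g"])
     (use g notin_supp smooth_continuous in \<open>auto simp: test_function_def intro!: continuous_on_of_real\<close>)

lemma interaction_polyf: "test_function g \<Longrightarrow> interaction n g \<in> polyf UNIV"
  unfolding interaction_eq_monomial[of g n 0]
  using kern_interactions[of g "{0}"] by (intro polyf.monomial) auto

section \<open>The propagators\<close>

context
  fixes m lam :: real
  assumes m: "m > 0" and lam: "lam > 0"
begin

definition weight :: "real ^ 3 \<Rightarrow> real" where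
  "weight p = 1 / (2 * omega m p) * exp (- lam\<^sup>2 * (2 * (norm p)\<^sup>2 + m\<^sup>2))"

definition phase :: "spacetime \<Rightarrow> real ^ 3 \<Rightarrow> complex" where
  "phase x p = exp (- \<i> * of_real (omega m p * fst x - p \<bullet> snd x))"

section \<open>The propagator \<open>Delta_plus\<close>\<close>

lemma Delta_plus_eq: "Delta_plus m lam x = 1 / (2 * of_real pi) ^ 3 * (LINT p|lborel. of_real (weight p) * phase x p)"
  by (simp only: Delta_plus_def weight_def phase_def)

lemma omega_ge: "omega m p \<ge> m"
  using m unfolding omega_def by (intro real_le_rsqrt) simp

lemma continuous_omega: "continuous_on UNIV (omega m)"
  unfolding omega_def by (intro continuous_intros)

lemma continuous_weight: "continuous_on UNIV weight"
proof -
  have "2 * omega m p \<noteq> 0" for p using omega_ge[of p] m by simp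
  then show ?thesis
    unfolding weight_def
    by (intro continuous_on_mult continuous_on_divide continuous_on_const continuous_omega continuous_intros ballI)
qed

lemma continuous_phase: "continuous_on UNIV (phase x)"
  unfolding phase_def
  by (intro continuous_on_exp continuous_on_mult continuous_on_const continuous_on_of_real continuous_on_diff
      continuous_omega continuous_on_inner continuous_on_id)

lemma norm_phase: "norm (phase x p) = 1"
  unfolding phase_def by simp

text \<open>Use \<open>1 + u \<le> exp u\<close> at \<open>u = a * t\<^sup>2\<close>; the constant
  \<open>max 1 (1 / a)\<close> covers both terms of \<open>1 + t\<^sup>2\<close>.\<close>

lemma exp_minus_square_le:
  fixes a t :: real
  assumes "a > 0"
  shows "exp (- (a * t\<^sup>2)) \<le> max 1 (1 / a) * inverse (1 + t\<^sup>2)"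
proof -
  have "1 + t\<^sup>2 \<le> max 1 (1 / a) * (1 + a * t\<^sup>2)"
  proof -
    have "1 / a * (a * t\<^sup>2) \<le> max 1 (1 / a) * (a * t\<^sup>2)"
      using assms by (intro mult_right_mono) auto
    then show ?thesis using assms by (simp add: distrib_left)
  qed
  also have "\<dots> \<le> max 1 (1 / a) * exp (a * t\<^sup>2)"
    by (intro mult_left_mono exp_ge_add_one_self) auto
  finally have le: "1 + t\<^sup>2 \<le> max 1 (1 / a) * exp (a * t\<^sup>2)" .
  have pos: "1 + t\<^sup>2 > 0" by (simp add: add_pos_nonneg)
  have "exp (- (a * t\<^sup>2)) = exp (- (a * t\<^sup>2)) * ((1 + t\<^sup>2) * inverse (1 + t\<^sup>2))"
    using pos by simp
  also have "\<dots> \<le> exp (- (a * t\<^sup>2)) * ((max 1 (1 / a) * exp (a * t\<^sup>2)) * inverse (1 + t\<^sup>2))"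
    using le pos by (intro mult_left_mono mult_right_mono) auto
  also have "\<dots> = max 1 (1 / a) * inverse (1 + t\<^sup>2) * (exp (- (a * t\<^sup>2)) * exp (a * t\<^sup>2))"
    by (simp only: mult_ac)
  finally show ?thesis by (simp flip: exp_add)
qed

text \<open>Here \<open>lam > 0\<close> gives Gaussian decay in every momentum component, dominated
  by the integrable product weight, and \<open>m > 0\<close> bounds the factor
  \<open>1 / (2 * omega m p)\<close>.\<close>

lemma integrable_weight: "integrable lborel weight"
proof -
  define a where "a = 2 * lam\<^sup>2"
  define C where "C = max 1 (1 / a)"
  have a: "a > 0" using lam by (simp add: a_def)
  have "\<bar>weight p\<bar> \<le> 1 / (2 * m) * (C ^ DIM(real ^ 3) * (\<Prod>b\<in>Basis. inverse (1 + (p \<bullet> b)\<^sup>2)))" for p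
  proof -
    have "(norm p)\<^sup>2 = (\<Sum>b\<in>Basis. (p \<bullet> b)\<^sup>2)"
      unfolding power2_norm_eq_inner by (subst euclidean_inner) (simp only: power2_eq_square)
    then have "exp (- (a * (norm p)\<^sup>2)) = (\<Prod>b\<in>Basis. exp (- (a * (p \<bullet> b)\<^sup>2)))"
      by (simp add: exp_sum[symmetric] sum_negf sum_distrib_left[symmetric])
    also have "\<dots> \<le> (\<Prod>b\<in>(Basis :: (real ^ 3) set). C * inverse (1 + (p \<bullet> b)\<^sup>2))"
      unfolding C_def by (intro prod_mono conjI exp_minus_square_le a) auto
    also have "\<dots> = C ^ DIM(real ^ 3) * (\<Prod>b\<in>Basis. inverse (1 + (p \<bullet> b)\<^sup>2))"
      by (simp only: prod.distrib prod_constant)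
    finally have 1: "exp (- (a * (norm p)\<^sup>2)) \<le> C ^ DIM(real ^ 3) * (\<Prod>b\<in>Basis. inverse (1 + (p \<bullet> b)\<^sup>2))" .
    have "exp (- lam\<^sup>2 * (2 * (norm p)\<^sup>2 + m\<^sup>2)) \<le> exp (- (a * (norm p)\<^sup>2))"
      by (simp add: a_def algebra_simps)
    note 2 = order_trans[OF this 1]
    have 3: "0 \<le> 1 / (2 * omega m p)" "1 / (2 * omega m p) \<le> 1 / (2 * m)"
      using omega_ge[of p] m by (auto simp: frac_le)
    have "\<bar>weight p\<bar> = 1 / (2 * omega m p) * exp (- lam\<^sup>2 * (2 * (norm p)\<^sup>2 + m\<^sup>2))"
      unfolding weight_def using 3(1) by (intro abs_of_nonneg mult_nonneg_nonneg) auto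
    also have "\<dots> \<le> 1 / (2 * m) * (C ^ DIM(real ^ 3) * (\<Prod>b\<in>Basis. inverse (1 + (p \<bullet> b)\<^sup>2)))"
      by (rule mult_mono[OF 3(2) 2]) (use m in simp_all)
    finally show ?thesis .
  qed
  then have "\<bar>weight p\<bar> \<le> \<bar>1 / (2 * m) * (C ^ DIM(real ^ 3) * (\<Prod>b\<in>Basis. inverse (1 + (p \<bullet> b)\<^sup>2)))\<bar>" for p
    by (rule order_trans) (rule abs_ge_self)
  moreover have "integrable lborel (\<lambda>p::real ^ 3. 1 / (2 * m) * (C ^ DIM(real ^ 3) * (\<Prod>b\<in>Basis. inverse (1 + (p \<bullet> b)\<^sup>2))))"
    by (intro integrable_mult_right integrable_prod_inverse_one_plus_power2)
  ultimately show ?thesis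
    using continuous_weight
    by (intro Bochner_Integration.integrable_bound[of lborel _ weight]) (auto intro: borel_measurable_continuous_onI)
qed

lemma measurable_weight_phase: "(\<lambda>p. of_real (weight p) * phase x p) \<in> borel_measurable lborel"
proof -
  have "continuous_on UNIV (\<lambda>p. of_real (weight p) * phase x p)"
    by (intro continuous_on_mult continuous_on_of_real continuous_weight continuous_phase)
  then show ?thesis by (simp only: borel_measurable_continuous_onI measurable_lborel2)
qed

text \<open>The phase has modulus one, so \<open>weight\<close> majorises the integrands for all
  points at once.\<close>

lemma continuous_Delta_plus: "continuous_on UNIV (Delta_plus m lam)"
proof -
  have "(\<lambda>n. LINT p|lborel. of_real (weight p) * phase (u n) p) \<longlonglongrightarrow> (LINT p|lborel. of_real (weight p) * phase a p)"
    if u: "u \<longlonglongrightarrow> a" for u a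
  proof (rule integral_dominated_convergence[where w = "\<lambda>p. \<bar>weight p\<bar>"])
    show "integrable lborel (\<lambda>p. \<bar>weight p\<bar>)" using integrable_weight by (rule integrable_abs)
    show "AE p in lborel. (\<lambda>n. of_real (weight p) * phase (u n) p) \<longlonglongrightarrow> of_real (weight p) * phase a p"
      unfolding phase_def by (intro AE_I2 tendsto_intros u)
    show "AE p in lborel. norm (of_real (weight p) * phase (u n) p) \<le> \<bar>weight p\<bar>" for n
      by (intro AE_I2) (simp add: norm_mult norm_phase)
  qed (rule measurable_weight_phase)+
  then have "\<forall>a. isCont (\<lambda>x. LINT p|lborel. of_real (weight p) * phase x p) a"
    unfolding continuous_at_sequentially comp_def by blast
  then have "continuous_on UNIV (\<lambda>x. LINT p|lborel. of_real (weight p) * phase x p)"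
    by (simp add: continuous_on_eq_continuous_at)
  then have "continuous_on UNIV (\<lambda>x. 1 / (2 * of_real pi) ^ 3 * (LINT p|lborel. of_real (weight p) * phase x p))"
    by (rule continuous_on_mult_left)
  then show ?thesis unfolding Delta_plus_eq[abs_def] .
qed

lemma cnj_Delta_plus: "cnj (Delta_plus m lam x) = Delta_plus m lam (- x)"
proof -
  have ph: "cnj (phase x p) = phase (- x) p" for p
    unfolding phase_def by (simp add: exp_cnj algebra_simps)
  have "cnj (Delta_plus m lam x) = 1 / (2 * of_real pi) ^ 3 * cnj (LINT p|lborel. of_real (weight p) * phase x p)"
    unfolding Delta_plus_eq by simp
  also have "cnj (LINT p|lborel. of_real (weight p) * phase x p) = (LINT p|lborel. of_real (weight p) * phase (- x) p)"
    by (subst Bochner_Integration.integral_cnj[symmetric]) (simp only: complex_cnj_mult complex_cnj_complex_of_real ph)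
  finally show ?thesis unfolding Delta_plus_eq .
qed

text \<open>Substitute \<open>- p\<close> for \<open>p\<close>: the weight depends on
  \<open>norm p\<close> only, and at time zero the phase only contains
  \<open>p \<bullet> snd x\<close>.\<close>

lemma Delta_plus_even:
  assumes "fst x = 0"
  shows "Delta_plus m lam (- x) = Delta_plus m lam x"
proof -
  let ?f = "\<lambda>x p. of_real (weight p) * phase x p"
  have neg: "lborel = distr lborel borel (uminus :: real ^ 3 \<Rightarrow> real ^ 3)"
    using lborel_affine[of "-1" "0 :: real ^ 3"] by (simp add: density_1)
  have "(LINT p|lborel. ?f x p) = (LINT p|distr lborel borel uminus. ?f x p)"
    using neg by simp
  also have "\<dots> = (LINT p|lborel. ?f x (- p))"
    using measurable_weight_phase[of x] by (intro integral_distr) auto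
  also have "\<dots> = (LINT p|lborel. ?f (- x) p)"
    using assms by (intro Bochner_Integration.integral_cong refl) (simp add: weight_def phase_def omega_def)
  finally show ?thesis unfolding Delta_plus_eq by simp
qed

section \<open>The Feynman propagator\<close>

lemma Delta_F_minus: "Delta_F m lam (- x) = Delta_F m lam x"
  by (simp add: Delta_F_def)

text \<open>At time zero the value is the mean of the two branches, and these agree by
  \<open>Delta_plus_even\<close>. Having the closed half space matters: points of equal time may be
  ordered either way.\<close>

lemma Delta_F_future: "fst x \<ge> 0 \<Longrightarrow> Delta_F m lam x = Delta_plus m lam x"
  using Delta_plus_even[of x] by (cases "fst x = 0") (auto simp: Delta_F_def theta_def)

lemma Delta_F_past: "fst x \<le> 0 \<Longrightarrow> Delta_F m lam x = Delta_plus m lam (- x)"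
  using Delta_F_future[of "- x"] Delta_F_minus[of x] by simp

lemma continuous_Delta_F: "continuous_on UNIV (Delta_F m lam)"
proof -
  let ?P = "{x::spacetime. 0 \<le> fst x}" and ?N = "{x::spacetime. fst x \<le> 0}"
  have "continuous_on ?P (Delta_F m lam)"
    using continuous_on_subset[OF continuous_Delta_plus subset_UNIV] Delta_F_future
    by (subst continuous_on_cong[OF refl, of _ _ "Delta_plus m lam"]) auto
  moreover have "continuous_on ?N (Delta_F m lam)"
  proof -
    have "continuous_on ?N (\<lambda>x. Delta_plus m lam (- x))"
      by (rule continuous_on_compose2[OF continuous_Delta_plus]) (auto intro: continuous_on_minus continuous_on_id)
    then show ?thesis
      using Delta_F_past by (subst continuous_on_cong[OF refl, of _ _ "\<lambda>x. Delta_plus m lam (- x)"]) auto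
  qed
  moreover have "closed ?P" "closed ?N"
    by (intro closed_Collect_le continuous_on_const continuous_on_fst continuous_on_id)+
  ultimately have "continuous_on (?P \<union> ?N) (Delta_F m lam)" by (intro continuous_on_closed_Un)
  moreover have "?P \<union> ?N = UNIV" by auto
  ultimately show ?thesis by simp
qed

end

section \<open>Time-ordered powers and causality\<close>

text \<open>The recursion is that of the power in \<open>T_monoid\<close>, so
  \<open>pow_T_monoid\<close> uses no monoid laws.\<close>

primrec tpow :: "(spacetime \<Rightarrow> complex) \<Rightarrow> functional \<Rightarrow> nat \<Rightarrow> functional" where
  "tpow F A 0 = 1"
| "tpow F A (Suc k) = prod_of F (tpow F A k) A"

lemma tpow_polyf: "continuous_on UNIV F \<Longrightarrow> A \<in> polyf U \<Longrightarrow> tpow F A k \<in> polyf U"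
  by (induction k) (auto intro: polyf_one prod_of_closed)

text \<open>No propagator joins two legs of one vertex, so each interaction vertex remains a plain
  power of the field.\<close>

definition chron :: "(spacetime \<Rightarrow> complex) \<Rightarrow> propagators" where
  "chron F = (\<lambda>i j. if i = j then (\<lambda>z. 0) else F)"

lemma sum_Pow_insert:
  fixes f :: "'a set \<Rightarrow> 'b::comm_monoid_add"
  assumes "finite K" "i \<in> K"
  shows "(\<Sum>S\<in>Pow K. f S) = (\<Sum>S\<in>Pow (K - {i}). f S + f (insert i S))"
proof -
  have K: "K = insert i (K - {i})" using assms(2) by auto
  have inj: "inj_on (insert i) (Pow (K - {i}))" by (auto simp: inj_on_def)
  have "(\<Sum>S\<in>Pow (insert i (K - {i})). f S) = (\<Sum>S\<in>Pow (K - {i}). f S) + (\<Sum>S\<in>insert i ` Pow (K - {i}). f S)"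
    unfolding Pow_insert using assms(1) by (intro sum.union_disjoint) auto
  then show ?thesis using K by (simp add: sum.reindex[OF inj] sum.distrib)
qed

text \<open>Turns a binomial sum over orders into a sum over sets of labelled vertices, where
  cancellation in pairs becomes visible.\<close>

lemma sum_Pow_card:
  fixes f :: "nat \<Rightarrow> complex"
  assumes "finite K"
  shows "(\<Sum>S\<in>Pow K. f (card S)) = (\<Sum>r\<le>card K. of_nat (card K choose r) * f r)"
proof -
  have "(\<Sum>S\<in>Pow K. f (card S)) = (\<Sum>r\<le>card K. \<Sum>S\<in>{S \<in> Pow K. card S = r}. f (card S))"
    using assms by (intro sum.group[symmetric]) (auto intro: card_mono)
  also have "\<dots> = (\<Sum>r\<le>card K. of_nat (card K choose r) * f r)"
    using n_subsets[OF assms] by (intro sum.cong refl) (simp add: Pow_def)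
  finally show ?thesis .
qed

lemma finite_argmax:
  fixes f :: "'a \<Rightarrow> real"
  assumes "finite K" "K \<noteq> {}"
  shows "\<exists>i\<in>K. \<forall>j\<in>K. f j \<le> f i"
proof -
  have "Max (f ` K) \<in> f ` K" using assms by (intro Max_in) auto
  then obtain i where i: "i \<in> K" "f i = Max (f ` K)" by auto
  have "f j \<le> f i" if "j \<in> K" for j unfolding i(2) using assms(1) that by (intro Max_ge) auto
  with i(1) show ?thesis by blast
qed

text \<open>The direction of time is abstract: \<open>\<tau>\<close> is the time function and
  \<open>F\<close> equals \<open>D\<close> whenever the first point is not earlier. Both the future
  with \<open>Delta_plus\<close> and the past with its reflection are instances.\<close>

locale causal =
  fixes D F :: "spacetime \<Rightarrow> complex" and \<tau> :: "spacetime \<Rightarrow> real"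
  assumes continuous_D: "continuous_on UNIV D" and continuous_F: "continuous_on UNIV F"
    and cnj_D: "cnj (D z) = D (- z)"
    and F_minus: "F (- z) = F z"
    and F_eq_D: "\<tau> y \<le> \<tau> x \<Longrightarrow> F (x - y) = D (x - y)"
begin

lemma propagator_chron: "propagator (chron F)"
  unfolding propagator_def
proof (intro conjI allI)
  show "continuous_on UNIV (chron F i j)" for i j
    by (cases "i = j") (simp_all add: chron_def continuous_F)
  show "chron F j i (- z) = chron F i j z" for i j z
    by (cases "i = j") (simp_all add: chron_def F_minus)
qed

text \<open>Any \<open>K\<close> of the right size may carry the vertices, so they can be kept apart
  from those of other functionals. A new vertex is joined to all of \<open>K\<close> by
  \<open>F\<close>, and evenness of \<open>F\<close> makes the result
  \<open>chron F\<close>.\<close>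

lemma tpow_interaction:
  assumes g: "test_function g" and K: "finite K"
  shows "tpow F (interaction n g) (card K) =
    diagram K (\<lambda>x. \<Prod>i\<in>K. complex_of_real (g (x i))) (K \<times> {..<n}) (chron F)"
  using K
proof (induction K rule: finite_induct)
  case empty
  have "diagram {} (\<lambda>x. 1) {} (chron F) = diagram {} (\<lambda>x. 1) {} (\<lambda>i j z. 0)"
    by (rule diagram_cong[OF propagator_chron propagator_zero]) auto
  then show ?case by (simp add: one_eq_monomial monomial_diagram)
next
  case (insert i K)
  let ?g = "\<lambda>K x. \<Prod>i\<in>K. complex_of_real (g (x i))"
  have s: "fst ` (K \<times> {..<n}) \<subseteq> K" "fst ` ({i} \<times> {..<n}) \<subseteq> {i}" "finite (K \<times> {..<n})" "finite ({i} \<times> {..<n})"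
    "K \<inter> {i} = {}" using insert.hyps by auto
  have ki: "(\<lambda>x. complex_of_real (g (x i))) \<in> kern {i} UNIV"
    using kern_interactions[OF g, of "{i}"] by simp
  have V: "interaction n g = diagram {i} (\<lambda>x. of_real (g (x i))) ({i} \<times> {..<n}) (\<lambda>i j z. 0)"
    unfolding interaction_eq_monomial[OF g, of n i] by (rule monomial_diagram[OF s(4)])
  have "tpow F (interaction n g) (card (insert i K)) = prod_of F (tpow F (interaction n g) (card K)) (interaction n g)"
    using insert.hyps by simp
  also have "\<dots> = prod_of F (diagram K (?g K) (K \<times> {..<n}) (chron F))
        (diagram {i} (\<lambda>x. of_real (g (x i))) ({i} \<times> {..<n}) (\<lambda>i j z. 0))"
    unfolding insert.IH by (subst V) (rule refl)
  also have "\<dots> = diagram (K \<union> {i}) (\<lambda>x. ?g K x * of_real (g (x i))) (K \<times> {..<n} \<union> {i} \<times> {..<n})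
      (join K {i} F (chron F) (\<lambda>i j z. 0))"
    by (rule prod_of_diagram[OF continuous_F propagator_chron propagator_zero kern_interactions[OF g insert.hyps(1)]
          insert.hyps(1) s(3,1) ki _ s(4,2,5)]) simp
  also have "\<dots> = diagram (K \<union> {i}) (?g (insert i K)) (K \<times> {..<n} \<union> {i} \<times> {..<n}) (chron F)"
  proof (rule diagram_cong[OF propagator_join[OF continuous_F propagator_chron propagator_zero s(5)] propagator_chron])
    show "?g K x * of_real (g (x i)) = ?g (insert i K) x" for x
      using insert.hyps by (simp add: mult.commute)
    show "join K {i} F (chron F) (\<lambda>i j z. 0) a b (x a - x b) = chron F a b (x a - x b)"
      if "a \<in> fst ` (K \<times> {..<n} \<union> {i} \<times> {..<n})" "b \<in> fst ` (K \<times> {..<n} \<union> {i} \<times> {..<n})" for x a b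
    proof -
      have "a \<in> insert i K" "b \<in> insert i K" using that by auto
      then have "join K {i} F (chron F) (\<lambda>i j z. 0) a b z = chron F a b z" for z
        using insert.hyps(2) by (cases "a = b"; cases "a = i"; cases "b = i") (simp_all add: join_def chron_def F_minus)
      then show ?thesis .
    qed
  qed
  also have "K \<times> {..<n} \<union> {i} \<times> {..<n} = insert i K \<times> {..<n}" by auto
  also have "K \<union> {i} = insert i K" by auto
  finally show ?case .
qed

section \<open>Cancellation of the latest vertex\<close>

text \<open>The propagators of \<open>T(S)\<^sup>* \<star> T(K - S, B)\<close>: anti-time-ordered within \<open>S\<close>, time-ordered outside
  of \<open>S\<close> except for the vertices \<open>J\<close> of the fixed functional \<open>B\<close>.\<close>

definition mixed :: "nat set \<Rightarrow> nat set \<Rightarrow> propagators" where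
  "mixed J S = (\<lambda>i j. if i = j then (\<lambda>z. 0) else if i \<in> S \<and> j \<in> S then (\<lambda>z. cnj (F z))
     else if i \<notin> S \<and> j \<notin> S then (if i \<in> J \<and> j \<in> J then (\<lambda>z. 0) else F)
     else if i \<in> S then D else (\<lambda>z. D (- z)))"

lemma continuous_D_minus: "continuous_on UNIV (\<lambda>z. D (- z))"
  by (rule continuous_on_reflect[OF continuous_D])

lemma propagator_mixed: "propagator (mixed J S)"
  unfolding propagator_def
proof (intro conjI allI)
  have "continuous_on UNIV (\<lambda>z. cnj (F z))" using continuous_F by (rule continuous_on_cnj)
  then show "continuous_on UNIV (mixed J S i j)" for i j
    using continuous_F continuous_D continuous_D_minus by (simp add: mixed_def)
  show "mixed J S j i (- z) = mixed J S i j z" for i j z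
    by (cases "i = j"; cases "i \<in> S"; cases "j \<in> S") (simp_all add: mixed_def F_minus)
qed

lemma propagator_cnj_chron: "propagator (\<lambda>i j z. cnj (chron F i j z))"
  unfolding propagator_def
proof (intro conjI allI)
  show "continuous_on UNIV (\<lambda>z. cnj (chron F i j z))" for i j
    by (rule continuous_on_cnj) (rule propagator_continuous[OF propagator_chron])
  show "cnj (chron F j i (- z)) = cnj (chron F i j z)" for i j z
    unfolding propagator_sym[OF propagator_chron] ..
qed

text \<open>Two uses of \<open>prod_of_diagram\<close>. The resulting kernel is the same for all
  \<open>S\<close>, because \<open>g\<close> is real and the adjoint keeps it; the sum over
  \<open>S\<close> thus acts on the Wick sums alone.\<close>

lemma prod_of_mixed:
  assumes g: "test_function g" and K: "finite K" "S \<subseteq> K"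
    and B: "finite J" "d \<in> kern J UNIV" "finite E" "fst ` E \<subseteq> J" and dj: "K \<inter> J = {}"
  shows "prod_of D (involution (tpow F (interaction n g) (card S)))
      (prod_of F (tpow F (interaction n g) (card K - card S)) (monomial J d E)) =
    diagram (K \<union> J) (\<lambda>x. (\<Prod>i\<in>K. complex_of_real (g (x i))) * d x) (K \<times> {..<n} \<union> E) (mixed J S)"
proof -
  let ?g = "\<lambda>K x. \<Prod>i\<in>K. complex_of_real (g (x i))"
  let ?R = "K - S"
  have fS: "finite S" and fR: "finite ?R" using K finite_subset by auto
  have cR: "card K - card S = card ?R" using K fS by (simp add: card_Diff_subset)
  have s: "fst ` (S \<times> {..<n}) \<subseteq> S" "fst ` (?R \<times> {..<n}) \<subseteq> ?R" "finite (S \<times> {..<n})" "finite (?R \<times> {..<n})"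
    "?R \<inter> J = {}" "S \<inter> (?R \<union> J) = {}" "finite (?R \<union> J)" "finite (?R \<times> {..<n} \<union> E)"
    "fst ` (?R \<times> {..<n} \<union> E) \<subseteq> ?R \<union> J"
    using K B dj fS by auto
  have kS: "?g S \<in> kern S UNIV" and kR: "?g ?R \<in> kern ?R UNIV"
    using kern_interactions[OF g] fS fR by auto
  have inv: "involution (tpow F (interaction n g) (card S)) =
      diagram S (?g S) (S \<times> {..<n}) (\<lambda>i j z. cnj (chron F i j z))"
    unfolding tpow_interaction[OF g fS] involution_diagram[OF propagator_chron] by simp
  have right: "prod_of F (tpow F (interaction n g) (card K - card S)) (monomial J d E) =
      diagram (?R \<union> J) (\<lambda>x. ?g ?R x * d x) (?R \<times> {..<n} \<union> E) (join ?R J F (chron F) (\<lambda>i j z. 0))"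
    unfolding cR tpow_interaction[OF g fR] monomial_diagram[OF B(3)]
    by (rule prod_of_diagram[OF continuous_F propagator_chron propagator_zero kR fR s(4,2) B(2,1,3,4) s(5)])
  have pj: "propagator (join ?R J F (chron F) (\<lambda>i j z. 0))"
    by (rule propagator_join[OF continuous_F propagator_chron propagator_zero s(5)])
  let ?Q = "join S (?R \<union> J) D (\<lambda>i j z. cnj (chron F i j z)) (join ?R J F (chron F) (\<lambda>i j z. 0))"
  have "prod_of D (involution (tpow F (interaction n g) (card S)))
      (prod_of F (tpow F (interaction n g) (card K - card S)) (monomial J d E)) =
    diagram (S \<union> (?R \<union> J)) (\<lambda>x. ?g S x * (?g ?R x * d x)) (S \<times> {..<n} \<union> (?R \<times> {..<n} \<union> E)) ?Q"
    unfolding inv right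
    by (rule prod_of_diagram[OF continuous_D propagator_cnj_chron pj kS fS s(3,1) kern_mult[OF kR B(2)] s(7,8,9,6)])
  also have "\<dots> = diagram (S \<union> (?R \<union> J)) (\<lambda>x. ?g K x * d x) (S \<times> {..<n} \<union> (?R \<times> {..<n} \<union> E)) (mixed J S)"
  proof (rule diagram_cong[OF propagator_join[OF continuous_D propagator_cnj_chron pj s(6)] propagator_mixed])
    show "?g S x * (?g ?R x * d x) = ?g K x * d x" for x
      using prod.subset_diff[OF K(2,1), of "\<lambda>i. complex_of_real (g (x i))"] by (simp add: mult_ac)
    show "?Q a b (x a - x b) = mixed J S a b (x a - x b)"
      if "a \<in> fst ` (S \<times> {..<n} \<union> (?R \<times> {..<n} \<union> E))" "b \<in> fst ` (S \<times> {..<n} \<union> (?R \<times> {..<n} \<union> E))" for x a b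
    proof -
      define R where "R = ?R"
      \<comment> \<open>Each vertex lies in exactly one of \<open>S\<close>, \<open>R\<close> and
        \<open>J\<close>; the nine cases for \<open>a\<close> and \<open>b\<close> compare the
        nested joins with \<open>mixed\<close>.\<close>
      have tri: "(c \<in> S \<and> c \<notin> R \<and> c \<notin> J) \<or> (c \<notin> S \<and> c \<in> R \<and> c \<notin> J) \<or> (c \<notin> S \<and> c \<notin> R \<and> c \<in> J)"
        if "c \<in> K \<union> J" for c using that K(2) dj by (auto simp: R_def)
      have "a \<in> K \<union> J" "b \<in> K \<union> J" using that B(4) K(2) by auto
      from tri[OF this(1)] tri[OF this(2)] have "?Q a b z = mixed J S a b z" for z
        unfolding join_def mixed_def chron_def R_def[symmetric]
        by (elim disjE; cases "a = b"; simp add: F_minus)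
      then show ?thesis .
    qed
  qed
  also have "S \<union> (?R \<union> J) = K \<union> J" using K(2) by auto
  also have "S \<times> {..<n} \<union> (?R \<times> {..<n} \<union> E) = K \<times> {..<n} \<union> E" using K(2) by auto
  finally show ?thesis .
qed

text \<open>The latest vertex may be moved between the anti-time-ordered and the time-ordered factor.\<close>

lemma mixed_insert:
  assumes "i \<notin> S" "i \<notin> J" and late: "\<And>j. j \<in> fst ` E \<Longrightarrow> \<tau> (x j) \<le> \<tau> (x i)"
  shows "wick E (mixed J (insert i S)) \<phi> x = wick E (mixed J S) \<phi> x"
proof (rule wick_cong[OF propagator_mixed propagator_mixed])
  fix a b assume ab: "a \<in> fst ` E" "b \<in> fst ` E"
  \<comment> \<open>With \<open>x i\<close> latest, \<open>F\<close> and its conjugate towards any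
    \<open>x j\<close> become \<open>D\<close> or its reflection, the very propagators that link
    \<open>S\<close> to its complement.\<close>
  have 1: "F (x i - x j) = D (x i - x j)" "F (x j - x i) = D (x i - x j)" "cnj (D (x i - x j)) = D (x j - x i)"
    if "j \<in> fst ` E" for j
  proof -
    show D: "F (x i - x j) = D (x i - x j)" by (rule F_eq_D[OF late[OF that]])
    show "F (x j - x i) = D (x i - x j)" using F_minus[of "x i - x j"] unfolding minus_diff_eq D .
    show "cnj (D (x i - x j)) = D (x j - x i)" using cnj_D[of "x i - x j"] unfolding minus_diff_eq .
  qed
  show "mixed J (insert i S) a b (x a - x b) = mixed J S a b (x a - x b)"
    using assms(1,2) 1[OF ab(1)] 1[OF ab(2)]
    by (cases "a = i"; cases "b = i") (simp_all add: mixed_def)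
qed

lemma sum_wick_mixed_zero:
  assumes K: "finite K" "i \<in> K" "i \<notin> J" and late: "\<And>j. j \<in> fst ` E \<Longrightarrow> \<tau> (x j) \<le> \<tau> (x i)"
  shows "(\<Sum>S\<in>Pow K. (- 1) ^ card S * wick E (mixed J S) \<phi> x) = 0"
  unfolding sum_Pow_insert[OF K(1,2)]
proof (rule sum.neutral, rule ballI)
  fix S assume S: "S \<in> Pow (K - {i})"
  have "finite S" "i \<notin> S" using S K(1) finite_subset by auto
  moreover have "wick E (mixed J (insert i S)) \<phi> x = wick E (mixed J S) \<phi> x"
    by (rule mixed_insert[OF \<open>i \<notin> S\<close> K(3)]) (rule late)
  ultimately show "(- 1) ^ card S * wick E (mixed J S) \<phi> x + (- 1) ^ card (insert i S) * wick E (mixed J (insert i S)) \<phi> x = 0"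
    by simp
qed

text \<open>The retarded product of order \<open>k\<close> without the phases and factorials of the
  S-matrix, which \<open>relative_eq_retarded\<close> restores.\<close>

definition retarded :: "functional \<Rightarrow> functional \<Rightarrow> nat \<Rightarrow> functional" where
  "retarded V B k = (\<lambda>\<phi>. \<Sum>r\<le>k. of_nat (k choose r) * ((- 1) ^ r *
     prod_of D (involution (tpow F V r)) (prod_of F (tpow F V (k - r)) B) \<phi>))"

text \<open>With \<open>K\<close> labelling the interaction vertices, the binomial sum becomes a sum
  over subsets, and the common kernel lets it move under the integral.\<close>

lemma retarded_monomial:
  assumes g: "test_function g" and K: "finite K"
    and B: "finite J" "d \<in> kern J UNIV" "finite E" "fst ` E \<subseteq> J" and dj: "K \<inter> J = {}"
  shows "retarded (interaction n g) (monomial J d E) (card K) \<phi> =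
    (LINT x|vol (K \<union> J). (\<Prod>i\<in>K. complex_of_real (g (x i))) * d x *
       (\<Sum>S\<in>Pow K. (- 1) ^ card S * wick (K \<times> {..<n} \<union> E) (mixed J S) \<phi> x))"
proof -
  let ?E = "K \<times> {..<n} \<union> E"
  let ?c = "\<lambda>x. (\<Prod>i\<in>K. complex_of_real (g (x i))) * d x"
  have c: "?c \<in> kern (K \<union> J) UNIV" by (rule kern_mult[OF kern_interactions[OF g K] B(2)])
  have E: "fst ` ?E \<subseteq> K \<union> J" "finite ?E" using B K by auto
  have fin: "finite (K \<union> J)" using K B by simp
  have int: "integrable (vol (K \<union> J)) (\<lambda>x. ?c x * wick ?E (mixed J S) \<phi> x)" for S
    unfolding wick_def sum_distrib_left mult.assoc[symmetric]
  proof (rule Bochner_Integration.integrable_sum)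
    fix M assume M: "M \<in> matchings ?E"
    have "fst ` (?E - \<Union>M) \<subseteq> K \<union> J" using E(1) by auto
    from kern_integrable[OF kern_legs[OF kern_pairings[OF c propagator_mixed E(1) M] this] fin]
    show "integrable (vol (K \<union> J)) (\<lambda>x. (\<Prod>i\<in>K. complex_of_real (g (x i))) * d x *
        (\<Prod>p\<in>M. pairing (mixed J S) x p) * legs \<phi> (?E - \<Union>M) x)" .
  qed
  have "retarded (interaction n g) (monomial J d E) (card K) \<phi> =
      (\<Sum>S\<in>Pow K. (- 1) ^ card S * prod_of D (involution (tpow F (interaction n g) (card S)))
        (prod_of F (tpow F (interaction n g) (card K - card S)) (monomial J d E)) \<phi>)"
    unfolding retarded_def by (rule sum_Pow_card[OF K, symmetric])
  also have "\<dots> = (\<Sum>S\<in>Pow K. (- 1) ^ card S * (LINT x|vol (K \<union> J). ?c x * wick ?E (mixed J S) \<phi> x))"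
    by (intro sum.cong refl) (simp add: prod_of_mixed[OF g K _ B dj] diagram_def)
  also have "\<dots> = (\<Sum>S\<in>Pow K. LINT x|vol (K \<union> J). (- 1) ^ card S * (?c x * wick ?E (mixed J S) \<phi> x))"
    by simp
  also have "\<dots> = (LINT x|vol (K \<union> J). (\<Sum>S\<in>Pow K. (- 1) ^ card S * (?c x * wick ?E (mixed J S) \<phi> x)))"
    by (rule Bochner_Integration.integral_sum[symmetric]) (intro integrable_mult_right int)
  also have "\<dots> = (LINT x|vol (K \<union> J). ?c x * (\<Sum>S\<in>Pow K. (- 1) ^ card S * wick ?E (mixed J S) \<phi> x))"
    by (simp only: sum_distrib_left mult.left_commute)
  finally show ?thesis .
qed

section \<open>Causality of retarded products\<close>

lemma retarded_add:
  assumes V: "V \<in> polyf U" and A: "A \<in> polyf U" "B \<in> polyf U"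
  shows "retarded V (A + B) k = retarded V A k + retarded V B k"
proof -
  note t = tpow_polyf[OF continuous_F V] and c = prod_of_closed[OF continuous_F]
  have "prod_of D (involution (tpow F V r)) (prod_of F (tpow F V s) (A + B)) =
      prod_of D (involution (tpow F V r)) (prod_of F (tpow F V s) A) +
      prod_of D (involution (tpow F V r)) (prod_of F (tpow F V s) B)" for r s
    unfolding prod_of_add_right[OF continuous_F A t]
    by (rule prod_of_add_right[OF continuous_D c[OF t A(1)] c[OF t A(2)] involution_polyf[OF t]])
  then show ?thesis by (simp add: retarded_def fun_eq_iff distrib_left sum.distrib)
qed

text \<open>The integrands agree point by point: either all interaction points have
  \<open>\<tau> < e\<close>, where the couplings coincide, or a latest one has
  \<open>\<tau> \<ge> e\<close>, is later than all points of \<open>B\<close> and kills the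
  alternating sum for both couplings.\<close>

theorem retarded_causal:
  assumes g: "test_function g" "test_function g'" and B: "B \<in> polyf U"
    and U: "\<And>x. x \<in> U \<Longrightarrow> \<tau> x < e" and eq: "\<And>x. \<tau> x < e \<Longrightarrow> g x = g' x"
  shows "retarded (interaction n g) B k = retarded (interaction n g') B k"
  using B
proof (induction B rule: polyf.induct)
  case (monomial J d E)
  obtain s where s: "\<forall>i\<in>J. i < s" using monomial(1) finite_nat_set_iff_bounded by auto
  \<comment> \<open>Fresh interaction vertices, above all vertices of \<open>J\<close>.\<close>
  define K where "K = {s..<s + k}"
  have K: "finite K" "card K = k" "K \<inter> J = {}" using s by (auto simp: K_def)
  have d: "d \<in> kern J UNIV" by (rule kern_mono[OF subset_UNIV monomial(2)])
  obtain L where L: "L \<subseteq> U" "\<And>x i. d x \<noteq> 0 \<Longrightarrow> i \<in> J \<Longrightarrow> x i \<in> L"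
    by (rule kern_supp[OF monomial(2)]) blast
  let ?h = "\<lambda>\<phi> x. \<Sum>S\<in>Pow K. (- 1) ^ card S * wick (K \<times> {..<n} \<union> E) (mixed J S) \<phi> x"
  have key: "(\<Prod>i\<in>K. complex_of_real (g (x i))) * d x * ?h \<phi> x = (\<Prod>i\<in>K. complex_of_real (g' (x i))) * d x * ?h \<phi> x" for x \<phi>
  proof (cases "d x = 0 \<or> (\<forall>i\<in>K. \<tau> (x i) < e)")
    case True
    then show ?thesis
    proof
      assume "\<forall>i\<in>K. \<tau> (x i) < e"
      then have "(\<Prod>i\<in>K. complex_of_real (g (x i))) = (\<Prod>i\<in>K. complex_of_real (g' (x i)))"
        using eq by (intro prod.cong) (simp_all del: split_paired_All)
      then show ?thesis by simp
    qed simp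
  next
    case False
    then have dx: "d x \<noteq> 0" and late: "\<not> (\<forall>i\<in>K. \<tau> (x i) < e)" by auto
    then have "K \<noteq> {}" by auto
    obtain i where i: "i \<in> K" "\<forall>j\<in>K. \<tau> (x j) \<le> \<tau> (x i)"
      using finite_argmax[OF K(1) \<open>K \<noteq> {}\<close>, of "\<lambda>i. \<tau> (x i)"] by (rule bexE)
    obtain j where "j \<in> K" "\<not> \<tau> (x j) < e" using late by blast
    then have "e \<le> \<tau> (x i)" using bspec[OF i(2), of j] by simp
    moreover have "\<tau> (x j) < e" if "j \<in> J" for j
      using U[OF subsetD[OF L(1) L(2)[OF dx that]]] .
    ultimately have "\<tau> (x j) \<le> \<tau> (x i)" if "j \<in> K \<or> j \<in> J" for j
      using that bspec[OF i(2), of j] by fastforce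
    then have "\<tau> (x j) \<le> \<tau> (x i)" if "j \<in> fst ` (K \<times> {..<n} \<union> E)" for j
      using that monomial(4) by auto
    moreover have "i \<notin> J" using i(1) K(3) by auto
    ultimately have "?h \<phi> x = 0" by (intro sum_wick_mixed_zero[OF K(1) i(1)])
    then show ?thesis by simp
  qed
  show ?case
  proof (rule ext)
    fix \<phi>
    note r = retarded_monomial[OF _ K(1) monomial(1) d monomial(3,4) K(3), of _ n \<phi>, unfolded K(2)]
    show "retarded (interaction n g) (monomial J d E) k \<phi> = retarded (interaction n g') (monomial J d E) k \<phi>"
      unfolding r[OF g(1)] r[OF g(2)] by (simp only: key)
  qed
next
  case (add A B)
  note AB = polyf_mono[OF subset_UNIV add.hyps(1)] polyf_mono[OF subset_UNIV add.hyps(2)]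
  show ?case
    unfolding retarded_add[OF interaction_polyf[OF g(1)] AB] retarded_add[OF interaction_polyf[OF g(2)] AB] add.IH ..
qed

text \<open>Without fixed vertices the latest point is an interaction point as soon as there is
  one.\<close>

theorem retarded_one:
  assumes g: "test_function g" and k: "k > 0"
  shows "retarded (interaction n g) 1 k = 0"
proof (rule ext)
  fix \<phi>
  let ?K = "{..<k}"
  let ?h = "\<lambda>x. \<Sum>S\<in>Pow ?K. (- 1) ^ card S * wick (?K \<times> {..<n} \<union> {}) (mixed {} S) \<phi> x"
  have "?h x = 0" for x
  proof -
    have "?K \<noteq> {}" using k by auto
    then obtain i where i: "i \<in> ?K" "\<forall>j\<in>?K. \<tau> (x j) \<le> \<tau> (x i)"
      using finite_argmax[OF finite_lessThan, of k "\<lambda>i. \<tau> (x i)"] by blast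
    show ?thesis
    proof (rule sum_wick_mixed_zero[OF _ i(1)])
      show "\<tau> (x j) \<le> \<tau> (x i)" if "j \<in> fst ` (?K \<times> {..<n} \<union> {})" for j
        using that bspec[OF i(2), of j] by (auto simp: image_Un split: if_splits)
    qed auto
  qed
  then show "retarded (interaction n g) 1 k \<phi> = 0 \<phi>"
    using retarded_monomial[OF g, of ?K "{}" "\<lambda>x. 1" "{}" n \<phi>] by (simp add: one_eq_monomial kern_one)
qed

end

section \<open>The S-matrices\<close>

lemma prod_of_zero_right:
  "continuous_on UNIV D \<Longrightarrow> A \<in> polyf U \<Longrightarrow> prod_of D A 0 = 0"
  using prod_of_sum_right[of D A U "{}" "\<lambda>_. 0"] by simp

lemma prod_of_zero_left:
  "continuous_on UNIV D \<Longrightarrow> A \<in> polyf U \<Longrightarrow> prod_of D 0 A = 0"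
  using prod_of_sum_left[of D A U "{}" "\<lambda>_. 0"] by simp

text \<open>Pascal's rule, in the form of the induction step for the binomial theorem in
  \<open>tpow_add\<close>.\<close>

lemma sum_choose_step:
  fixes h :: "nat \<Rightarrow> nat \<Rightarrow> complex"
  shows "(\<Sum>j\<le>N. of_nat (N choose j) * (h (Suc j) (N - j) + h j (Suc (N - j)))) =
    (\<Sum>j\<le>Suc N. of_nat (Suc N choose j) * h j (Suc N - j))"
proof -
  have "(\<Sum>j\<le>N. of_nat (N choose j) * h j (Suc (N - j))) = (\<Sum>j\<le>Suc N. of_nat (N choose j) * h j (Suc N - j))"
    by (simp add: Suc_diff_le)
  also have "\<dots> = h 0 (Suc N) + (\<Sum>j\<le>N. of_nat (N choose Suc j) * h (Suc j) (N - j))"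
    by (subst sum.atMost_Suc_shift) simp
  finally have 1: "(\<Sum>j\<le>N. of_nat (N choose j) * h j (Suc (N - j))) = \<dots>" .
  have "(\<Sum>j\<le>Suc N. of_nat (Suc N choose j) * h j (Suc N - j)) =
      h 0 (Suc N) + (\<Sum>j\<le>N. of_nat (Suc N choose Suc j) * h (Suc j) (N - j))"
    by (subst sum.atMost_Suc_shift) simp
  also have "\<dots> = (\<Sum>j\<le>N. of_nat (N choose j) * h (Suc j) (N - j)) +
      (h 0 (Suc N) + (\<Sum>j\<le>N. of_nat (N choose Suc j) * h (Suc j) (N - j)))"
    by (simp add: distrib_right sum.distrib)
  finally show ?thesis unfolding 1[symmetric] by (simp only: distrib_left sum.distrib)
qed

lemma sum_scaled_functionals: "(\<lambda>\<phi>. \<Sum>j\<in>S. c j * X j \<phi>) = (\<Sum>j\<in>S. (\<lambda>\<phi>. c j * X j \<phi> :: complex))"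
  by (rule ext) (simp only: sum_fun_apply)

text \<open>The binomial theorem; evenness of \<open>F\<close> supplies commutativity through
  \<open>prod_of_commute\<close>.\<close>

lemma tpow_add:
  assumes F: "continuous_on UNIV F" "\<And>z. F (- z) = F z" and V: "V \<in> polyf U" and A: "A \<in> polyf U"
  shows "tpow F (V + A) N = (\<lambda>\<phi>. \<Sum>j\<le>N. of_nat (N choose j) * prod_of F (tpow F V j) (tpow F A (N - j)) \<phi>)"
proof (induction N)
  case 0
  show ?case
  proof (rule ext)
    fix \<phi>
    have "tpow F (V + A) 0 \<phi> = prod_of F (tpow F V 0) (tpow F A 0) \<phi>"
      by (simp only: tpow.simps prod_of_one_left[OF F(1) polyf_one])
    then show "tpow F (V + A) 0 \<phi> =
        (\<Sum>j\<le>0. of_nat (0 choose j) * prod_of F (tpow F V j) (tpow F A (0 - j)) \<phi>)" by simp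
  qed
next
  case (Suc N)
  let ?X = "\<lambda>j l. prod_of F (tpow F V j) (tpow F A l)"
  note t = tpow_polyf[OF F(1) V] tpow_polyf[OF F(1) A]
  have X: "?X j l \<in> polyf U" for j l by (rule prod_of_closed[OF F(1) t])
  have comm: "prod_of F P Q = prod_of F Q P" if "P \<in> polyf U" "Q \<in> polyf U" for P Q
    using prod_of_commute[OF F(1) that] by (simp only: F(2))
  have XA: "prod_of F (?X j l) A = ?X j (Suc l)" for j l
    using prod_of_assoc[OF F(1) t A] by simp
  have XV: "prod_of F (?X j l) V = ?X (Suc j) l" for j l
  proof -
    have "prod_of F (?X j l) V = prod_of F (tpow F V j) (prod_of F (tpow F A l) V)"
      by (rule prod_of_assoc[OF F(1) t V])
    also have "\<dots> = prod_of F (tpow F V j) (prod_of F V (tpow F A l))" by (simp only: comm[OF t(2) V])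
    also have "\<dots> = ?X (Suc j) l" using prod_of_assoc[OF F(1) t(1) V t(2)] by simp
    finally show ?thesis .
  qed
  have "tpow F (V + A) (Suc N) = prod_of F (\<Sum>j\<le>N. (\<lambda>\<phi>. of_nat (N choose j) * ?X j (N - j) \<phi>)) (V + A)"
    using Suc.IH by (simp only: tpow.simps sum_scaled_functionals)
  also have "\<dots> = (\<Sum>j\<le>N. prod_of F (\<lambda>\<phi>. of_nat (N choose j) * ?X j (N - j) \<phi>) (V + A))"
    by (rule prod_of_sum_left[OF F(1) polyf.add[OF V A] polyf_scale[OF X]])
  also have "\<dots> = (\<Sum>j\<le>N. (\<lambda>\<phi>. of_nat (N choose j) * (?X (Suc j) (N - j) \<phi> + ?X j (Suc (N - j)) \<phi>)))"
    by (intro sum.cong refl)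
       (simp only: prod_of_scale_left[OF F(1) X polyf.add[OF V A]] prod_of_add_right[OF F(1) V A X] XV XA plus_fun_apply)
  also have "\<dots> = (\<lambda>\<phi>. \<Sum>j\<le>N. of_nat (N choose j) * (?X (Suc j) (N - j) \<phi> + ?X j (Suc (N - j)) \<phi>))"
    by (rule sum_scaled_functionals[symmetric])
  also have "\<dots> = (\<lambda>\<phi>. \<Sum>j\<le>Suc N. of_nat (Suc N choose j) * ?X j (Suc N - j) \<phi>)"
    by (rule ext) (rule sum_choose_step)
  finally show ?case .
qed

definition scoeff :: "(spacetime \<Rightarrow> complex) \<Rightarrow> functional \<Rightarrow> nat \<Rightarrow> functional" where
  "scoeff F A k = (\<lambda>\<phi>. (- \<i>) ^ k / fact k * tpow F A k \<phi>)"

lemma scoeff_polyf: "continuous_on UNIV F \<Longrightarrow> A \<in> polyf U \<Longrightarrow> scoeff F A k \<in> polyf U"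
  unfolding scoeff_def by (intro polyf_scale tpow_polyf)

text \<open>Both sides run over all triples with total \<open>N\<close>; the third index is moved to
  the outer sum.\<close>

lemma sum_triple_swap:
  fixes f :: "nat \<Rightarrow> nat \<Rightarrow> nat \<Rightarrow> complex"
  shows "(\<Sum>r\<le>N. \<Sum>j\<le>N - r. f r j (N - r - j)) = (\<Sum>l\<le>N. \<Sum>r\<le>N - l. f r (N - l - r) l)"
proof -
  have "(\<Sum>r\<le>N. \<Sum>j\<le>N - r. f r j (N - r - j)) = (\<Sum>(r, j)\<in>(SIGMA r:{..N}. {..N - r}). f r j (N - r - j))"
    by (rule sum.Sigma) auto
  also have "\<dots> = (\<Sum>(l, r)\<in>(SIGMA l:{..N}. {..N - l}). f r (N - l - r) l)"
    by (rule sum.reindex_bij_witness[where i = "\<lambda>(l, r). (r, N - l - r)" and j = "\<lambda>(r, j). (N - r - j, r)"]) auto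
  also have "\<dots> = (\<Sum>l\<le>N. \<Sum>r\<le>N - l. f r (N - l - r) l)"
    by (rule sum.Sigma[symmetric]) auto
  finally show ?thesis .
qed

section \<open>Relative S-matrices as series of retarded products\<close>

context causal
begin

text \<open>The adjoint stands where \<open>relative_S\<close> has the inverse, so the causality
  argument needs no inverse; \<open>inv_S_matrix\<close> identifies the two for
  interactions.\<close>

definition relative :: "functional \<Rightarrow> functional \<Rightarrow> nat \<Rightarrow> functional" where
  "relative V A N = (\<Sum>r\<le>N. prod_of D (involution (scoeff F V r)) (scoeff F (V + A) (N - r)))"

text \<open>Expanding the powers of \<open>V + A\<close> gives triples of orders: \<open>r\<close>
  in the adjoint, \<open>j\<close> for \<open>V\<close> and \<open>l\<close> for \<open>A\<close>.
  Collected by \<open>l\<close>, the inner sums are retarded products.\<close>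

lemma relative_eq_retarded:
  assumes V: "V \<in> polyf U" and A: "A \<in> polyf U"
  shows "relative V A N \<phi> =
    (\<Sum>l\<le>N. (- \<i>) ^ N / (fact l * fact (N - l)) * retarded V (tpow F A l) (N - l) \<phi>)"
proof -
  note t = tpow_polyf[OF continuous_F V] tpow_polyf[OF continuous_F A]
  define P where "P r j l = prod_of D (involution (tpow F V r)) (prod_of F (tpow F V j) (tpow F A l))" for r j l
  define f where "f r j l = (- \<i>) ^ N * (- 1) ^ r / (fact r * fact j * fact l) * P r j l \<phi>" for r j l
  have I: "involution (tpow F V r) \<in> polyf U" for r by (rule involution_polyf[OF t(1)])
  have X: "prod_of F (tpow F V j) (tpow F A l) \<in> polyf U" for j l by (rule prod_of_closed[OF continuous_F t])
  have T: "tpow F (V + A) n \<in> polyf U" for n by (rule tpow_polyf[OF continuous_F polyf.add[OF V A]])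
  \<comment> \<open>The adjoint contributes \<open>\<i> ^ r\<close> where the S-matrix has
    \<open>(- \<i>) ^ r\<close>; the ratio is the alternating sign in
    \<open>retarded\<close>.\<close>
  have ph: "\<i> ^ r * (- \<i>) ^ (N - r) = (- \<i>) ^ N * (- 1) ^ r" if "r \<le> N" for r
  proof -
    have "\<i> ^ r = (- 1) ^ r * (- \<i>) ^ r" by (simp flip: power_mult_distrib)
    then show ?thesis using that by (simp add: mult.commute mult.left_commute flip: power_add)
  qed
  have 1: "prod_of D (involution (tpow F V r)) (tpow F (V + A) n) \<phi> =
      (\<Sum>j\<le>n. of_nat (n choose j) * P r j (n - j) \<phi>)" for r n
  proof -
    have "prod_of D (involution (tpow F V r)) (tpow F (V + A) n) =
        (\<Sum>j\<le>n. prod_of D (involution (tpow F V r)) (\<lambda>\<phi>. of_nat (n choose j) * prod_of F (tpow F V j) (tpow F A (n - j)) \<phi>))"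
      unfolding tpow_add[OF continuous_F F_minus V A] sum_scaled_functionals
      by (rule prod_of_sum_right[OF continuous_D I polyf_scale[OF X]])
    also have "\<dots> = (\<Sum>j\<le>n. (\<lambda>\<phi>. of_nat (n choose j) * P r j (n - j) \<phi>))"
      by (intro sum.cong refl) (simp only: prod_of_scale_right[OF continuous_D I X] P_def)
    finally show ?thesis by (simp only: sum_fun_apply)
  qed
  have inv: "involution (scoeff F V r) = (\<lambda>\<phi>. \<i> ^ r / fact r * involution (tpow F V r) \<phi>)" for r
    by (simp add: involution_def scoeff_def)
  have 2: "prod_of D (involution (scoeff F V r)) (scoeff F (V + A) (N - r)) \<phi> = (\<Sum>j\<le>N - r. f r j (N - r - j))"
    if r: "r \<le> N" for r
  proof -
    have "prod_of D (involution (scoeff F V r)) (scoeff F (V + A) (N - r)) \<phi> =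
        \<i> ^ r / fact r * ((- \<i>) ^ (N - r) / fact (N - r) * prod_of D (involution (tpow F V r)) (tpow F (V + A) (N - r)) \<phi>)"
      unfolding inv unfolding scoeff_def
      by (simp only: prod_of_scale_left[OF continuous_D I polyf_scale[OF T]] prod_of_scale_right[OF continuous_D I T])
    also have "\<dots> = (\<Sum>j\<le>N - r. \<i> ^ r / fact r * ((- \<i>) ^ (N - r) / fact (N - r) *
        (of_nat (N - r choose j) * P r j (N - r - j) \<phi>)))"
      unfolding 1 by (simp only: sum_distrib_left)
    also have "\<dots> = (\<Sum>j\<le>N - r. f r j (N - r - j))"
    proof (rule sum.cong[OF refl])
      fix j assume "j \<in> {..N - r}"
      then have "(of_nat (N - r choose j) :: complex) = fact (N - r) / (fact j * fact (N - r - j))"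
        by (intro binomial_fact) simp
      then show "\<i> ^ r / fact r * ((- \<i>) ^ (N - r) / fact (N - r) * (of_nat (N - r choose j) * P r j (N - r - j) \<phi>)) =
          f r j (N - r - j)"
        unfolding f_def ph[OF r, symmetric] by (simp add: mult.assoc)
    qed
    finally show ?thesis .
  qed
  have 3: "(- \<i>) ^ N / (fact l * fact (N - l)) * retarded V (tpow F A l) (N - l) \<phi> = (\<Sum>r\<le>N - l. f r (N - l - r) l)" for l
    unfolding retarded_def sum_distrib_left
  proof (rule sum.cong[OF refl])
    fix r assume "r \<in> {..N - l}"
    then have b: "(of_nat (N - l choose r) :: complex) = fact (N - l) / (fact r * fact (N - l - r))"
      by (intro binomial_fact) simp
    show "(- \<i>) ^ N / (fact l * fact (N - l)) * (of_nat (N - l choose r) * ((- 1) ^ r *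
        prod_of D (involution (tpow F V r)) (prod_of F (tpow F V (N - l - r)) (tpow F A l)) \<phi>)) = f r (N - l - r) l"
      unfolding f_def P_def[symmetric] b by (simp add: mult_ac)
  qed
  have "relative V A N \<phi> = (\<Sum>r\<le>N. \<Sum>j\<le>N - r. f r j (N - r - j))"
    unfolding relative_def sum_fun_apply using 2 by simp
  also have "\<dots> = (\<Sum>l\<le>N. \<Sum>r\<le>N - l. f r (N - l - r) l)" by (rule sum_triple_swap)
  finally show ?thesis unfolding 3 .
qed

lemma relative_causal:
  assumes g: "test_function g" "test_function g'" and A: "A \<in> polyf U"
    and U: "\<And>x. x \<in> U \<Longrightarrow> \<tau> x < e" and eq: "\<And>x. \<tau> x < e \<Longrightarrow> g x = g' x"
  shows "relative (interaction n g) A N = relative (interaction n g') A N"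
proof (rule ext)
  fix \<phi>
  have A': "A \<in> polyf UNIV" by (rule polyf_mono[OF subset_UNIV A])
  show "relative (interaction n g) A N \<phi> = relative (interaction n g') A N \<phi>"
    unfolding relative_eq_retarded[OF interaction_polyf[OF g(1)] A'] relative_eq_retarded[OF interaction_polyf[OF g(2)] A']
    by (simp only: retarded_causal[OF g tpow_polyf[OF continuous_F A] U eq])
qed

text \<open>For \<open>A = 0\<close> only \<open>l = 0\<close> survives, with
  \<open>tpow F 0 0 = 1\<close>, and \<open>retarded_one\<close> removes the positive orders. Each
  instance of the locale gives one half of unitarity.\<close>

lemma relative_zero:
  assumes g: "test_function g"
  shows "relative (interaction n g) 0 N = (if N = 0 then 1 else 0)"
proof (rule ext)
  fix \<phi>
  let ?V = "interaction n g"
  note V = interaction_polyf[OF g, of n]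
  note t = tpow_polyf[OF continuous_F V]
  have "tpow F 0 (Suc l) = 0" for l
    using prod_of_zero_right[OF continuous_F tpow_polyf[OF continuous_F polyf_zero]] by simp
  then have t0: "tpow F 0 l = 0" if "l \<noteq> 0" for l using that by (cases l) auto
  have "prod_of D (involution (tpow F ?V r)) (prod_of F (tpow F ?V s) 0) = 0" for r s
    by (simp only: prod_of_zero_right[OF continuous_F t] prod_of_zero_right[OF continuous_D involution_polyf[OF t]])
  then have r0: "retarded ?V 0 k \<phi> = 0" for k by (simp add: retarded_def)
  have "relative ?V 0 N \<phi> = (\<Sum>l\<le>N. if l = 0 then (- \<i>) ^ N / fact N * retarded ?V 1 N \<phi> else 0)"
    unfolding relative_eq_retarded[OF V polyf_zero] by (intro sum.cong refl) (auto simp: t0 r0)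
  also have "\<dots> = (- \<i>) ^ N / fact N * retarded ?V 1 N \<phi>" by simp
  also have "\<dots> = (if N = 0 then 1 else 0)"
  proof (cases "N = 0")
    case True
    have "involution 1 = 1" by (simp add: involution_def fun_eq_iff)
    then have "prod_of D (involution (tpow F ?V 0)) (prod_of F (tpow F ?V 0) 1) = 1"
      by (simp only: tpow.simps prod_of_one_left[OF continuous_F polyf_one] prod_of_one_left[OF continuous_D polyf_one])
    then have "prod_of D (involution (tpow F ?V 0)) (prod_of F (tpow F ?V 0) 1) \<phi> = 1"
      by (rule fun_cong[THEN trans]) simp
    then have "retarded ?V 1 0 \<phi> = 1" unfolding retarded_def by simp
    then show ?thesis using True by simp
  qed (simp add: retarded_one[OF g])
  finally show "relative ?V 0 N \<phi> = (if N = 0 then 1 else 0) \<phi>" by simp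
qed

end

section \<open>The star algebra of formal power series\<close>

lemma star_eq_prod_of: "star m lam = prod_of (Delta_plus m lam)"
  by (intro ext) (simp add: star_def prod_of_def)

lemma pow_T_monoid: "A [^]\<^bsub>T_monoid m lam\<^esub> k = tpow (Delta_F m lam) A k"
  by (induction k) (simp_all add: nat_pow_def T_monoid_def T_prod_def prod_of_def)

lemma S_matrix_nth: "fps_nth (S_matrix m lam A) k = scoeff (Delta_F m lam) A k"
  by (simp add: S_matrix_def scoeff_def pow_T_monoid)

lemma (in monoid) inv_eqI:
  assumes "x \<in> carrier G" "y \<in> carrier G" "x \<otimes> y = \<one>" "y \<otimes> x = \<one>"
  shows "inv x = y"
proof -
  have "x \<in> Units G" using assms unfolding Units_def by blast
  then show ?thesis using inv_unique[of "inv x" x y] assms by simp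
qed

context
  fixes m lam :: real
  assumes m: "m > 0" and lam: "lam > 0"
begin

abbreviation (input) G where "G \<equiv> star_alg m lam"

abbreviation (input) star_mult (infixl "\<odot>" 70) where "X \<odot> Y \<equiv> X \<otimes>\<^bsub>G\<^esub> Y"

interpretation ret: causal "Delta_plus m lam" "Delta_F m lam" fst
proof
  show "continuous_on UNIV (Delta_plus m lam)" by (rule continuous_Delta_plus[OF m lam])
  show "continuous_on UNIV (Delta_F m lam)" by (rule continuous_Delta_F[OF m lam])
  show "cnj (Delta_plus m lam z) = Delta_plus m lam (- z)" for z by (rule cnj_Delta_plus[OF m lam])
  show "Delta_F m lam (- z) = Delta_F m lam z" for z by (rule Delta_F_minus[OF m lam])
  show "Delta_F m lam (x - y) = Delta_plus m lam (x - y)" if "fst y \<le> fst x" for x y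
    by (rule Delta_F_future[OF m lam]) (use that in simp)
qed

text \<open>Advanced products are retarded products for the reversed time and the opposite star product.\<close>

interpretation adv: causal "\<lambda>z. Delta_plus m lam (- z)" "Delta_F m lam" "\<lambda>x. - fst x"
proof
  show "continuous_on UNIV (\<lambda>z. Delta_plus m lam (- z))" by (rule ret.continuous_D_minus)
  show "continuous_on UNIV (Delta_F m lam)" by (rule ret.continuous_F)
  show "cnj (Delta_plus m lam (- z)) = Delta_plus m lam (- (- z))" for z by (rule ret.cnj_D)
  show "Delta_F m lam (- z) = Delta_F m lam z" for z by (rule ret.F_minus)
  show "Delta_F m lam (x - y) = Delta_plus m lam (- (x - y))" if "- fst y \<le> - fst x" for x y
    by (rule Delta_F_past[OF m lam]) (use that in simp)
qed

section \<open>Monoid structure and involution\<close>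

lemma carrier_iff: "X \<in> carrier G \<longleftrightarrow> (\<forall>k. fps_nth X k \<in> polyf UNIV)"
  by (simp add: star_alg_def local_alg_UNIV)

lemma carrierD: "X \<in> carrier G \<Longrightarrow> fps_nth X k \<in> polyf UNIV"
  by (simp add: carrier_iff)

lemma mult_nth: "fps_nth (X \<odot> Y) k = (\<Sum>i\<le>k. prod_of (Delta_plus m lam) (fps_nth X i) (fps_nth Y (k - i)))"
  by (simp add: star_alg_def fps_star_def star_eq_prod_of)

lemma one_star_alg: "\<one>\<^bsub>G\<^esub> = 1"
  by (simp add: star_alg_def)

lemma one_nth: "fps_nth \<one>\<^bsub>G\<^esub> k = (if k = 0 then 1 else 0)"
  by (simp add: one_star_alg)

text \<open>The laws hold coefficientwise by bilinearity, unit and associativity of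
  \<open>prod_of\<close>; for the Cauchy sums of a triple product the index reshuffling is
  \<open>fps_mult_assoc_lemma\<close>.\<close>

lemma monoid_star_alg: "monoid G"
proof (rule monoidI)
  note D = ret.continuous_D
  show closed: "X \<odot> Y \<in> carrier G" if "X \<in> carrier G" "Y \<in> carrier G" for X Y
    unfolding carrier_iff mult_nth by (intro allI polyf_sum prod_of_closed[OF D] carrierD that)
  show "\<one>\<^bsub>G\<^esub> \<in> carrier G" unfolding carrier_iff one_nth by (simp add: polyf_one polyf_zero)
  show "\<one>\<^bsub>G\<^esub> \<odot> X = X" if X: "X \<in> carrier G" for X
  proof (rule fps_ext)
    fix k
    have "fps_nth (\<one>\<^bsub>G\<^esub> \<odot> X) k = (\<Sum>i\<le>k. if i = 0 then fps_nth X k else 0)"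
      unfolding mult_nth one_nth
      by (intro sum.cong refl)
         (simp add: prod_of_one_left[OF D carrierD[OF X]] prod_of_zero_left[OF D carrierD[OF X]])
    then show "fps_nth (\<one>\<^bsub>G\<^esub> \<odot> X) k = fps_nth X k" by simp
  qed
  show "X \<odot> \<one>\<^bsub>G\<^esub> = X" if X: "X \<in> carrier G" for X
  proof (rule fps_ext)
    fix k
    have "fps_nth (X \<odot> \<one>\<^bsub>G\<^esub>) k = (\<Sum>i\<le>k. if i = k then fps_nth X k else 0)"
      unfolding mult_nth one_nth
      by (intro sum.cong refl)
         (simp add: prod_of_one_right[OF D carrierD[OF X]] prod_of_zero_right[OF D carrierD[OF X]])
    then show "fps_nth (X \<odot> \<one>\<^bsub>G\<^esub>) k = fps_nth X k" by simp
  qed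
  show "(X \<odot> Y) \<odot> Z = X \<odot> (Y \<odot> Z)"
    if XYZ: "X \<in> carrier G" "Y \<in> carrier G" "Z \<in> carrier G" for X Y Z
  proof (rule fps_ext)
    fix k
    let ?p = "prod_of (Delta_plus m lam)"
    note c = carrierD[OF XYZ(1)] carrierD[OF XYZ(2)] carrierD[OF XYZ(3)]
    have "fps_nth ((X \<odot> Y) \<odot> Z) k =
        (\<Sum>i\<le>k. \<Sum>j\<le>i. ?p (?p (fps_nth X j) (fps_nth Y (i - j))) (fps_nth Z (k - i)))"
      unfolding mult_nth
      by (intro sum.cong refl) (rule prod_of_sum_left[OF D c(3) prod_of_closed[OF D c(1,2)]])
    also have "\<dots> = (\<Sum>i\<le>k. \<Sum>j\<le>i. ?p (fps_nth X j) (?p (fps_nth Y (i - j)) (fps_nth Z (k - i))))"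
      by (simp only: prod_of_assoc[OF D c])
    also have "\<dots> = (\<Sum>i\<le>k. \<Sum>j\<le>k - i. ?p (fps_nth X i) (?p (fps_nth Y j) (fps_nth Z (k - i - j))))"
      using fps_mult_assoc_lemma[where k = k and n = k and f = "\<lambda>a b c. ?p (fps_nth X a) (?p (fps_nth Y b) (fps_nth Z c))"]
      by (simp add: atLeast0AtMost)
    also have "\<dots> = fps_nth (X \<odot> (Y \<odot> Z)) k"
      unfolding mult_nth
      by (intro sum.cong refl) (rule prod_of_sum_right[OF D c(1) prod_of_closed[OF D c(2,3)], symmetric])
    finally show "fps_nth ((X \<odot> Y) \<odot> Z) k = fps_nth (X \<odot> (Y \<odot> Z)) k" .
  qed
qed

lemma involution_carrier: "X \<in> carrier G \<Longrightarrow> fps_involution X \<in> carrier G"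
  by (simp add: carrier_iff fps_involution_def involution_polyf)

lemma involution_involution: "fps_involution (fps_involution X) = X"
  by (simp add: fps_involution_def involution_def fps_eq_iff)

lemma involution_sum: "involution (\<Sum>a\<in>S. A a) = (\<Sum>a\<in>S. involution (A a))"
  by (rule ext) (simp add: involution_def sum_fun_apply)

text \<open>Conjugation reflects \<open>Delta_plus\<close>, and exchanging the factors undoes the
  reflection; hence the order reverses.\<close>

lemma involution_mult:
  assumes X: "X \<in> carrier G" and Y: "Y \<in> carrier G"
  shows "fps_involution (X \<odot> Y) = fps_involution Y \<odot> fps_involution X"
proof (rule fps_ext)
  fix k
  note D = ret.continuous_D
  note c = carrierD[OF X] carrierD[OF Y]
  have p: "involution (prod_of (Delta_plus m lam) (fps_nth X i) (fps_nth Y j)) =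
      prod_of (Delta_plus m lam) (involution (fps_nth Y j)) (involution (fps_nth X i))" for i j
  proof -
    have "involution (prod_of (Delta_plus m lam) (fps_nth X i) (fps_nth Y j)) =
        prod_of (\<lambda>z. Delta_plus m lam (- z)) (involution (fps_nth X i)) (involution (fps_nth Y j))"
      unfolding involution_prod_of[OF D c] by (simp only: ret.cnj_D)
    also have "\<dots> = prod_of (Delta_plus m lam) (involution (fps_nth Y j)) (involution (fps_nth X i))"
      unfolding prod_of_commute[OF D involution_polyf[OF c(2)] involution_polyf[OF c(1)]] ..
    finally show ?thesis .
  qed
  have "fps_nth (fps_involution (X \<odot> Y)) k =
      (\<Sum>i\<le>k. prod_of (Delta_plus m lam) (involution (fps_nth Y (k - i))) (involution (fps_nth X i)))"
    by (simp add: fps_involution_def mult_nth involution_sum p)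
  also have "\<dots> = (\<Sum>i\<le>k. prod_of (Delta_plus m lam) (involution (fps_nth Y i)) (involution (fps_nth X (k - i))))"
    by (rule sum.reindex_bij_witness[where i = "\<lambda>i. k - i" and j = "\<lambda>i. k - i"]) auto
  finally show "fps_nth (fps_involution (X \<odot> Y)) k = fps_nth (fps_involution Y \<odot> fps_involution X) k"
    by (simp add: fps_involution_def mult_nth)
qed

section \<open>Unitarity of S-matrices\<close>

lemma S_matrix_carrier: "A \<in> polyf UNIV \<Longrightarrow> S_matrix m lam A \<in> carrier G"
  unfolding carrier_iff S_matrix_nth by (intro allI scoeff_polyf ret.continuous_F)

lemma retarded_series:
  "fps_nth (fps_involution (S_matrix m lam V) \<odot> S_matrix m lam (V + A)) k = ret.relative V A k"
  by (simp add: mult_nth ret.relative_def S_matrix_nth fps_involution_def)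

lemma advanced_series:
  assumes V: "V \<in> polyf UNIV" and A: "A \<in> polyf UNIV"
  shows "fps_nth (S_matrix m lam (V + A) \<odot> fps_involution (S_matrix m lam V)) k = adv.relative V A k"
proof -
  let ?s = "scoeff (Delta_F m lam)"
  note s = scoeff_polyf[OF ret.continuous_F polyf.add[OF V A]] involution_polyf[OF scoeff_polyf[OF ret.continuous_F V]]
  have "fps_nth (S_matrix m lam (V + A) \<odot> fps_involution (S_matrix m lam V)) k =
      (\<Sum>i\<le>k. prod_of (\<lambda>z. Delta_plus m lam (- z)) (involution (?s V (k - i))) (?s (V + A) i))"
    by (simp add: mult_nth S_matrix_nth fps_involution_def prod_of_commute[OF ret.continuous_D s])
  also have "\<dots> = adv.relative V A k"
    unfolding adv.relative_def
    by (rule sum.reindex_bij_witness[where i = "\<lambda>i. k - i" and j = "\<lambda>i. k - i"]) auto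
  finally show ?thesis .
qed

text \<open>The adjoint is a left inverse by the retarded instance and a right inverse by the
  advanced one.\<close>

lemma S_matrix_unitary:
  assumes g: "test_function g"
  shows "fps_involution (S_matrix m lam (interaction n g)) \<odot> S_matrix m lam (interaction n g) = \<one>\<^bsub>G\<^esub>"
    and "S_matrix m lam (interaction n g) \<odot> fps_involution (S_matrix m lam (interaction n g)) = \<one>\<^bsub>G\<^esub>"
proof -
  note V = interaction_polyf[OF g, of n]
  show "fps_involution (S_matrix m lam (interaction n g)) \<odot> S_matrix m lam (interaction n g) = \<one>\<^bsub>G\<^esub>"
    using retarded_series[of "interaction n g" 0] ret.relative_zero[OF g, of n]
    by (intro fps_ext) (simp add: one_nth)
  show "S_matrix m lam (interaction n g) \<odot> fps_involution (S_matrix m lam (interaction n g)) = \<one>\<^bsub>G\<^esub>"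
    using advanced_series[OF V polyf_zero] adv.relative_zero[OF g, of n]
    by (intro fps_ext) (simp add: one_nth)
qed

lemma inv_S_matrix:
  assumes g: "test_function g"
  shows "inv\<^bsub>G\<^esub> (S_matrix m lam (interaction n g)) = fps_involution (S_matrix m lam (interaction n g))"
  by (intro monoid.inv_eqI[OF monoid_star_alg] S_matrix_unitary[OF g] involution_carrier
      S_matrix_carrier[OF interaction_polyf[OF g]])

section \<open>Change of the coupling in the future and in the past\<close>

lemma relative_S_causal:
  assumes eps: "A \<in> local_alg (time_slab \<epsilon>)" and g: "test_function g" "test_function g'"
    and supp: "supp (\<lambda>x. g x - g' x) \<subseteq> {x. fst x \<ge> \<epsilon>}"
  shows "relative_S m lam (interaction n g) A = relative_S m lam (interaction n g') A"
proof (rule fps_ext)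
  fix k
  have "g x = g' x" if "fst x < \<epsilon>" for x
    using notin_supp[of x "\<lambda>x. g x - g' x"] subsetD[OF supp, of x] that by auto
  then have "ret.relative (interaction n g) A k = ret.relative (interaction n g') A k"
    by (intro ret.relative_causal[OF g local_alg_polyf[OF eps], of \<epsilon>]) (auto simp: time_slab_def)
  then show "fps_nth (relative_S m lam (interaction n g) A) k = fps_nth (relative_S m lam (interaction n g') A) k"
    unfolding relative_S_def inv_S_matrix[OF g(1)] inv_S_matrix[OF g(2)] retarded_series .
qed

text \<open>With the inverse on the right the product is advanced, so it ignores changes of the
  coupling in the past.\<close>

lemma S_matrix_advanced:
  assumes eps: "A \<in> local_alg (time_slab \<epsilon>)" and g: "test_function g" "test_function g'"
    and supp: "supp (\<lambda>x. g x - g' x) \<subseteq> {x. fst x \<le> - \<epsilon>}"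
  shows "S_matrix m lam (interaction n g + A) \<odot> inv\<^bsub>G\<^esub> (S_matrix m lam (interaction n g)) =
    S_matrix m lam (interaction n g' + A) \<odot> inv\<^bsub>G\<^esub> (S_matrix m lam (interaction n g'))"
proof (rule fps_ext)
  fix k
  note A = polyf_mono[OF subset_UNIV local_alg_polyf[OF eps]]
  have "g x = g' x" if "- fst x < \<epsilon>" for x
    using notin_supp[of x "\<lambda>x. g x - g' x"] subsetD[OF supp, of x] that by auto
  then have "adv.relative (interaction n g) A k = adv.relative (interaction n g') A k"
    by (intro adv.relative_causal[OF g local_alg_polyf[OF eps], of \<epsilon>]) (auto simp: time_slab_def)
  then show "fps_nth (S_matrix m lam (interaction n g + A) \<odot> inv\<^bsub>G\<^esub> (S_matrix m lam (interaction n g))) k =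
    fps_nth (S_matrix m lam (interaction n g' + A) \<odot> inv\<^bsub>G\<^esub> (S_matrix m lam (interaction n g'))) k"
    unfolding inv_S_matrix[OF g(1)] inv_S_matrix[OF g(2)]
      advanced_series[OF interaction_polyf[OF g(1)] A] advanced_series[OF interaction_polyf[OF g(2)] A] .
qed

lemma W_op_unitary:
  assumes g: "test_function g" "test_function g'"
  shows "W_op m lam n g g' \<in> carrier G"
    and "inv\<^bsub>G\<^esub> (W_op m lam n g g') =
      inv\<^bsub>G\<^esub> (S_matrix m lam (interaction n g)) \<odot> S_matrix m lam (interaction n g')"
    and "star_unitary m lam (W_op m lam n g g')"
proof -
  interpret monoid G by (rule monoid_star_alg)
  let ?S = "S_matrix m lam (interaction n g)" and ?S' = "S_matrix m lam (interaction n g')"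
  let ?T = "fps_involution ?S" and ?T' = "fps_involution ?S'"
  have c [simp]: "?S \<in> carrier G" "?S' \<in> carrier G" "?T \<in> carrier G" "?T' \<in> carrier G"
    using S_matrix_carrier[OF interaction_polyf] involution_carrier g by auto
  note u = S_matrix_unitary[OF g(1), of n] S_matrix_unitary[OF g(2), of n]
  have W: "W_op m lam n g g' = ?T' \<odot> ?S" unfolding W_op_def inv_S_matrix[OF g(2)] ..
  show Wc: "W_op m lam n g g' \<in> carrier G" unfolding W by simp
  have W': "fps_involution (W_op m lam n g g') = ?T \<odot> ?S'"
    unfolding W involution_mult[OF c(4,1)] involution_involution ..
  have "(?T \<odot> ?S') \<odot> (?T' \<odot> ?S) = ?T \<odot> (?S' \<odot> ?T') \<odot> ?S"
    by (simp only: m_assoc c m_closed)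
  then have 1: "(?T \<odot> ?S') \<odot> (?T' \<odot> ?S) = \<one>\<^bsub>G\<^esub>"
    by (simp only: u c r_one)
  have "(?T' \<odot> ?S) \<odot> (?T \<odot> ?S') = ?T' \<odot> (?S \<odot> ?T) \<odot> ?S'"
    by (simp only: m_assoc c m_closed)
  then have 2: "(?T' \<odot> ?S) \<odot> (?T \<odot> ?S') = \<one>\<^bsub>G\<^esub>"
    by (simp only: u c r_one)
  show "inv\<^bsub>G\<^esub> (W_op m lam n g g') = inv\<^bsub>G\<^esub> ?S \<odot> ?S'"
    unfolding W inv_S_matrix[OF g(1)] by (rule inv_eqI) (simp_all only: c m_closed 1 2)
  show "star_unitary m lam (W_op m lam n g g')"
    unfolding star_unitary_def W' using Wc 1 2 unfolding W by blast
qed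

text \<open>Inserting \<open>S \<odot> T\<close>-type units around \<open>R\<close> exhibits the
  advanced product: \<open>T \<odot> R = T \<odot> (R \<odot> T) \<odot> S\<close>. There
  \<open>R \<odot> T\<close> may be exchanged for \<open>R' \<odot> T'\<close>, and
  \<open>S' \<odot> T'\<close> is inserted in front of it to form \<open>W_op\<close> and its
  inverse.\<close>

lemma relative_S_conjugate:
  assumes eps: "A \<in> local_alg (time_slab \<epsilon>)" and g: "test_function g" "test_function g'"
    and supp: "supp (\<lambda>x. g x - g' x) \<subseteq> {x. fst x \<le> - \<epsilon>}"
  shows "relative_S m lam (interaction n g) A =
    inv\<^bsub>G\<^esub> (W_op m lam n g g') \<odot> relative_S m lam (interaction n g') A \<odot> W_op m lam n g g'"
proof -
  interpret monoid G by (rule monoid_star_alg)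
  note A = polyf_mono[OF subset_UNIV local_alg_polyf[OF eps]]
  define S where "S = S_matrix m lam (interaction n g)"
  define S' where "S' = S_matrix m lam (interaction n g')"
  define R where "R = S_matrix m lam (interaction n g + A)"
  define R' where "R' = S_matrix m lam (interaction n g' + A)"
  define T where "T = inv\<^bsub>G\<^esub> S"
  define T' where "T' = inv\<^bsub>G\<^esub> S'"
  have c: "S \<in> carrier G" "S' \<in> carrier G" "R \<in> carrier G" "R' \<in> carrier G" "T \<in> carrier G" "T' \<in> carrier G"
    using S_matrix_carrier interaction_polyf[OF g(1)] interaction_polyf[OF g(2)] A involution_carrier
    unfolding S_def S'_def R_def R'_def T_def T'_def inv_S_matrix[OF g(1)] inv_S_matrix[OF g(2)]
    by (auto intro: polyf.add)
  have u: "T \<odot> S = \<one>\<^bsub>G\<^esub>" "S' \<odot> T' = \<one>\<^bsub>G\<^esub>"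
    unfolding T_def T'_def S_def S'_def inv_S_matrix[OF g(1)] inv_S_matrix[OF g(2)]
    using S_matrix_unitary[OF g(1)] S_matrix_unitary[OF g(2)] by auto
  have RT: "R \<odot> T = R' \<odot> T'"
    unfolding R_def T_def R'_def T'_def S_def S'_def by (rule S_matrix_advanced[OF eps g supp])
  have "inv\<^bsub>G\<^esub> (W_op m lam n g g') \<odot> relative_S m lam (interaction n g') A \<odot> W_op m lam n g g' =
      (T \<odot> S') \<odot> (T' \<odot> R') \<odot> (T' \<odot> S)"
    unfolding W_op_unitary(2)[OF g] unfolding W_op_def relative_S_def T_def T'_def S_def S'_def R'_def ..
  also have "\<dots> = T \<odot> ((S' \<odot> T') \<odot> (R' \<odot> T')) \<odot> S"
    by (simp only: m_assoc c m_closed)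
  also have "\<dots> = T \<odot> (R \<odot> T) \<odot> S"
    by (simp only: u RT l_one c m_closed)
  also have "\<dots> = T \<odot> R \<odot> (T \<odot> S)"
    by (simp only: m_assoc c m_closed)
  also have "\<dots> = T \<odot> R" by (simp only: u r_one c m_closed)
  finally show ?thesis unfolding relative_S_def T_def R_def S_def by simp
qed

end

theorem proposition5p1:
  fixes m lam \<epsilon> :: real and n :: nat
    and g g' :: "spacetime \<Rightarrow> real" and A :: functional
  assumes "m > 0" and "lam > 0" and "\<epsilon> > 0"
    and "A \<in> local_alg (time_slab \<epsilon>)"
    and "test_function g" and "test_function g'"
  shows "(supp (\<lambda>x. g x - g' x) \<subseteq> {x. fst x \<ge> \<epsilon>} \<longrightarrow>
            relative_S m lam (interaction n g) A = relative_S m lam (interaction n g') A) \<and>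
         (supp (\<lambda>x. g x - g' x) \<subseteq> {x. fst x \<le> - \<epsilon>} \<longrightarrow>
            relative_S m lam (interaction n g) A =
              inv\<^bsub>star_alg m lam\<^esub> (W_op m lam n g g') \<otimes>\<^bsub>star_alg m lam\<^esub>
              relative_S m lam (interaction n g') A \<otimes>\<^bsub>star_alg m lam\<^esub> W_op m lam n g g') \<and>
         star_unitary m lam (W_op m lam n g g')"
proof (intro conjI impI)
  show "relative_S m lam (interaction n g) A = relative_S m lam (interaction n g') A"
    if "supp (\<lambda>x. g x - g' x) \<subseteq> {x. fst x \<ge> \<epsilon>}"
    by (rule relative_S_causal[OF assms(1,2,4,5,6) that])
  show "relative_S m lam (interaction n g) A =
      inv\<^bsub>star_alg m lam\<^esub> (W_op m lam n g g') \<otimes>\<^bsub>star_alg m lam\<^esub>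
      relative_S m lam (interaction n g') A \<otimes>\<^bsub>star_alg m lam\<^esub> W_op m lam n g g'"
    if "supp (\<lambda>x. g x - g' x) \<subseteq> {x. fst x \<le> - \<epsilon>}"
    by (rule relative_S_conjugate[OF assms(1,2,4,5,6) that])
  show "star_unitary m lam (W_op m lam n g g')"
    by (rule W_op_unitary(3)[OF assms(1,2,5,6)])
qed

end
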